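(* (i) Let $M$ be a Garside monoid, let $\Sigma$ be a generating subset of $M$, and let $f$ be an lcm selector on $\Sigma$. Then $f$ is a reversing function on $\Sigma$, it satisfies the conditions $( ** )$, and $M$ admits the (complemented) presentation $\langle \Sigma\,;\,R_f\rangle^{+}$. (ii) Conversely, let $f$ be a reversing function on a set $\Sigma$ that satisfies the conditions $( ** )$. Then the monoid $\langle \Sigma\,;\,R_f\rangle^{+}$ is a Garside monoid, and $f$ is an lcm selector on $\Sigma$.
   Context: Divisibility. In a monoid $M$, $x$ is a left divisor of $y$ (and $y$ a right multiple of $x$) if $xz=y$ for some $z\in M$; right divisors and left multiples are symmetric. A right lcm of $x,y$ is a common right multiple that is a left divisor of every common right multiple; a left gcd is a common left divisor that is a right multiple of every common left divisor; left lcm's and right gcd's are symmetric. An atom is an element $x\ne1$ such that $x=yz$ implies $y=1$ or $z=1$. $M$ is atomic if it is generated by its atoms and, for every $x$, the lengths of the expressions of $x$ as a product of atoms are bounded. $M$ is Gaussian if it is atomic, left and right cancellative, and any two elements admit right and left lcm's and gcd's. A Garside element in $M$ is an element $\Delta$ whose left divisors coincide with its right divisors, are finite in number and generate $M$. A Garside monoid is a Gaussian monoid that contains a Garside element. In a Gaussian monoid the right lcm $x\vee y$ is unique and $x\backslash y$ denotes the unique element with $x\vee y=x\,(x\backslash y)$. Words. $\mathrm{Mo}(\Sigma)$ is the free monoid on $\Sigma$ and $\varepsilon$ is the empty word. An lcm selector on a generating subset $\Sigma$ of $M$ is a partial map $f$ from $\Sigma\times\Sigma$ to $\mathrm{Mo}(\Sigma)$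 such that, for $a,b\in\Sigma$, $f(a,b)$ is a word representing $a\backslash b$ whenever the latter exists (which is always the case in a Gaussian monoid). A reversing function on a nonempty set $\Sigma$ is a partial map $f:\Sigma\times\Sigma\to\mathrm{Mo}(\Sigma)$ with $f(a,a)=\varepsilon$ for every $a\in\Sigma$ and with symmetric domain; $R_f$ is the family of relations $a f(a,b)=b f(b,a)$ for $(a,b)\in\mathrm{Dom}(f)$; $\langle\Sigma;R_f\rangle^+$ is the monoid presented by $\Sigma$ and $R_f$ (a presentation of this form is called complemented); and $\equiv_f^+$ is the congruence on $\mathrm{Mo}(\Sigma)$ generated by $R_f$. Reversing. Let $\Sigma^{-1}$ be a disjoint copy $\{a^{-1}:a\in\Sigma\}$ of $\Sigma$; $w^{-1}$ is obtained from a word $w$ on $\Sigma\cup\Sigma^{-1}$ by exchanging $a$ and $a^{-1}$ and reversing the order of the letters. Write $w\to_f w'$ if $w$ can be transformed into $w'$ in finitely many steps (possibly none), each replacing a subword $a^{-1}b$ with $a,b\in\Sigma$ by $f(a,b)f(b,a)^{-1}$. For $u,v\in\mathrm{Mo}(\Sigma)$, if there are words $u',v'\in\mathrm{Mo}(\Sigma)$ with $u^{-1}v\to_f v'u'^{-1}$, they are unique, and one sets $u\backslash_f v=v'$ (so that $v\backslash_f u=u'$) and $u\vee_f v=u\,(u\backslash_f v)$; otherwise $u\backslash_f v$ is undefined, written $u\backslash_f v=\bot$. All operations with an argument $\bot$ yield $\bot$. Write $u\equiv_f^{++}v$ if $u^{-1}v\to_f\varepsilon$ (equivalently $u\backslash_f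 v=v\backslash_f u=\varepsilon$), with the conventions that $\bot\equiv_f^{++}\bot$ is true and that $u\equiv_f^{++}\bot$, $\bot\equiv_f^{++}u$ are false for words $u$. The function $f$ has the cube property on a set $X\subseteq\mathrm{Mo}(\Sigma)\cup\{\bot\}$ if $(u\backslash_f v)\backslash_f(u\backslash_f w)\equiv_f^{++}(v\backslash_f u)\backslash_f(v\backslash_f w)$ for all $u,v,w\in X$. Conditions $( ** )$ for a reversing function $f$ on $\Sigma$ are the conjunction of: (1) the closure $\widetilde\Sigma$ of $\Sigma$ under $\backslash_f$ exists (i.e. there is a smallest set $\widetilde\Sigma\subseteq\mathrm{Mo}(\Sigma)$ that includes $\Sigma$ and is such that for all $u,v\in\widetilde\Sigma$ the word $u\backslash_f v$ is defined and belongs to $\widetilde\Sigma$) and is finite; (2) $f$ has the cube property on $\widetilde\Sigma$; (3) letting $\widetilde\Sigma^{\vee}$ be the closure of $\widetilde\Sigma$ under $\vee_f$ (which necessarily exists and is finite if (1) and (2) are satisfied), there exists a word $\Omega\in\widetilde\Sigma^\vee$ such that, for every $u\in\widetilde\Sigma^\vee$, $\Omega\backslash_f u=\varepsilon$ and there exists $v\in\widetilde\Sigma^\vee$ with $v\backslash_f\Omega\equiv_f^{+}u$.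
   Formalization: In (i) the generating subset Σ is additionally assumed finite, nonempty and not containing 1; without these the conclusion fails (e.g. M = ℕ, Σ = ℕ∖{0} has an infinite closure, violating (∗∗)(1)). *)

theory Defs
  imports "HOL-Algebra.Divisibility"
begin

section \<open>Garside monoids\<close>

definition left_divides :: "('m, 'x) monoid_scheme \<Rightarrow> 'm \<Rightarrow> 'm \<Rightarrow> bool" where
  "left_divides M x y \<longleftrightarrow>
     x \<in> carrier M \<and> y \<in> carrier M \<and> (\<exists>z\<in>carrier M. x \<otimes>\<^bsub>M\<^esub> z = y)"

definition right_divides :: "('m, 'x) monoid_scheme \<Rightarrow> 'm \<Rightarrow> 'm \<Rightarrow> bool" where
  "right_divides M x y \<longleftrightarrow>
     x \<in> carrier M \<and> y \<in> carrier M \<and> (\<exists>z\<in>carrier M. z \<otimes>\<^bsub>M\<^esub> x = y)"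

definition is_right_lcm :: "('m, 'x) monoid_scheme \<Rightarrow> 'm \<Rightarrow> 'm \<Rightarrow> 'm \<Rightarrow> bool" where
  "is_right_lcm M x y m \<longleftrightarrow>
     left_divides M x m \<and> left_divides M y m \<and>
     (\<forall>n. left_divides M x n \<and> left_divides M y n \<longrightarrow> left_divides M m n)"

definition is_left_lcm :: "('m, 'x) monoid_scheme \<Rightarrow> 'm \<Rightarrow> 'm \<Rightarrow> 'm \<Rightarrow> bool" where
  "is_left_lcm M x y m \<longleftrightarrow>
     right_divides M x m \<and> right_divides M y m \<and>
     (\<forall>n. right_divides M x n \<and> right_divides M y n \<longrightarrow> right_divides M m n)"

definition is_left_gcd :: "('m, 'x) monoid_scheme \<Rightarrow> 'm \<Rightarrow> 'm \<Rightarrow> 'm \<Rightarrow> bool" where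
  "is_left_gcd M x y d \<longleftrightarrow>
     left_divides M d x \<and> left_divides M d y \<and>
     (\<forall>e. left_divides M e x \<and> left_divides M e y \<longrightarrow> left_divides M e d)"

definition is_right_gcd :: "('m, 'x) monoid_scheme \<Rightarrow> 'm \<Rightarrow> 'm \<Rightarrow> 'm \<Rightarrow> bool" where
  "is_right_gcd M x y d \<longleftrightarrow>
     right_divides M d x \<and> right_divides M d y \<and>
     (\<forall>e. right_divides M e x \<and> right_divides M e y \<longrightarrow> right_divides M e d)"

definition mprod :: "('m, 'x) monoid_scheme \<Rightarrow> 'm list \<Rightarrow> 'm" where
  "mprod M xs = foldr (\<lambda>x y. x \<otimes>\<^bsub>M\<^esub> y) xs \<one>\<^bsub>M\<^esub>"

definition generates :: "('m, 'x) monoid_scheme \<Rightarrow> 'm set \<Rightarrow> bool" where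
  "generates M S \<longleftrightarrow> S \<subseteq> carrier M \<and> (\<forall>x\<in>carrier M. \<exists>xs\<in>lists S. mprod M xs = x)"

definition atoms :: "('m, 'x) monoid_scheme \<Rightarrow> 'm set" where
  "atoms M = {x \<in> carrier M. x \<noteq> \<one>\<^bsub>M\<^esub> \<and>
     (\<forall>y\<in>carrier M. \<forall>z\<in>carrier M. x = y \<otimes>\<^bsub>M\<^esub> z \<longrightarrow> y = \<one>\<^bsub>M\<^esub> \<or> z = \<one>\<^bsub>M\<^esub>)}"

definition atomic_monoid :: "('m, 'x) monoid_scheme \<Rightarrow> bool" where
  "atomic_monoid M \<longleftrightarrow> monoid M \<and> generates M (atoms M) \<and>
     (\<forall>x\<in>carrier M. \<exists>N. \<forall>xs\<in>lists (atoms M). mprod M xs = x \<longrightarrow> length xs \<le> N)"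

definition gaussian_monoid :: "('m, 'x) monoid_scheme \<Rightarrow> bool" where
  "gaussian_monoid M \<longleftrightarrow> atomic_monoid M \<and> monoid_cancel M \<and>
     (\<forall>x\<in>carrier M. \<forall>y\<in>carrier M.
        (\<exists>m. is_right_lcm M x y m) \<and> (\<exists>m. is_left_lcm M x y m) \<and>
        (\<exists>d. is_left_gcd M x y d) \<and> (\<exists>d. is_right_gcd M x y d))"

definition garside_element :: "('m, 'x) monoid_scheme \<Rightarrow> 'm \<Rightarrow> bool" where
  "garside_element M \<Delta> \<longleftrightarrow> \<Delta> \<in> carrier M \<and>
     {x. left_divides M x \<Delta>} = {x. right_divides M x \<Delta>} \<and>
     finite {x. left_divides M x \<Delta>} \<and>
     generates M {x. left_divides M x \<Delta>}"

definition garside_monoid :: "('m, 'x) monoid_scheme \<Rightarrow> bool" where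
  "garside_monoid M \<longleftrightarrow> gaussian_monoid M \<and> (\<exists>\<Delta>. garside_element M \<Delta>)"

text \<open>The element \<open>z\<close> is \<open>x \ y\<close>; it is unique in a Gaussian monoid.\<close>
definition is_lcm_complement :: "('m, 'x) monoid_scheme \<Rightarrow> 'm \<Rightarrow> 'm \<Rightarrow> 'm \<Rightarrow> bool" where
  "is_lcm_complement M x y z \<longleftrightarrow> z \<in> carrier M \<and> is_right_lcm M x y (x \<otimes>\<^bsub>M\<^esub> z)"


section \<open>Complemented presentations\<close>

text \<open>A partial map from \<open>\<Sigma> \<times> \<Sigma>\<close> to \<open>Mo(\<Sigma>)\<close>, the latter being \<open>lists \<Sigma>\<close>;
  \<open>None\<close> stands for \<open>undefined\<close>.\<close>
definition partial_word_map :: "'a set \<Rightarrow> ('a \<Rightarrow> 'a \<Rightarrow> 'a list option) \<Rightarrow> bool" where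
  "partial_word_map \<Sigma> f \<longleftrightarrow>
     (\<forall>a b w. f a b = Some w \<longrightarrow> a \<in> \<Sigma> \<and> b \<in> \<Sigma> \<and> w \<in> lists \<Sigma>)"

text \<open>The letters are interpreted in \<open>M\<close> by a map \<open>\<iota>\<close>, which is the identity when \<open>\<Sigma>\<close> is a
  subset of \<open>M\<close>. In a presented monoid \<open>\<iota>\<close> maps a letter to its class; two letters may
  have the same class, so \<open>\<Sigma>\<close> cannot literally be replaced by a subset of that monoid.\<close>
definition lcm_selector ::
  "('m, 'x) monoid_scheme \<Rightarrow> ('a \<Rightarrow> 'm) \<Rightarrow> 'a set \<Rightarrow> ('a \<Rightarrow> 'a \<Rightarrow> 'a list option) \<Rightarrow> bool" where
  "lcm_selector M \<iota> \<Sigma> f \<longleftrightarrow>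
     generates M (\<iota> ` \<Sigma>) \<and> partial_word_map \<Sigma> f \<and>
     (\<forall>a\<in>\<Sigma>. \<forall>b\<in>\<Sigma>. \<forall>z. is_lcm_complement M (\<iota> a) (\<iota> b) z \<longrightarrow>
        (\<exists>w. f a b = Some w \<and> mprod M (map \<iota> w) = z))"

definition reversing_function :: "'a set \<Rightarrow> ('a \<Rightarrow> 'a \<Rightarrow> 'a list option) \<Rightarrow> bool" where
  "reversing_function \<Sigma> f \<longleftrightarrow>
     \<Sigma> \<noteq> {} \<and> partial_word_map \<Sigma> f \<and> (\<forall>a\<in>\<Sigma>. f a a = Some []) \<and>
     (\<forall>a b. f a b \<noteq> None \<longrightarrow> f b a \<noteq> None)"

definition complement_relations :: "('a \<Rightarrow> 'a \<Rightarrow> 'a list option) \<Rightarrow> ('a list \<times> 'a list) set" where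
  "complement_relations f =
     {(a # u, b # v) | a b u v. f a b = Some u \<and> f b a = Some v}"

inductive_set word_congruence :: "'a set \<Rightarrow> ('a list \<times> 'a list) set \<Rightarrow> ('a list \<times> 'a list) set"
  for \<Sigma> :: "'a set" and R :: "('a list \<times> 'a list) set" where
  rel: "(u, v) \<in> R \<Longrightarrow> u \<in> lists \<Sigma> \<Longrightarrow> v \<in> lists \<Sigma> \<Longrightarrow> (u, v) \<in> word_congruence \<Sigma> R"
| refl: "u \<in> lists \<Sigma> \<Longrightarrow> (u, u) \<in> word_congruence \<Sigma> R"
| sym: "(u, v) \<in> word_congruence \<Sigma> R \<Longrightarrow> (v, u) \<in> word_congruence \<Sigma> R"
| trans: "(u, v) \<in> word_congruence \<Sigma> R \<Longrightarrow> (v, w) \<in> word_congruence \<Sigma> R \<Longrightarrow>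
    (u, w) \<in> word_congruence \<Sigma> R"
| append: "(u, v) \<in> word_congruence \<Sigma> R \<Longrightarrow> (u', v') \<in> word_congruence \<Sigma> R \<Longrightarrow>
    (u @ u', v @ v') \<in> word_congruence \<Sigma> R"

definition word_class :: "'a set \<Rightarrow> ('a list \<times> 'a list) set \<Rightarrow> 'a list \<Rightarrow> 'a list set" where
  "word_class \<Sigma> R u = word_congruence \<Sigma> R `` {u}"

definition presented_monoid :: "'a set \<Rightarrow> ('a list \<times> 'a list) set \<Rightarrow> 'a list set monoid" where
  "presented_monoid \<Sigma> R =
     \<lparr>carrier = lists \<Sigma> // word_congruence \<Sigma> R,
      mult = (\<lambda>A B. \<Union>u\<in>A. \<Union>v\<in>B. word_class \<Sigma> R (u @ v)),
      one = word_class \<Sigma> R []\<rparr>"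

definition admits_presentation ::
  "('m, 'x) monoid_scheme \<Rightarrow> ('a \<Rightarrow> 'm) \<Rightarrow> 'a set \<Rightarrow> ('a list \<times> 'a list) set \<Rightarrow> bool" where
  "admits_presentation M \<iota> \<Sigma> R \<longleftrightarrow>
     (\<exists>h\<in>iso (presented_monoid \<Sigma> R) M. \<forall>a\<in>\<Sigma>. h (word_class \<Sigma> R [a]) = \<iota> a)"


section \<open>Word reversing\<close>

datatype 'a signed = Pos 'a | Neg 'a

fun flip_sign :: "'a signed \<Rightarrow> 'a signed" where
  "flip_sign (Pos a) = Neg a"
| "flip_sign (Neg a) = Pos a"

definition inverse_word :: "'a signed list \<Rightarrow> 'a signed list" where
  "inverse_word w = rev (map flip_sign w)"

abbreviation pos_word :: "'a list \<Rightarrow> 'a signed list" where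
  "pos_word u \<equiv> map Pos u"

abbreviation neg_word :: "'a list \<Rightarrow> 'a signed list" where
  "neg_word u \<equiv> inverse_word (map Pos u)"

inductive reversing_step ::
  "('a \<Rightarrow> 'a \<Rightarrow> 'a list option) \<Rightarrow> 'a signed list \<Rightarrow> 'a signed list \<Rightarrow> bool"
  for f :: "'a \<Rightarrow> 'a \<Rightarrow> 'a list option" where
  "f a b = Some u \<Longrightarrow> f b a = Some v \<Longrightarrow>
   reversing_step f (x @ [Neg a, Pos b] @ y) (x @ pos_word u @ neg_word v @ y)"

definition reverses ::
  "('a \<Rightarrow> 'a \<Rightarrow> 'a list option) \<Rightarrow> 'a signed list \<Rightarrow> 'a signed list \<Rightarrow> bool" where
  "reverses f = (reversing_step f)\<^sup>*\<^sup>*"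

text \<open>Reversing is confluent, hence the words \<open>v'\<close> and \<open>u'\<close> below are unique when they exist.\<close>
definition word_complement ::
  "('a \<Rightarrow> 'a \<Rightarrow> 'a list option) \<Rightarrow> 'a list \<Rightarrow> 'a list \<Rightarrow> 'a list option" where
  "word_complement f u v =
     (if \<exists>v' u'. reverses f (neg_word u @ pos_word v) (pos_word v' @ neg_word u')
      then Some (THE v'. \<exists>u'. reverses f (neg_word u @ pos_word v) (pos_word v' @ neg_word u'))
      else None)"

definition word_lcm ::
  "('a \<Rightarrow> 'a \<Rightarrow> 'a list option) \<Rightarrow> 'a list \<Rightarrow> 'a list \<Rightarrow> 'a list option" where
  "word_lcm f u v = map_option (\<lambda>w. u @ w) (word_complement f u v)"

text \<open>Extension of \<open>word_complement\<close> to \<open>Mo(\<Sigma>) \<union> {\<bottom>}\<close>, with \<open>None\<close> for \<open>\<bottom>\<close>.\<close>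
definition word_complement_opt ::
  "('a \<Rightarrow> 'a \<Rightarrow> 'a list option) \<Rightarrow> 'a list option \<Rightarrow> 'a list option \<Rightarrow> 'a list option" where
  "word_complement_opt f p q =
     Option.bind p (\<lambda>u. Option.bind q (\<lambda>v. word_complement f u v))"

fun reversing_equiv ::
  "('a \<Rightarrow> 'a \<Rightarrow> 'a list option) \<Rightarrow> 'a list option \<Rightarrow> 'a list option \<Rightarrow> bool" where
  "reversing_equiv f None None = True"
| "reversing_equiv f (Some u) (Some v) = reverses f (neg_word u @ pos_word v) []"
| "reversing_equiv f (Some u) None = False"
| "reversing_equiv f None (Some v) = False"

definition cube_property ::
  "('a \<Rightarrow> 'a \<Rightarrow> 'a list option) \<Rightarrow> 'a list option set \<Rightarrow> bool" where
  "cube_property f X \<longleftrightarrow> (\<forall>u\<in>X. \<forall>v\<in>X. \<forall>w\<in>X.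
     reversing_equiv f
       (word_complement_opt f (word_complement_opt f u v) (word_complement_opt f u w))
       (word_complement_opt f (word_complement_opt f v u) (word_complement_opt f v w)))"

definition closed_under :: "('w \<Rightarrow> 'w \<Rightarrow> 'w option) \<Rightarrow> 'w set \<Rightarrow> bool" where
  "closed_under op C \<longleftrightarrow> (\<forall>u\<in>C. \<forall>v\<in>C. \<exists>w\<in>C. op u v = Some w)"

definition is_closure ::
  "'a set \<Rightarrow> ('a list \<Rightarrow> 'a list \<Rightarrow> 'a list option) \<Rightarrow> 'a list set \<Rightarrow> 'a list set \<Rightarrow> bool" where
  "is_closure \<Sigma> op A C \<longleftrightarrow>
     C \<subseteq> lists \<Sigma> \<and> A \<subseteq> C \<and> closed_under op C \<and>
     (\<forall>D. D \<subseteq> lists \<Sigma> \<and> A \<subseteq> D \<and> closed_under op D \<longrightarrow> C \<subseteq> D)"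

text \<open>Here \<open>T\<close> is the closure of \<open>\<Sigma>\<close> under \<open>word_complement f\<close> and \<open>V\<close> the closure of \<open>T\<close> under
  \<open>word_lcm f\<close>; both are unique when they exist.\<close>
definition garside_conditions :: "'a set \<Rightarrow> ('a \<Rightarrow> 'a \<Rightarrow> 'a list option) \<Rightarrow> bool" where
  "garside_conditions \<Sigma> f \<longleftrightarrow>
     (\<exists>T. is_closure \<Sigma> (word_complement f) ((\<lambda>a. [a]) ` \<Sigma>) T \<and> finite T \<and>
        cube_property f (Some ` T) \<and>
        (\<exists>V. is_closure \<Sigma> (word_lcm f) T V \<and>
           (\<exists>\<Omega>\<in>V. \<forall>u\<in>V. word_complement f \<Omega> u = Some [] \<and>
              (\<exists>v\<in>V. \<exists>w. word_complement f v \<Omega> = Some w \<and>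
                 (w, u) \<in> word_congruence \<Sigma> (complement_relations f)))))"

end

theory Submission
  imports Defs
begin

text \<open>Both directions rest on the calculus of the complement \<open>x \ y\<close> in a left cancellative monoid
  without non-trivial invertible elements in which right lcm's exist (\<open>lcm_monoid\<close>). There
  \<open>x \ y\<close> left divides \<open>p\<close> if and only if \<open>y\<close> left divides \<open>x p\<close>, and this adjunction yields the
  product rules for \<open>(x y) \ z\<close> and \<open>z \ (x y)\<close>, the cube identity
  \<open>(x \ y) \ (x \ z) = (y \ x) \ (y \ z)\<close> and the compatibility with lcm's. Word reversing obeys
  the same product rules, because reversing diagrams can be glued.

  From a Garside monoid to the conditions: reversing \<open>u\<inverse> v\<close> stays inside the divisors of a common
  right multiple of \<open>u\<close> and \<open>v\<close>, so by atomicity it terminates and computes the complement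
  (\<open>lcm_square_exists_bounded\<close>). As the letters are non-trivial, two words represent the same
  element if and only if reversing leads to the empty word; this gives the presentation and the cube
  property. The products of \<open>k\<close> divisors of \<open>\<Delta>\<close> form a finite set closed under complements, and
  only finitely many words represent each of them, so the closure of the letters is finite
  (\<open>finite_complement_closure\<close>). Its closure under lcm's represents a finite set with a greatest
  element \<open>\<Omega>\<close>, on which \<open>v \<mapsto> v \ \<Omega>\<close> is injective by right cancellation, hence surjective
  (\<open>garside_conditions_if_finite\<close>).

  From the conditions to a Garside monoid: words are concatenations of words of the closure \<open>T\<close> of the
  letters, so reversing them is filling a rectangular grid with cells in \<open>T\<close>. The cube property
  extends from the cells to the grid (\<open>grid_cube\<close>, \<open>cube_gr\<close>), thus to all words. It makes reversing
  to the empty word a congruence, which is the one of the presentation, and the presented monoid is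
  left cancellative with right lcm's computed by reversing (\<open>is_right_lcm_cl\<close>). The closure of \<open>T\<close>
  under lcm's represents a finite generating set \<open>S\<close> closed under complements with greatest element
  \<open>\<Delta>\<close>, such that each of its elements right divides \<open>\<Delta>\<close> with a left cofactor in \<open>S\<close>. This is enough for a
  Garside monoid (\<open>garside\<close>): there is an endomorphism \<open>\<theta>\<close> with \<open>x \<Delta> = \<Delta> \<theta>(x)\<close>, it maps each finite
  set of products of \<open>k\<close> elements of \<open>S\<close> onto itself and is therefore bijective, and this provides
  right cancellation, common left multiples, atomicity by counting right divisors, and finally left
  lcm's and both gcd's.\<close>

section \<open>Word reversing\<close>

lemma inverse_word_Nil [simp]: "inverse_word [] = []"
  by (simp add: inverse_word_def)

lemma inverse_word_append [simp]: "inverse_word (u @ v) = inverse_word v @ inverse_word u"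
  by (simp add: inverse_word_def)

lemma inverse_word_Cons [simp]: "inverse_word (s # w) = inverse_word w @ [flip_sign s]"
  by (simp add: inverse_word_def)

lemma flip_sign_flip_sign [simp]: "flip_sign (flip_sign s) = s"
  by (cases s) auto

lemma inverse_word_inverse_word [simp]: "inverse_word (inverse_word w) = w"
  by (induction w) auto

lemma reversing_step_context:
  assumes "reversing_step f w w'"
  shows "reversing_step f (x @ w @ y) (x @ w' @ y)"
  using assms
proof cases
  case (1 a b u v p q)
  then show ?thesis
    using reversing_step.intros[of f a b u v "x @ p" "q @ y"] by simp
qed

lemma reverses_context:
  assumes "reverses f w w'"
  shows "reverses f (x @ w @ y) (x @ w' @ y)"
  using assms unfolding reverses_def
  by (induction rule: rtranclp_induct)
    (auto intro: reversing_step_context rtranclp.rtrancl_into_rtrancl)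

lemma reverses_trans: "reverses f u v \<Longrightarrow> reverses f v w \<Longrightarrow> reverses f u w"
  unfolding reverses_def by (rule rtranclp_trans)

lemma reversing_step_inverse_word:
  assumes "reversing_step f w w'"
  shows "reversing_step f (inverse_word w) (inverse_word w')"
  using assms
proof cases
  case (1 a b u v p q)
  then show ?thesis
    using reversing_step.intros[of f b a v u "inverse_word q" "inverse_word p"] by simp
qed

lemma reverses_inverse_word:
  assumes "reverses f w w'"
  shows "reverses f (inverse_word w) (inverse_word w')"
  using assms unfolding reverses_def
  by (induction rule: rtranclp_induct)
    (auto intro: reversing_step_inverse_word rtranclp.rtrancl_into_rtrancl)

text \<open>Two redexes \<open>a\<inverse> b\<close> of a signed word either coincide or are disjoint.\<close>

lemma redex_positions:
  assumes "x @ [Neg a, Pos b] @ y = x' @ [Neg a', Pos b'] @ y'"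
  shows "x = x' \<and> a = a' \<and> b = b' \<and> y = y' \<or>
    (\<exists>z. x' = x @ [Neg a, Pos b] @ z \<and> y = z @ [Neg a', Pos b'] @ y') \<or>
    (\<exists>z. x = x' @ [Neg a', Pos b'] @ z \<and> y' = z @ [Neg a, Pos b] @ y)"
  using assms
proof (induction x arbitrary: x')
  case Nil
  show ?case
  proof (cases x')
    case Nil2: (Cons s t)
    then show ?thesis using Nil by (cases t) auto
  qed (use Nil in auto)
next
  case (Cons s x)
  show ?case
  proof (cases x')
    case Nil
    then show ?thesis using Cons.prems by (cases x) auto
  next
    case (Cons s' t)
    then show ?thesis using Cons.IH[of t] Cons.prems by auto
  qed
qed

lemma reversing_step_commute:
  assumes "f a b = Some u" "f b a = Some v" "f a' b' = Some u'" "f b' a' = Some v'"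
  shows "\<exists>w. reversing_step f (x @ pos_word u @ neg_word v @ z @ [Neg a', Pos b'] @ y) w \<and>
    reversing_step f (x @ [Neg a, Pos b] @ z @ pos_word u' @ neg_word v' @ y) w"
  using reversing_step.intros[of f a b u v x "z @ pos_word u' @ neg_word v' @ y"]
    reversing_step.intros[of f a' b' u' v' "x @ pos_word u @ neg_word v @ z" y] assms
  by (intro exI[of _ "x @ pos_word u @ neg_word v @ z @ pos_word u' @ neg_word v' @ y"]) auto

text \<open>Reversing is confluent in the strong sense that two different steps can be joined by one step
  each. Hence a word has at most one irreducible reduct.\<close>

lemma reversing_step_diamond:
  assumes "reversing_step f w w1" "reversing_step f w w2"
  shows "w1 = w2 \<or> (\<exists>w3. reversing_step f w1 w3 \<and> reversing_step f w2 w3)"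
  using assms(1)
proof cases
  case 1: (1 a b u v x y)
  show ?thesis
    using assms(2)
  proof cases
    case 2: (1 a' b' u' v' x' y')
    consider "x = x' \<and> a = a' \<and> b = b' \<and> y = y'"
      | z where "x' = x @ [Neg a, Pos b] @ z" "y = z @ [Neg a', Pos b'] @ y'"
      | z where "x = x' @ [Neg a', Pos b'] @ z" "y' = z @ [Neg a, Pos b] @ y"
      using redex_positions[OF HOL.trans[OF 1(1)[symmetric] 2(1)]] by blast
    then show ?thesis
    proof cases
      case 1
      then show ?thesis using \<open>f a b = Some u\<close> \<open>f b a = Some v\<close> 2 \<open>w1 = _\<close> by simp
    next
      case (2 z)
      then show ?thesis
        using reversing_step_commute[of f a b u v a' b' u' v' x z y'] 1 \<open>f a' b' = _\<close> \<open>f b' a' = _\<close>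
          \<open>w2 = _\<close> by auto
    next
      case (3 z)
      then show ?thesis
        using reversing_step_commute[of f a' b' u' v' a b u v x' z y] 1 2 by auto
    qed
  qed
qed

lemma reverses_after_step:
  assumes "reverses f w n" "reversing_step f w w'" "\<And>m. \<not> reversing_step f n m"
  shows "reverses f w' n"
  using assms(1,2) unfolding reverses_def
proof (induction arbitrary: w' rule: converse_rtranclp_induct)
  case base
  then show ?case using assms(3) by blast
next
  case (step w w2)
  then show ?case
    by (metis converse_rtranclp_into_rtranclp reversing_step_diamond)
qed

lemma reverses_normal_form_unique:
  assumes "reverses f w n" "reverses f w n'"
    "\<And>m. \<not> reversing_step f n m" "\<And>m. \<not> reversing_step f n' m"
  shows "n = n'"
  using assms(2,1) unfolding reverses_def
proof (induction rule: converse_rtranclp_induct)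
  case base
  then show ?case using assms(4) by (metis converse_rtranclpE)
next
  case (step w w1)
  then show ?case using reverses_after_step assms(3) unfolding reverses_def by metis
qed

lemma set_neg_word: "set (neg_word u) = Neg ` set u"
  by (induction u) auto

lemma no_redex_pos_neg: "x @ [Neg a, Pos b] @ y \<noteq> pos_word v @ neg_word u"
proof (induction v arbitrary: x)
  case Nil
  show ?case
  proof
    assume eq: "x @ [Neg a, Pos b] @ y = pos_word [] @ neg_word u"
    have "Pos b \<in> set (x @ [Neg a, Pos b] @ y)" by simp
    then have "Pos b \<in> set (neg_word u)" unfolding eq by simp
    then show False by (auto simp: set_neg_word)
  qed
next
  case (Cons c v)
  then show ?case by (cases x) auto
qed

lemma no_step_pos_neg: "\<not> reversing_step f (pos_word v @ neg_word u) m"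
proof
  assume "reversing_step f (pos_word v @ neg_word u) m"
  then show False
  proof cases
    case (1 a b p q x y)
    then show False using no_redex_pos_neg[of x a b y v u] by simp
  qed
qed

lemma inj_neg_word: "neg_word u = neg_word v \<Longrightarrow> u = v"
  by (drule arg_cong[of _ _ inverse_word]) (simp add: inj_map_eq_map inj_def)

lemma pos_neg_eqD:
  "pos_word v @ neg_word u = pos_word v' @ neg_word u' \<Longrightarrow> v = v' \<and> u = u'"
proof (induction v arbitrary: v')
  case Nil
  have "v' = []"
  proof (cases v')
    case (Cons a t)
    then have "Pos a \<in> set (neg_word u)" using Nil by simp
    then show ?thesis by (auto simp: set_neg_word)
  qed simp
  then show ?case using Nil inj_neg_word by auto
next
  case (Cons c v)
  show ?case
  proof (cases v')
    case Nil
    then have "neg_word u' = Pos c # pos_word v @ neg_word u" using Cons.prems by simp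
    then have "Pos c \<in> set (neg_word u')" by simp
    then show ?thesis by (auto simp: set_neg_word)
  qed (use Cons in auto)
qed

text \<open>A reversing square: the word \<open>u\<inverse> v\<close> reverses to \<open>v' u'\<inverse>\<close>, so that \<open>v'\<close> and \<open>u'\<close> complete
  \<open>u\<close> and \<open>v\<close> to a square with \<open>u v'\<close> and \<open>v u'\<close> as its boundary paths.\<close>

definition reversing_square ::
  "('a \<Rightarrow> 'a \<Rightarrow> 'a list option) \<Rightarrow> 'a list \<Rightarrow> 'a list \<Rightarrow> 'a list \<Rightarrow> 'a list \<Rightarrow> bool" where
  "reversing_square f u v v' u' \<longleftrightarrow>
     reverses f (neg_word u @ pos_word v) (pos_word v' @ neg_word u')"

lemma reversing_square_unique:
  assumes "reversing_square f u v v' u'" "reversing_square f u v v'' u''"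
  shows "v' = v'' \<and> u' = u''"
  using assms reverses_normal_form_unique no_step_pos_neg pos_neg_eqD
  unfolding reversing_square_def by metis

lemma word_complement_eq_Some_iff:
  "word_complement f u v = Some v' \<longleftrightarrow> (\<exists>u'. reversing_square f u v v' u')"
proof -
  have "(THE v'. \<exists>u'. reversing_square f u v v' u') = v''" if "reversing_square f u v v'' u''" for v'' u''
    using that reversing_square_unique by blast
  then show ?thesis
    unfolding word_complement_def reversing_square_def[symmetric] by auto
qed

lemma reversing_square_sym:
  assumes "reversing_square f u v v' u'"
  shows "reversing_square f v u u' v'"
  using reverses_inverse_word[OF assms[unfolded reversing_square_def]]
  by (simp add: reversing_square_def)

lemma reversing_square_Nil_left: "reversing_square f [] v v []"
  by (simp add: reversing_square_def reverses_def)

lemma reversing_square_Nil_right: "reversing_square f u [] [] u"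
  by (simp add: reversing_square_def reverses_def)

lemma reversing_square_letters:
  assumes "f a b = Some u" "f b a = Some v"
  shows "reversing_square f [a] [b] u v"
  using reversing_step.intros[of f a b u v "[]" "[]"] assms
  by (auto simp: reversing_square_def reverses_def)

text \<open>Squares can be glued along a common side.\<close>

lemma reversing_square_append_left:
  assumes "reversing_square f u1 v v1 u1'" "reversing_square f u2 v1 v2 u2'"
  shows "reversing_square f (u1 @ u2) v v2 (u1' @ u2')"
proof -
  have "reverses f (neg_word u2 @ (neg_word u1 @ pos_word v) @ [])
      (neg_word u2 @ (pos_word v1 @ neg_word u1') @ [])"
    using assms(1) unfolding reversing_square_def by (rule reverses_context)
  moreover have "reverses f ([] @ (neg_word u2 @ pos_word v1) @ neg_word u1')
      ([] @ (pos_word v2 @ neg_word u2') @ neg_word u1')"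
    using assms(2) unfolding reversing_square_def by (rule reverses_context)
  ultimately show ?thesis
    unfolding reversing_square_def using reverses_trans by fastforce
qed

lemma reversing_square_append_right:
  assumes "reversing_square f u v1 v1' u'" "reversing_square f u' v2 v2' u''"
  shows "reversing_square f u (v1 @ v2) (v1' @ v2') u''"
  using assms by (meson reversing_square_append_left reversing_square_sym)

text \<open>If one of the values of \<open>f\<close> were undefined, the word \<open>a\<inverse> b\<close> would be irreducible without
  being of the required form.\<close>

lemma reversing_square_letters_defined:
  assumes "reversing_square f [a] [b] u v"
  shows "f a b = Some u \<and> f b a = Some v"
proof (cases "\<exists>p q. f a b = Some p \<and> f b a = Some q")
  case True
  then show ?thesis using reversing_square_letters reversing_square_unique assms by metis
next
  case False
  have *: "\<not> reversing_step f [Neg a, Pos b] w" for w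
  proof
    assume "reversing_step f [Neg a, Pos b] w"
    then show False
    proof cases
      case (1 a' b' p q x y)
      then have "x @ [Neg a', Pos b'] @ y = [] @ [Neg a, Pos b] @ []" by simp
      from redex_positions[OF this] show ?thesis using 1 False by auto
    qed
  qed
  have "reverses f [Neg a, Pos b] (pos_word u @ neg_word v)"
    using assms by (simp add: reversing_square_def)
  then have "[Neg a, Pos b] = pos_word u @ neg_word v"
    using * unfolding reverses_def by (metis converse_rtranclpE)
  then show ?thesis using no_redex_pos_neg[of "[]" a b "[]" u v] by simp
qed

text \<open>The letter underlying a signed letter.\<close>

fun letter :: "'a signed \<Rightarrow> 'a" where
  "letter (Pos a) = a"
| "letter (Neg a) = a"

lemma letter_flip_sign [simp]: "letter (flip_sign s) = letter s"
  by (cases s) auto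

lemma letters_inverse_word [simp]: "letter ` set (inverse_word w) = letter ` set w"
  by (induction w) auto

lemma reversing_step_letters:
  assumes "partial_word_map \<Sigma> f" "reversing_step f w w'" "letter ` set w \<subseteq> \<Sigma>"
  shows "letter ` set w' \<subseteq> \<Sigma>"
  using assms(2)
proof cases
  case (1 a b p q)
  have "set p \<subseteq> \<Sigma>" "set q \<subseteq> \<Sigma>"
    using 1 assms(1) unfolding partial_word_map_def by blast+
  then show ?thesis
    using 1 assms(3) by (auto simp: image_Un set_neg_word image_image)
qed

lemma reversing_square_lists:
  assumes "partial_word_map \<Sigma> f" "reversing_square f u v v' u'"
    "u \<in> lists \<Sigma>" "v \<in> lists \<Sigma>"
  shows "v' \<in> lists \<Sigma>" "u' \<in> lists \<Sigma>"
proof -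
  have letters_pos: "letter ` set (pos_word w) = set w" for w
    by (auto simp: image_image)
  have "letter ` set w' \<subseteq> \<Sigma>" if "reverses f w w'" "letter ` set w \<subseteq> \<Sigma>" for w w'
    using that unfolding reverses_def
  proof (induction rule: rtranclp_induct)
    case (step x y)
    then have "letter ` set x \<subseteq> \<Sigma>" by blast
    then show ?case by (rule reversing_step_letters[OF assms(1) step(2)])
  qed simp
  from this[OF assms(2)[unfolded reversing_square_def]] assms(3,4)
  show "v' \<in> lists \<Sigma>" "u' \<in> lists \<Sigma>"
    by (auto simp: image_Un letters_pos image_image lists_eq_set)
qed


section \<open>The congruence of a complemented presentation\<close>

lemma word_congruence_lists:
  assumes "(u, v) \<in> word_congruence \<Sigma> R"
  shows "u \<in> lists \<Sigma>" "v \<in> lists \<Sigma>"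
  using assms by (induction) auto

text \<open>A signed word \<open>w\<close> is read as a relation between positive words up to congruence: a letter
  \<open>a\<close> multiplies by \<open>a\<close> on the right, a letter \<open>a\<inverse>\<close> cancels \<open>a\<close> on the right. Reversing steps
  can only enlarge this relation. The base case allows for congruent words, which makes the relation
  compatible with the congruence on both sides.\<close>

fun signed_action ::
  "'a set \<Rightarrow> ('a list \<times> 'a list) set \<Rightarrow> 'a signed list \<Rightarrow> 'a list \<Rightarrow> 'a list \<Rightarrow> bool" where
  "signed_action \<Sigma> R [] x y \<longleftrightarrow> (x, y) \<in> word_congruence \<Sigma> R"
| "signed_action \<Sigma> R (Pos a # w) x y \<longleftrightarrow> signed_action \<Sigma> R w (x @ [a]) y"
| "signed_action \<Sigma> R (Neg a # w) x y \<longleftrightarrow>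
     (\<exists>z. (x, z @ [a]) \<in> word_congruence \<Sigma> R \<and> signed_action \<Sigma> R w z y)"

context
  fixes \<Sigma> :: "'a set" and R :: "('a list \<times> 'a list) set"
begin

lemma signed_action_cong_left:
  assumes "signed_action \<Sigma> R w x y" "(x', x) \<in> word_congruence \<Sigma> R" "letter ` set w \<subseteq> \<Sigma>"
  shows "signed_action \<Sigma> R w x' y"
  using assms
proof (induction w arbitrary: x x')
  case (Cons s w)
  show ?case
  proof (cases s)
    case (Pos a)
    have "(x' @ [a], x @ [a]) \<in> word_congruence \<Sigma> R"
      using Cons.prems Pos by (intro word_congruence.append word_congruence.refl) auto
    then show ?thesis using Cons Pos by auto
  next
    case (Neg a)
    then show ?thesis using Cons.prems by (auto intro: word_congruence.trans)
  qed
qed (auto intro: word_congruence.trans)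

lemma signed_action_append:
  assumes "letter ` set w \<subseteq> \<Sigma>" "letter ` set w' \<subseteq> \<Sigma>" "x \<in> lists \<Sigma>"
  shows "signed_action \<Sigma> R (w @ w') x y \<longleftrightarrow>
    (\<exists>z. signed_action \<Sigma> R w x z \<and> signed_action \<Sigma> R w' z y)"
  using assms
proof (induction w arbitrary: x)
  case Nil
  then show ?case
    by (auto intro: signed_action_cong_left word_congruence.refl)
next
  case (Cons s w)
  show ?case
  proof (cases s)
    case (Pos a)
    then show ?thesis using Cons.IH[of "x @ [a]"] Cons.prems by auto
  next
    case (Neg a)
    have lists: "z \<in> lists \<Sigma>" if "(x, z @ [a]) \<in> word_congruence \<Sigma> R" for z
      using word_congruence_lists[OF that] by simp
    have "signed_action \<Sigma> R (s # w @ w') x y \<longleftrightarrow> (\<exists>t. (x, t @ [a]) \<in> word_congruence \<Sigma> R \<and>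
        (\<exists>z. signed_action \<Sigma> R w t z \<and> signed_action \<Sigma> R w' z y))"
      using Cons.IH[OF _ Cons.prems(2) lists] Cons.prems(1) Neg by (auto 0 3)
    then show ?thesis using Neg by auto
  qed
qed

lemma signed_action_pos_word:
  assumes "u \<in> lists \<Sigma>"
  shows "signed_action \<Sigma> R (pos_word u) x y \<longleftrightarrow> (x @ u, y) \<in> word_congruence \<Sigma> R"
  using assms by (induction u arbitrary: x) auto

lemma signed_action_neg_word:
  assumes "u \<in> lists \<Sigma>" "x \<in> lists \<Sigma>"
  shows "signed_action \<Sigma> R (neg_word u) x y \<longleftrightarrow> (x, y @ u) \<in> word_congruence \<Sigma> R"
  using assms
proof (induction u arbitrary: y rule: list.induct)
  case (Cons a u)
  have "a \<in> \<Sigma>" using Cons.prems(1) by simp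
  have "signed_action \<Sigma> R [Neg a] z y \<longleftrightarrow> (z, y @ [a]) \<in> word_congruence \<Sigma> R" for z
  proof -
    have "(t @ [a], y @ [a]) \<in> word_congruence \<Sigma> R" if "(t, y) \<in> word_congruence \<Sigma> R" for t
      using that \<open>a \<in> \<Sigma>\<close> by (intro word_congruence.append word_congruence.refl) auto
    moreover have "(y, y) \<in> word_congruence \<Sigma> R" if "(z, y @ [a]) \<in> word_congruence \<Sigma> R"
      using word_congruence_lists(2)[OF that] by (auto intro: word_congruence.refl)
    ultimately show ?thesis by (auto intro: word_congruence.trans)
  qed
  moreover have "signed_action \<Sigma> R (neg_word u @ [Neg a]) x y \<longleftrightarrow>
      (\<exists>z. signed_action \<Sigma> R (neg_word u) x z \<and> signed_action \<Sigma> R [Neg a] z y)"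
    using Cons.prems by (intro signed_action_append) (auto simp: set_neg_word)
  ultimately have "signed_action \<Sigma> R (neg_word u @ [Neg a]) x y \<longleftrightarrow>
      (\<exists>z. (x, z @ u) \<in> word_congruence \<Sigma> R \<and> (z, y @ [a]) \<in> word_congruence \<Sigma> R)"
    using Cons.IH[of _, OF _ Cons.prems(2)] Cons.prems(1) by simp
  also have "\<dots> \<longleftrightarrow> (x, (y @ [a]) @ u) \<in> word_congruence \<Sigma> R"
  proof
    assume "\<exists>z. (x, z @ u) \<in> word_congruence \<Sigma> R \<and> (z, y @ [a]) \<in> word_congruence \<Sigma> R"
    then obtain z where z: "(x, z @ u) \<in> word_congruence \<Sigma> R" "(z, y @ [a]) \<in> word_congruence \<Sigma> R"
      by blast
    have "(z @ u, (y @ [a]) @ u) \<in> word_congruence \<Sigma> R"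
      using z(2) Cons.prems(1) by (intro word_congruence.append word_congruence.refl) auto
    with z(1) show "(x, (y @ [a]) @ u) \<in> word_congruence \<Sigma> R"
      by (rule word_congruence.trans)
  next
    assume *: "(x, (y @ [a]) @ u) \<in> word_congruence \<Sigma> R"
    have "(y @ [a], y @ [a]) \<in> word_congruence \<Sigma> R"
      using word_congruence_lists(2)[OF *] by (intro word_congruence.refl) auto
    with * show "\<exists>z. (x, z @ u) \<in> word_congruence \<Sigma> R \<and> (z, y @ [a]) \<in> word_congruence \<Sigma> R"
      by blast
  qed
  finally show ?case by simp
qed auto

end

text \<open>If \<open>x = z a\<close> and \<open>y = z b\<close>, then \<open>x f(a,b) = y f(b,a)\<close>.\<close>

lemma signed_action_step:
  assumes "partial_word_map \<Sigma> f" "reversing_step f w w'"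
    "signed_action \<Sigma> (complement_relations f) w x y" "letter ` set w \<subseteq> \<Sigma>" "x \<in> lists \<Sigma>"
  shows "signed_action \<Sigma> (complement_relations f) w' x y"
  using assms(2)
proof cases
  case (1 a b u v p q)
  let ?R = "complement_relations f"
  have uv: "u \<in> lists \<Sigma>" "v \<in> lists \<Sigma>" and ab: "a \<in> \<Sigma>" "b \<in> \<Sigma>"
    using assms(1) 1 unfolding partial_word_map_def by blast+
  have pq: "letter ` set p \<subseteq> \<Sigma>" "letter ` set q \<subseteq> \<Sigma>" using assms(4) 1 by auto
  have rel: "(a # u, b # v) \<in> word_congruence \<Sigma> ?R"
    using 1 uv ab by (intro word_congruence.rel) (auto simp: complement_relations_def)
  have letters: "letter ` set (neg_word v) \<subseteq> \<Sigma>" "letter ` set (pos_word u) \<subseteq> \<Sigma>"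
    using uv by (auto simp: set_neg_word)
  obtain z where z: "signed_action \<Sigma> ?R p x z" "signed_action \<Sigma> ?R ([Neg a, Pos b] @ q) z y"
    using signed_action_append[of p \<Sigma> "[Neg a, Pos b] @ q" x ?R y] assms 1 pq ab by auto
  obtain t where t: "(z, t @ [a]) \<in> word_congruence \<Sigma> ?R" "signed_action \<Sigma> ?R q (t @ [b]) y"
    using z(2) by auto
  have zt: "z \<in> lists \<Sigma>" "t \<in> lists \<Sigma>" using word_congruence_lists[OF t(1)] by auto
  have "(z @ u, (t @ [a]) @ u) \<in> word_congruence \<Sigma> ?R"
    using t(1) uv by (intro word_congruence.append word_congruence.refl)
  moreover have "(t @ a # u, t @ b # v) \<in> word_congruence \<Sigma> ?R"
    using rel zt by (intro word_congruence.append word_congruence.refl)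
  ultimately have "(z @ u, (t @ [b]) @ v) \<in> word_congruence \<Sigma> ?R"
    using word_congruence.trans by fastforce
  then have "signed_action \<Sigma> ?R (neg_word v) (z @ u) (t @ [b])"
    using uv zt by (simp add: signed_action_neg_word)
  then have "signed_action \<Sigma> ?R (neg_word v @ q) (z @ u) y"
    using signed_action_append[of "neg_word v" \<Sigma> q "z @ u" ?R y] letters pq zt uv t(2) by auto
  moreover have "signed_action \<Sigma> ?R (pos_word u) z (z @ u)"
    using uv zt by (simp add: signed_action_pos_word word_congruence.refl)
  ultimately have "signed_action \<Sigma> ?R (pos_word u @ neg_word v @ q) z y"
    using signed_action_append[of "pos_word u" \<Sigma> "neg_word v @ q" z ?R y] letters pq zt
    by (auto simp: image_Un)
  then show ?thesis
    using signed_action_append[of p \<Sigma> "pos_word u @ neg_word v @ q" x ?R y] letters pq z(1)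
      assms(5) 1(2) by (auto simp: image_Un)
qed

text \<open>The word \<open>u\<inverse> v\<close> relates \<open>u\<close> to \<open>v\<close> through the empty word, hence so does \<open>v' u'\<inverse>\<close>.\<close>

lemma reversing_square_sound:
  assumes "partial_word_map \<Sigma> f" "reversing_square f u v v' u'"
    "u \<in> lists \<Sigma>" "v \<in> lists \<Sigma>"
  shows "(u @ v', v @ u') \<in> word_congruence \<Sigma> (complement_relations f)"
proof -
  let ?R = "complement_relations f"
  have lists': "v' \<in> lists \<Sigma>" "u' \<in> lists \<Sigma>" using reversing_square_lists assms by blast+
  have letters: "letter ` set (neg_word u) \<subseteq> \<Sigma>" "letter ` set (pos_word v) \<subseteq> \<Sigma>"
      "letter ` set (neg_word u') \<subseteq> \<Sigma>" "letter ` set (pos_word v') \<subseteq> \<Sigma>"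
    using assms lists' by (auto simp: set_neg_word)
  have *: "signed_action \<Sigma> ?R w' u v \<and> letter ` set w' \<subseteq> \<Sigma>"
    if "reverses f w w'" "signed_action \<Sigma> ?R w u v" "letter ` set w \<subseteq> \<Sigma>" for w w'
    using that unfolding reverses_def
  proof (induction rule: rtranclp_induct)
    case (step x y)
    have "letter ` set y \<subseteq> \<Sigma>"
      by (rule reversing_step_letters[OF assms(1) step(2)]) (use step in blast)
    moreover have "signed_action \<Sigma> ?R y u v"
      using signed_action_step[OF assms(1) step(2)] step assms(3) by blast
    ultimately show ?case by blast
  qed simp
  have "signed_action \<Sigma> ?R (neg_word u) u []" 
    using assms by (simp add: signed_action_neg_word word_congruence.refl)
  moreover have "signed_action \<Sigma> ?R (pos_word v) [] v"
    using assms by (simp add: signed_action_pos_word word_congruence.refl)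
  ultimately have "signed_action \<Sigma> ?R (neg_word u @ pos_word v) u v"
    using assms letters by (subst signed_action_append) auto
  then have "signed_action \<Sigma> ?R (pos_word v' @ neg_word u') u v"
    using * assms(2) letters unfolding reversing_square_def by (simp add: image_Un)
  then obtain z where z: "signed_action \<Sigma> ?R (pos_word v') u z" "signed_action \<Sigma> ?R (neg_word u') z v"
    using signed_action_append letters assms by metis
  then have "(u @ v', z) \<in> word_congruence \<Sigma> ?R" using lists' by (simp add: signed_action_pos_word)
  moreover have "z \<in> lists \<Sigma>" using word_congruence_lists(2)[OF calculation] .
  then have "(z, v @ u') \<in> word_congruence \<Sigma> ?R" using z lists' by (simp add: signed_action_neg_word)
  ultimately show ?thesis by (rule word_congruence.trans)
qed


section \<open>Monoids with right lcm's\<close>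

lemma mprod_Nil [simp]: "mprod M [] = \<one>\<^bsub>M\<^esub>"
  by (simp add: mprod_def)

lemma mprod_Cons [simp]: "mprod M (x # xs) = x \<otimes>\<^bsub>M\<^esub> mprod M xs"
  by (simp add: mprod_def)

lemma (in monoid) mprod_closed [simp]: "xs \<in> lists (carrier G) \<Longrightarrow> mprod G xs \<in> carrier G"
  by (induction xs rule: list.induct) auto

lemma (in monoid) mprod_append:
  "xs \<in> lists (carrier G) \<Longrightarrow> ys \<in> lists (carrier G) \<Longrightarrow>
    mprod G (xs @ ys) = mprod G xs \<otimes> mprod G ys"
  by (induction xs rule: list.induct) (auto simp: m_assoc)

text \<open>Left cancellative monoids without non-trivial invertible elements in which any two elements have
  a right lcm.\<close>

locale lcm_monoid = monoid G for G (structure) +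
  assumes left_cancel:
    "\<lbrakk>x \<otimes> y = x \<otimes> z; x \<in> carrier G; y \<in> carrier G; z \<in> carrier G\<rbrakk> \<Longrightarrow> y = z"
    and conical: "\<lbrakk>x \<otimes> y = \<one>; x \<in> carrier G; y \<in> carrier G\<rbrakk> \<Longrightarrow> x = \<one>"
    and right_lcm_exists: "\<lbrakk>x \<in> carrier G; y \<in> carrier G\<rbrakk> \<Longrightarrow> \<exists>m. is_right_lcm G x y m"
begin

abbreviation divides_left (infix "\<preceq>" 50) where
  "x \<preceq> y \<equiv> left_divides G x y"

lemma dvdI: "x \<in> carrier G \<Longrightarrow> z \<in> carrier G \<Longrightarrow> x \<preceq> x \<otimes> z"
  by (auto simp: left_divides_def)

lemma dvd_refl: "x \<in> carrier G \<Longrightarrow> x \<preceq> x"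
  by (auto simp: left_divides_def intro!: bexI[of _ \<one>])

lemma dvd_one: "x \<in> carrier G \<Longrightarrow> \<one> \<preceq> x"
  by (auto simp: left_divides_def)

lemma dvd_trans: "x \<preceq> y \<Longrightarrow> y \<preceq> z \<Longrightarrow> x \<preceq> z"
  unfolding left_divides_def by (metis m_assoc m_closed)

lemma dvd_closed: "x \<preceq> y \<Longrightarrow> x \<in> carrier G" "x \<preceq> y \<Longrightarrow> y \<in> carrier G"
  by (auto simp: left_divides_def)

lemma dvd_antisym:
  assumes "x \<preceq> y" "y \<preceq> x"
  shows "x = y"
proof -
  obtain z w where zw: "z \<in> carrier G" "x \<otimes> z = y" "w \<in> carrier G" "y \<otimes> w = x"
    and c: "x \<in> carrier G" "y \<in> carrier G"
    using assms unfolding left_divides_def by blast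
  have "x \<otimes> (z \<otimes> w) = x \<otimes> \<one>" using zw c by (simp flip: m_assoc)
  then have "z \<otimes> w = \<one>" using left_cancel zw c m_closed one_closed by blast
  then have "z = \<one>" using conical zw by blast
  then show ?thesis using zw c by simp
qed

lemma dvd_mult_cancel:
  assumes "x \<in> carrier G" "y \<in> carrier G" "z \<in> carrier G"
  shows "x \<otimes> y \<preceq> x \<otimes> z \<longleftrightarrow> y \<preceq> z"
  unfolding left_divides_def using assms left_cancel m_assoc m_closed by metis

lemma eq_if_same_multiples:
  assumes "x \<in> carrier G" "y \<in> carrier G" "\<And>p. p \<in> carrier G \<Longrightarrow> x \<preceq> p \<longleftrightarrow> y \<preceq> p"
  shows "x = y"
  using assms dvd_refl dvd_antisym by blast

text \<open>The complement \<open>x \ y\<close> of the right lcm, unique and defined for all elements of the carrier.\<close>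

definition rc (infixl "\<setminus>" 75) where
  "x \<setminus> y = (THE z. is_lcm_complement G x y z)"

lemma lcm_complement_unique:
  assumes "is_lcm_complement G x y z" "is_lcm_complement G x y z'"
  shows "z = z'"
proof -
  have "x \<otimes> z = x \<otimes> z'"
    using assms unfolding is_lcm_complement_def is_right_lcm_def by (blast intro: dvd_antisym)
  then show ?thesis
    using assms left_cancel unfolding is_lcm_complement_def is_right_lcm_def left_divides_def
    by blast
qed

lemma is_lcm_complement_rc:
  assumes "x \<in> carrier G" "y \<in> carrier G"
  shows "is_lcm_complement G x y (x \<setminus> y)"
proof -
  obtain m where m: "is_right_lcm G x y m" using right_lcm_exists assms by blast
  then obtain z where "z \<in> carrier G" "m = x \<otimes> z"
    unfolding is_right_lcm_def left_divides_def by blast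
  with m have "is_lcm_complement G x y z" by (simp add: is_lcm_complement_def)
  then show ?thesis
    unfolding rc_def by (rule theI[of _ z]) (use \<open>is_lcm_complement G x y z\<close> lcm_complement_unique in blast)
qed

lemma rc_eqI:
  assumes "is_lcm_complement G x y z"
  shows "x \<setminus> y = z"
proof -
  have "x \<in> carrier G" "y \<in> carrier G"
    using assms by (auto simp: is_lcm_complement_def is_right_lcm_def left_divides_def)
  then show ?thesis using assms is_lcm_complement_rc lcm_complement_unique by blast
qed

lemma rc_closed [simp]: "x \<in> carrier G \<Longrightarrow> y \<in> carrier G \<Longrightarrow> x \<setminus> y \<in> carrier G"
  using is_lcm_complement_rc unfolding is_lcm_complement_def by blast

text \<open>The adjunction between complement and multiplication, from which all identities of the complement follow.\<close>

lemma rc_dvd_iff: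
  assumes "x \<in> carrier G" "y \<in> carrier G" "p \<in> carrier G"
  shows "x \<setminus> y \<preceq> p \<longleftrightarrow> y \<preceq> x \<otimes> p"
proof -
  have lcm: "is_right_lcm G x y (x \<otimes> (x \<setminus> y))"
    using is_lcm_complement_rc assms unfolding is_lcm_complement_def by blast
  have "y \<preceq> x \<otimes> p \<longleftrightarrow> x \<otimes> (x \<setminus> y) \<preceq> x \<otimes> p"
    using lcm assms dvd_trans dvdI unfolding is_right_lcm_def by metis
  then show ?thesis using assms dvd_mult_cancel by simp
qed

text \<open>The right lcm is written \<open>x (x \ y)\<close> throughout.\<close>

lemma join_dvd_iff:
  assumes "x \<in> carrier G" "y \<in> carrier G"
  shows "x \<otimes> (x \<setminus> y) \<preceq> p \<longleftrightarrow> x \<preceq> p \<and> y \<preceq> p"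
proof -
  have lcm: "is_right_lcm G x y (x \<otimes> (x \<setminus> y))"
    using is_lcm_complement_rc assms unfolding is_lcm_complement_def by blast
  then show ?thesis
    using dvd_trans unfolding is_right_lcm_def by blast
qed

lemma join_commute:
  assumes "x \<in> carrier G" "y \<in> carrier G"
  shows "x \<otimes> (x \<setminus> y) = y \<otimes> (y \<setminus> x)"
  using assms by (intro eq_if_same_multiples) (auto simp: join_dvd_iff)

lemma rc_mult_left:
  assumes "x \<in> carrier G" "y \<in> carrier G" "z \<in> carrier G"
  shows "(x \<otimes> y) \<setminus> z = y \<setminus> (x \<setminus> z)"
  using assms by (intro eq_if_same_multiples) (auto simp: rc_dvd_iff m_assoc)

lemma rc_mult_right:
  assumes "x \<in> carrier G" "y \<in> carrier G" "z \<in> carrier G"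
  shows "z \<setminus> (x \<otimes> y) = (z \<setminus> x) \<otimes> ((x \<setminus> z) \<setminus> y)"
proof (rule eq_if_same_multiples)
  fix p assume p: "p \<in> carrier G"
  have key: "x \<otimes> y \<preceq> z \<otimes> ((z \<setminus> x) \<otimes> q) \<longleftrightarrow> (x \<setminus> z) \<setminus> y \<preceq> q" if "q \<in> carrier G" for q
  proof -
    have "z \<otimes> ((z \<setminus> x) \<otimes> q) = x \<otimes> ((x \<setminus> z) \<otimes> q)"
      using assms that join_commute[of z x] by (simp add: m_assoc[symmetric])
    then show ?thesis using assms that by (simp add: dvd_mult_cancel rc_dvd_iff)
  qed
  have "z \<setminus> (x \<otimes> y) \<preceq> p \<longleftrightarrow> x \<otimes> y \<preceq> z \<otimes> p"
    using assms p by (simp add: rc_dvd_iff)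
  also have "\<dots> \<longleftrightarrow> (z \<setminus> x) \<otimes> ((x \<setminus> z) \<setminus> y) \<preceq> p"
  proof
    assume *: "x \<otimes> y \<preceq> z \<otimes> p"
    then have "x \<preceq> z \<otimes> p" using dvdI dvd_trans assms by blast
    then have "z \<setminus> x \<preceq> p" using assms p by (simp add: rc_dvd_iff)
    then obtain q where "q \<in> carrier G" "p = (z \<setminus> x) \<otimes> q" unfolding left_divides_def by blast
    then show "(z \<setminus> x) \<otimes> ((x \<setminus> z) \<setminus> y) \<preceq> p"
      using * key assms by (simp add: dvd_mult_cancel)
  next
    assume "(z \<setminus> x) \<otimes> ((x \<setminus> z) \<setminus> y) \<preceq> p"
    then obtain r where r: "r \<in> carrier G" "p = (z \<setminus> x) \<otimes> ((x \<setminus> z) \<setminus> y) \<otimes> r"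
      unfolding left_divides_def by blast
    then have "p = (z \<setminus> x) \<otimes> (((x \<setminus> z) \<setminus> y) \<otimes> r)" using assms by (simp add: m_assoc)
    then show "x \<otimes> y \<preceq> z \<otimes> p" using key r assms by (simp add: dvdI)
  qed
  finally show "z \<setminus> (x \<otimes> y) \<preceq> p \<longleftrightarrow> (z \<setminus> x) \<otimes> ((x \<setminus> z) \<setminus> y) \<preceq> p" .
qed (use assms in auto)

lemma rc_cube:
  assumes "x \<in> carrier G" "y \<in> carrier G" "z \<in> carrier G"
  shows "(x \<setminus> y) \<setminus> (x \<setminus> z) = (y \<setminus> x) \<setminus> (y \<setminus> z)"
  using assms join_commute[of x y]
  by (intro eq_if_same_multiples) (auto simp: rc_dvd_iff m_assoc[symmetric])

lemma dvd_one_iff: "x \<preceq> \<one> \<longleftrightarrow> x = \<one>"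
  using dvd_one dvd_antisym dvd_refl dvd_closed one_closed by blast

lemma rc_eq_one_iff:
  assumes "x \<in> carrier G" "y \<in> carrier G"
  shows "x \<setminus> y = \<one> \<longleftrightarrow> y \<preceq> x"
  using rc_dvd_iff[of x y \<one>] assms by (simp add: dvd_one_iff)

lemma rc_self [simp]: "x \<in> carrier G \<Longrightarrow> x \<setminus> x = \<one>"
  by (simp add: rc_eq_one_iff dvd_refl)

lemma rc_one_right [simp]: "x \<in> carrier G \<Longrightarrow> x \<setminus> \<one> = \<one>"
  by (simp add: rc_eq_one_iff dvd_one)

lemma rc_one_left [simp]: "x \<in> carrier G \<Longrightarrow> \<one> \<setminus> x = x"
  by (intro eq_if_same_multiples) (auto simp: rc_dvd_iff)

lemma rc_mult_self:
  assumes "x \<in> carrier G" "y \<in> carrier G"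
  shows "x \<setminus> (x \<otimes> y) = y"
  using assms by (simp add: rc_mult_right)

lemma mult_rc_if_dvd:
  assumes "x \<preceq> y"
  shows "x \<otimes> (x \<setminus> y) = y"
  using assms rc_mult_self unfolding left_divides_def by auto

lemma rc_join_right:
  assumes "x \<in> carrier G" "y \<in> carrier G" "z \<in> carrier G"
  shows "x \<setminus> (y \<otimes> (y \<setminus> z)) = (x \<setminus> y) \<otimes> ((x \<setminus> y) \<setminus> (x \<setminus> z))"
  using assms by (intro eq_if_same_multiples) (auto simp: rc_dvd_iff join_dvd_iff)

lemma join_assoc:
  assumes "x \<in> carrier G" "y \<in> carrier G" "z \<in> carrier G"
  defines "j \<equiv> \<lambda>x y. x \<otimes> (x \<setminus> y)"
  shows "j (j x y) z = j x (j y z)"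
  using assms(1-3) unfolding j_def
  by (intro eq_if_same_multiples) (auto simp: join_dvd_iff)

lemma mprod_eq_one:
  assumes "mprod G xs = \<one>" "xs \<in> lists (carrier G)" "x \<in> set xs"
  shows "x = \<one>"
  using assms
proof (induction xs rule: list.induct)
  case (Cons y ys)
  then have c: "y \<in> carrier G" "mprod G ys \<in> carrier G" by auto
  have "y = \<one>" using conical[of y "mprod G ys"] Cons.prems c by simp
  then show ?case using Cons c by auto
qed simp


text \<open>The products of exactly \<open>k\<close> elements of \<open>S\<close>.\<close>

definition products :: "'a set \<Rightarrow> nat \<Rightarrow> 'a set" where
  "products S k = mprod G ` {xs \<in> lists S. length xs = k}"

lemma finite_products: "finite S \<Longrightarrow> finite (products S k)"
  unfolding products_def using finite_lists_length_eq[of S k]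
  by (simp add: lists_eq_set)

lemma products_Suc:
  assumes "y \<in> products S (Suc k)"
  obtains s z where "s \<in> S" "z \<in> products S k" "y = s \<otimes> z"
proof -
  obtain xs where "xs \<in> lists S" "length xs = Suc k" "y = mprod G xs"
    using assms unfolding products_def by blast
  then show ?thesis using that unfolding products_def by (cases xs) auto
qed

lemma products_SucI:
  assumes "s \<in> S" "z \<in> products S k"
  shows "s \<otimes> z \<in> products S (Suc k)"
proof -
  obtain xs where "xs \<in> lists S" "length xs = k" "z = mprod G xs"
    using assms(2) unfolding products_def by blast
  then have "s \<otimes> z = mprod G (s # xs)" "s # xs \<in> lists S" "length (s # xs) = Suc k"
    using assms(1) by auto
  then show ?thesis unfolding products_def by blast
qed

lemma products_closed: "S \<subseteq> carrier G \<Longrightarrow> products S k \<subseteq> carrier G"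
  unfolding products_def by (auto intro!: mprod_closed)

lemma products_mono:
  assumes "S \<subseteq> carrier G" "\<one> \<in> S" "j \<le> k"
  shows "products S j \<subseteq> products S k"
  using assms(3)
proof (induction rule: dec_induct)
  case (step i)
  have "products S i \<subseteq> products S (Suc i)"
    using products_SucI[OF assms(2), of _ i] products_closed[OF assms(1)] by force
  then show ?case using step by blast
qed simp

lemma in_products_if_generates:
  assumes "generates G S" "x \<in> carrier G"
  shows "\<exists>k. x \<in> products S k"
proof -
  obtain xs where "xs \<in> lists S" "mprod G xs = x"
    using assms unfolding generates_def by blast
  then have "x \<in> products S (length xs)" unfolding products_def by blast
  then show ?thesis ..
qed

text \<open>Closure under complements with respect to a generating set extends to complements with respect
  to arbitrary elements of the monoid.\<close>

lemma rc_generated: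
  assumes "generates G S" "\<And>s t. s \<in> S \<Longrightarrow> t \<in> S \<Longrightarrow> s \<setminus> t \<in> S" "x \<in> carrier G" "t \<in> S"
  shows "x \<setminus> t \<in> S"
proof -
  have S: "S \<subseteq> carrier G" using assms(1) by (simp add: generates_def)
  have "mprod G xs \<setminus> t \<in> S" if "xs \<in> lists S" for xs
    using that assms(4)
  proof (induction xs arbitrary: t rule: list.induct)
    case Nil
    then show ?case using S by auto
  next
    case (Cons s xs)
    then have "xs \<in> lists S" "s \<in> S" by auto
    moreover have "s \<in> carrier G" "mprod G xs \<in> carrier G" "t \<in> carrier G"
      using subsetD[OF S] subsetD[OF lists_mono[OF S]] calculation Cons.prems by simp_all
    ultimately show ?case using Cons assms(2) by (simp add: rc_mult_left)
  qed
  moreover obtain xs where "xs \<in> lists S" "mprod G xs = x"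
    using assms(1,3) unfolding generates_def by blast
  ultimately show ?thesis by blast
qed

lemma rc_products:
  assumes "generates G S" "\<And>s t. s \<in> S \<Longrightarrow> t \<in> S \<Longrightarrow> s \<setminus> t \<in> S" "x \<in> carrier G"
    "y \<in> products S k"
  shows "x \<setminus> y \<in> products S k"
  using assms(3,4)
proof (induction k arbitrary: x y)
  case 0
  then show ?case by (auto simp: products_def)
next
  case (Suc k)
  obtain s z where sz: "s \<in> S" "z \<in> products S k" "y = s \<otimes> z"
    using Suc.prems by (elim products_Suc)
  have c: "s \<in> carrier G" "z \<in> carrier G"
    using sz assms(1) products_closed unfolding generates_def by blast+
  then show ?case
    using sz Suc rc_generated[OF assms(1,2)] by (simp add: rc_mult_right products_SucI)
qed


text \<open>The closure of a set under right lcm's. One argument is kept in the starting set, which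
  loses nothing since lcm's are associative.\<close>

inductive_set lcm_closure :: "'a set \<Rightarrow> 'a set" for T :: "'a set" where
  base: "t \<in> T \<Longrightarrow> t \<in> lcm_closure T"
| join: "s \<in> lcm_closure T \<Longrightarrow> t \<in> T \<Longrightarrow> s \<otimes> (s \<setminus> t) \<in> lcm_closure T"

context
  fixes T :: "'a set"
  assumes T: "T \<subseteq> carrier G"
begin

lemma lcm_closure_closed: "s \<in> lcm_closure T \<Longrightarrow> s \<in> carrier G"
  by (induction rule: lcm_closure.induct) (use T in auto)

lemma lcm_closure_join:
  assumes "s \<in> lcm_closure T" "s' \<in> lcm_closure T"
  shows "s \<otimes> (s \<setminus> s') \<in> lcm_closure T"
  using assms(2)
proof (induction rule: lcm_closure.induct)
  case (base t)
  then show ?case using assms lcm_closure.join by blast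
next
  case (join s' t)
  then have "s \<in> carrier G" "s' \<in> carrier G" "t \<in> carrier G"
    using assms T lcm_closure_closed by blast+
  then show ?case using lcm_closure.join[OF join(3,2)] join_assoc by simp
qed

text \<open>An element of the closure is the lcm of its divisors lying in \<open>T\<close>.\<close>

lemma finite_lcm_closure:
  assumes "finite T"
  shows "finite (lcm_closure T)"
proof -
  have dvd_iff: "s \<preceq> p \<longleftrightarrow> (\<forall>t\<in>T. t \<preceq> s \<longrightarrow> t \<preceq> p)" if "s \<in> lcm_closure T" for s p
    using that
  proof (induction rule: lcm_closure.induct)
    case (base t)
    then show ?case using T dvd_refl dvd_trans by blast
  next
    case (join s t)
    then have c: "s \<in> carrier G" "t \<in> carrier G" "s \<otimes> (s \<setminus> t) \<in> carrier G"
      using T lcm_closure_closed by auto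
    then have "s \<preceq> s \<otimes> (s \<setminus> t)" "t \<preceq> s \<otimes> (s \<setminus> t)"
      using join_dvd_iff[of s t "s \<otimes> (s \<setminus> t)"] dvd_refl by auto
    then show ?case
      using join c by (metis dvd_trans join_dvd_iff)
  qed
  have "inj_on (\<lambda>s. {t \<in> T. t \<preceq> s}) (lcm_closure T)"
  proof (rule inj_onI)
    fix s s' assume s: "s \<in> lcm_closure T" "s' \<in> lcm_closure T"
      and eq: "{t \<in> T. t \<preceq> s} = {t \<in> T. t \<preceq> s'}"
    show "s = s'"
      using s eq dvd_iff lcm_closure_closed by (intro eq_if_same_multiples) blast+
  qed
  moreover have "(\<lambda>s. {t \<in> T. t \<preceq> s}) ` lcm_closure T \<subseteq> Pow T" by blast
  ultimately show ?thesis
    using assms by (meson finite_Pow_iff inj_on_finite)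
qed

lemma rc_lcm_closure:
  assumes "\<And>s t. s \<in> T \<Longrightarrow> t \<in> T \<Longrightarrow> s \<setminus> t \<in> T" "s \<in> lcm_closure T" "s' \<in> lcm_closure T"
  shows "s \<setminus> s' \<in> lcm_closure T"
proof -
  have in_T: "s \<setminus> t \<in> T" if "t \<in> T" for t
    using assms(2) that
  proof (induction arbitrary: t rule: lcm_closure.induct)
    case (join s u)
    then have "s \<in> carrier G" "u \<in> carrier G" "t \<in> carrier G"
      using T lcm_closure_closed by blast+
    then show ?case using join assms(1) by (simp add: rc_mult_left)
  qed (use assms(1) in blast)
  show ?thesis
    using assms(3)
  proof (induction rule: lcm_closure.induct)
    case (base t)
    then show ?case using in_T lcm_closure.base by blast
  next
    case (join s' t)
    then have "s \<in> carrier G" "s' \<in> carrier G" "t \<in> carrier G"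
      using assms(2) T lcm_closure_closed by blast+
    then show ?case
      using lcm_closure.join[OF join(3) in_T[OF join(2)]] by (simp add: rc_join_right)
  qed
qed

lemma finite_lcm_closure_top:
  assumes "finite T" "T \<noteq> {}"
  shows "\<exists>d\<in>lcm_closure T. \<forall>s\<in>lcm_closure T. s \<preceq> d"
proof -
  have "\<exists>d\<in>lcm_closure T. \<forall>s\<in>F. s \<preceq> d" if "finite F" "F \<subseteq> lcm_closure T" for F
    using that
  proof (induction F rule: finite_induct)
    case empty
    then show ?case using assms(2) lcm_closure.base by blast
  next
    case (insert x F)
    then obtain d where d: "d \<in> lcm_closure T" "\<forall>s\<in>F. s \<preceq> d" by blast
    have c: "d \<in> carrier G" "x \<in> carrier G" using d insert lcm_closure_closed by auto
    then have "d \<preceq> d \<otimes> (d \<setminus> x)" "x \<preceq> d \<otimes> (d \<setminus> x)"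
      using join_dvd_iff[of d x "d \<otimes> (d \<setminus> x)"] dvd_refl by auto
    moreover have "d \<otimes> (d \<setminus> x) \<in> lcm_closure T" using d insert lcm_closure_join by blast
    ultimately show ?case using d dvd_trans by blast
  qed
  then show ?thesis using finite_lcm_closure[OF assms(1)] by blast
qed

end

end


section \<open>A criterion for Garside monoids\<close>

text \<open>Nonempty finite sets have least upper bounds if pairs do. The relation will be left divisibility
  or right divisibility.\<close>

lemma finite_upper_bound:
  assumes "finite A" "A \<noteq> {}" "A \<subseteq> C"
    and "\<And>x y. x \<in> C \<Longrightarrow> y \<in> C \<Longrightarrow>
      \<exists>m\<in>C. R x m \<and> R y m \<and> (\<forall>n. R x n \<and> R y n \<longrightarrow> R m n)"
    and "\<And>x y z. R x y \<Longrightarrow> R y z \<Longrightarrow> R x z" "\<And>x. x \<in> C \<Longrightarrow> R x x"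
  shows "\<exists>m\<in>C. (\<forall>a\<in>A. R a m) \<and> (\<forall>n. (\<forall>a\<in>A. R a n) \<longrightarrow> R m n)"
  using assms(1-3)
proof (induction A rule: finite_ne_induct)
  case (singleton x)
  then show ?case using assms(6) by auto
next
  case (insert x A)
  then obtain m where m: "m \<in> C" "\<forall>a\<in>A. R a m" "\<forall>n. (\<forall>a\<in>A. R a n) \<longrightarrow> R m n" by auto
  obtain k where "k \<in> C" "R x k" "R m k" "\<forall>n. R x n \<and> R m n \<longrightarrow> R k n"
    using assms(4)[of x m] m(1) insert.prems by auto
  then show ?case using m assms(5) by (intro bexI[of _ k]) blast+
qed

text \<open>A finite generating set closed under complements, with a greatest element \<open>\<Delta>\<close> of which each element
  of the set is a right divisor with left cofactor in the set. It turns out to be the set of all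
  divisors of \<open>\<Delta>\<close>.\<close>

locale garside_family = lcm_monoid +
  fixes S and \<Delta>
  assumes finite_S: "finite S"
    and generates_S: "generates G S"
    and rc_S: "\<And>s t. s \<in> S \<Longrightarrow> t \<in> S \<Longrightarrow> s \<setminus> t \<in> S"
    and \<Delta>_in_S: "\<Delta> \<in> S"
    and dvd_\<Delta>: "\<And>s. s \<in> S \<Longrightarrow> s \<preceq> \<Delta>"
    and left_factor: "\<And>u. u \<in> S \<Longrightarrow> \<exists>v\<in>S. v \<otimes> u = \<Delta>"
begin

lemma S_closed: "S \<subseteq> carrier G"
  using generates_S by (simp add: generates_def)

lemma \<Delta>_closed [simp]: "\<Delta> \<in> carrier G"
  using S_closed \<Delta>_in_S by blast

lemma one_in_S: "\<one> \<in> S"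
  using rc_S[OF \<Delta>_in_S \<Delta>_in_S] by simp

text \<open>Conjugation by \<open>\<Delta>\<close>, determined by \<open>x \<Delta> = \<Delta> \<theta>(x)\<close>. The complement merely picks the solution; that
  there is one follows from \<open>s \<Delta> = s t u = \<Delta> u\<close> for \<open>s \<in> S\<close>, where \<open>s t = \<Delta> = t u\<close>.\<close>

definition \<theta> where "\<theta> x = \<Delta> \<setminus> (x \<otimes> \<Delta>)"

lemma \<theta>_eqI: "x \<otimes> \<Delta> = \<Delta> \<otimes> y \<Longrightarrow> y \<in> carrier G \<Longrightarrow> \<theta> x = y"
  by (simp add: \<theta>_def rc_mult_self)

lemma \<theta>_S:
  assumes "s \<in> S"
  shows "s \<otimes> \<Delta> = \<Delta> \<otimes> \<theta> s" "\<theta> s \<in> S"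
proof -
  let ?t = "s \<setminus> \<Delta>"
  let ?u = "?t \<setminus> \<Delta>"
  have t: "?t \<in> S" and u: "?u \<in> S" using rc_S assms \<Delta>_in_S by blast+
  have c: "s \<in> carrier G" "?t \<in> carrier G" "?u \<in> carrier G" using assms t u S_closed by blast+
  have "\<Delta> \<otimes> ?u = s \<otimes> ?t \<otimes> ?u" using mult_rc_if_dvd[OF dvd_\<Delta>[OF assms]] by simp
  also have "\<dots> = s \<otimes> \<Delta>" using mult_rc_if_dvd[OF dvd_\<Delta>[OF t]] c by (simp add: m_assoc)
  finally have "s \<otimes> \<Delta> = \<Delta> \<otimes> ?u" ..
  then show "s \<otimes> \<Delta> = \<Delta> \<otimes> \<theta> s" "\<theta> s \<in> S" using \<theta>_eqI c u by metis+
qed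

lemma \<theta>_mprod:
  assumes "xs \<in> lists S"
  shows "mprod G xs \<otimes> \<Delta> = \<Delta> \<otimes> mprod G (map \<theta> xs)"
  using assms
proof (induction xs rule: list.induct)
  case (Cons s xs)
  then have s: "s \<in> S" "xs \<in> lists S" by auto
  have "map \<theta> xs \<in> lists S" using s(2) \<theta>_S(2) by auto
  then have c: "s \<in> carrier G" "\<theta> s \<in> carrier G" "mprod G xs \<in> carrier G"
      "mprod G (map \<theta> xs) \<in> carrier G"
    using s \<theta>_S(2)[OF s(1)] subsetD[OF S_closed] subsetD[OF lists_mono[OF S_closed]] by simp_all
  have "mprod G (s # xs) \<otimes> \<Delta> = s \<otimes> (\<Delta> \<otimes> mprod G (map \<theta> xs))"
    using Cons.IH s c by (simp add: m_assoc)
  also have "\<dots> = \<Delta> \<otimes> mprod G (map \<theta> (s # xs))"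
    using \<theta>_S(1)[OF s(1)] c by (simp flip: m_assoc)
  finally show ?case .
qed simp

lemma \<theta>_mprod_eq:
  assumes "xs \<in> lists S"
  shows "\<theta> (mprod G xs) = mprod G (map \<theta> xs)"
proof -
  have "map \<theta> xs \<in> lists S" using assms \<theta>_S(2) by auto
  then show ?thesis
    using \<theta>_mprod[OF assms] subsetD[OF lists_mono[OF S_closed]] by (intro \<theta>_eqI) simp_all
qed

lemma generated:
  assumes "x \<in> carrier G"
  obtains xs where "xs \<in> lists S" "x = mprod G xs"
proof -
  have "\<exists>xs\<in>lists S. mprod G xs = x" using assms generates_S by (simp add: generates_def)
  then show ?thesis using that by blast
qed

lemma \<theta>_mult: "x \<in> carrier G \<Longrightarrow> x \<otimes> \<Delta> = \<Delta> \<otimes> \<theta> x"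
  by (elim generated) (simp add: \<theta>_mprod \<theta>_mprod_eq)

lemma \<theta>_image_S: "\<theta> ` S = S"
proof (intro equalityI subsetI)
  fix u assume u: "u \<in> S"
  then obtain v where v: "v \<in> S" "v \<otimes> u = \<Delta>" using left_factor by blast
  then obtain w where w: "w \<in> S" "w \<otimes> v = \<Delta>" using left_factor by blast
  have "w \<otimes> \<Delta> = \<Delta> \<otimes> u"
    using u v w S_closed m_assoc by (metis subsetD)
  then have "\<theta> w = u" using \<theta>_eqI u S_closed by blast
  then show "u \<in> \<theta> ` S" using w by blast
qed (use \<theta>_S in blast)

lemma \<theta>_image_products: "\<theta> ` products S k = products S k"
proof -
  have "\<theta> ` products S k = mprod G ` map \<theta> ` {xs \<in> lists S. length xs = k}"
    unfolding products_def image_image using \<theta>_mprod_eq by (intro image_cong) auto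
  also have "map \<theta> ` {xs \<in> lists S. length xs = k} = {xs \<in> map \<theta> ` lists S. length xs = k}"
    by auto
  also have "map \<theta> ` lists S = lists S"
    using lists_image[of \<theta> S] \<theta>_image_S by simp
  finally show ?thesis unfolding products_def .
qed

lemma common_products:
  assumes "x \<in> carrier G" "y \<in> carrier G"
  obtains k where "x \<in> products S k" "y \<in> products S k"
proof -
  obtain i j where ij: "x \<in> products S i" "y \<in> products S j"
    using in_products_if_generates[OF generates_S] assms by metis
  have "x \<in> products S (i + j)" "y \<in> products S (i + j)"
    using products_mono[OF S_closed one_in_S, of i "i + j"]
      products_mono[OF S_closed one_in_S, of j "i + j"] ij by auto
  then show ?thesis using that by blast
qed

text \<open>\<open>\<theta>\<close> maps each finite set of products onto itself, hence is injective; this turns left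
  cancellativity into right cancellativity.\<close>

lemma \<theta>_inj:
  assumes "\<theta> x = \<theta> y" "x \<in> carrier G" "y \<in> carrier G"
  shows "x = y"
proof -
  obtain k where k: "x \<in> products S k" "y \<in> products S k" using common_products assms by blast
  have "inj_on \<theta> (products S k)"
    using finite_surj_inj[OF finite_products[OF finite_S]] \<theta>_image_products by simp
  then show ?thesis using assms(1) k by (rule inj_onD)
qed

lemma right_cancel:
  assumes "x \<otimes> z = y \<otimes> z" "x \<in> carrier G" "y \<in> carrier G" "z \<in> carrier G"
  shows "x = y"
proof -
  have single: "x = y" if "x \<otimes> s = y \<otimes> s" "s \<in> S" "x \<in> carrier G" "y \<in> carrier G" for x y s
  proof -
    have c: "s \<in> carrier G" "s \<setminus> \<Delta> \<in> carrier G" using that S_closed rc_S \<Delta>_in_S by blast+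
    have "x \<otimes> s \<otimes> (s \<setminus> \<Delta>) = x \<otimes> \<Delta>" "y \<otimes> s \<otimes> (s \<setminus> \<Delta>) = y \<otimes> \<Delta>"
      using mult_rc_if_dvd[OF dvd_\<Delta>[OF that(2)]] c that(3,4) by (simp_all add: m_assoc)
    then have "x \<otimes> \<Delta> = y \<otimes> \<Delta>" using that(1) by simp
    then have "\<theta> x = \<theta> y" by (simp add: \<theta>_def)
    then show ?thesis using \<theta>_inj that by blast
  qed
  have "x = y" if "xs \<in> lists S" "x \<otimes> mprod G xs = y \<otimes> mprod G xs" "x \<in> carrier G" "y \<in> carrier G"
    for xs
    using that
  proof (induction xs arbitrary: x y rule: list.induct)
    case (Cons s xs)
    then have s: "s \<in> S" "xs \<in> lists S" by auto
    then have c: "s \<in> carrier G" "mprod G xs \<in> carrier G"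
      using subsetD[OF S_closed] subsetD[OF lists_mono[OF S_closed]] by simp_all
    have "x \<otimes> s = y \<otimes> s"
      using Cons.IH[of "x \<otimes> s" "y \<otimes> s"] Cons.prems s c by (simp add: m_assoc)
    then show ?case using single s Cons.prems by blast
  qed simp
  then show ?thesis using assms generated by metis
qed

lemma right_divisor_products:
  assumes "x \<in> carrier G" "y \<in> carrier G" "x \<otimes> y \<in> products S k"
  shows "y \<in> products S k"
  using rc_products[OF generates_S rc_S assms(1,3)] assms rc_mult_self by simp

text \<open>The suffixes of a factorization into non-trivial factors are pairwise distinct right
  divisors, which bounds its length.\<close>

lemma length_factorization:
  assumes "xs \<in> lists (carrier G - {\<one>})" "mprod G xs \<in> products S k"
  shows "length xs \<le> card (products S k)"
proof -
  let ?g = "\<lambda>i. mprod G (drop i xs)"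
  have lists: "take i xs \<in> lists (carrier G)" "drop i xs \<in> lists (carrier G)" for i
    using assms(1) by (auto simp: lists_eq_set dest: in_set_takeD in_set_dropD)
  have "?g i \<noteq> ?g j" if "i < j" "j \<le> length xs" for i j
  proof
    assume eq: "?g i = ?g j"
    let ?m = "take (j - i) (drop i xs)"
    have m: "?m \<in> lists (carrier G)" using lists(2)[of i] by (auto simp: lists_eq_set dest: in_set_takeD)
    have "drop i xs = ?m @ drop j xs"
      using that by (metis append_take_drop_id drop_drop le_add_diff_inverse2 less_imp_le)
    then have "?g i = mprod G ?m \<otimes> ?g j" using mprod_append[OF m lists(2)] by metis
    then have "mprod G ?m \<otimes> ?g j = \<one> \<otimes> ?g j" using eq lists by simp
    then have "mprod G ?m = \<one>" by (rule right_cancel) (use m lists in simp_all)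
    moreover have "xs ! i \<in> set ?m"
      using that by (auto simp: in_set_conv_nth intro!: exI[of _ 0])
    ultimately have "xs ! i = \<one>" using mprod_eq_one m by blast
    moreover have "xs ! i \<in> set xs" using that by simp
    ultimately show False using assms(1) by (auto simp: lists_eq_set)
  qed
  then have "inj_on ?g {0..length xs}" by (intro linorder_inj_onI) auto
  moreover have "?g ` {0..length xs} \<subseteq> products S k"
  proof clarify
    fix i
    have "mprod G xs = mprod G (take i xs) \<otimes> ?g i"
      using mprod_append[OF lists, of i i] by simp
    then show "?g i \<in> products S k" using right_divisor_products assms(2) lists mprod_closed by metis
  qed
  ultimately have "card {0..length xs} \<le> card (products S k)"
    using card_inj_on_le finite_products[OF finite_S] by blast
  then show ?thesis by simp
qed

lemma factorization_bounded:
  assumes "x \<in> carrier G"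
  shows "\<exists>N. \<forall>xs\<in>lists (carrier G - {\<one>}). mprod G xs = x \<longrightarrow> length xs \<le> N"
  using in_products_if_generates[OF generates_S assms] length_factorization by blast

text \<open>A factorization of maximal length into non-trivial factors consists of atoms.\<close>

lemma atomic: "atomic_monoid G"
proof -
  have atoms: "atoms G \<subseteq> carrier G - {\<one>}" by (auto simp: atoms_def)
  have "\<exists>xs\<in>lists (atoms G). mprod G xs = x" if x: "x \<in> carrier G" for x
  proof -
    let ?P = "\<lambda>n. \<exists>xs\<in>lists (carrier G - {\<one>}). mprod G xs = x \<and> length xs = n"
    have "?P (if x = \<one> then 0 else 1)"
    proof (cases "x = \<one>")
      case True
      then show ?thesis by (intro bexI[of _ "[]"]) auto
    next
      case False
      then show ?thesis using x by (intro bexI[of _ "[x]"]) auto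
    qed
    moreover obtain N where "\<forall>n. ?P n \<longrightarrow> n \<le> N" using factorization_bounded[OF x] by blast
    ultimately have "\<exists>n. ?P n \<and> (\<forall>m. ?P m \<longrightarrow> m \<le> n)" by (rule Nat.ex_has_greatest_nat)
    then obtain n where n: "?P n" "\<forall>m. ?P m \<longrightarrow> m \<le> n" by blast
    then obtain xs where xs: "xs \<in> lists (carrier G - {\<one>})" "mprod G xs = x" "length xs = n"
      by blast
    have "z \<in> atoms G" if "z \<in> set xs" for z
    proof (rule ccontr)
      assume "z \<notin> atoms G"
      moreover have z: "z \<in> carrier G" "z \<noteq> \<one>" using that xs by auto
      ultimately obtain u v where uv: "u \<in> carrier G - {\<one>}" "v \<in> carrier G - {\<one>}" "z = u \<otimes> v"
        unfolding atoms_def by blast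
      obtain p q where pq: "xs = p @ z # q" using split_list[OF \<open>z \<in> set xs\<close>] by blast
      then have l: "p \<in> lists (carrier G)" "q \<in> lists (carrier G)" using xs by auto
      have "mprod G (p @ u # v # q) = x"
        using xs(2) pq l uv z by (simp add: mprod_append m_assoc)
      moreover have "p @ u # v # q \<in> lists (carrier G - {\<one>})" using xs pq uv by auto
      ultimately have "?P (Suc n)" using xs(3) pq by (intro bexI[of _ "p @ u # v # q"]) auto
      then show False using n(2) by fastforce
    qed
    then show ?thesis using xs by (auto simp: lists_eq_set)
  qed
  moreover have "\<exists>N. \<forall>xs\<in>lists (atoms G). mprod G xs = x \<longrightarrow> length xs \<le> N"
    if "x \<in> carrier G" for x
    using factorization_bounded[OF that] lists_mono[OF atoms] by blast
  ultimately show ?thesis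
    unfolding atomic_monoid_def generates_def using atoms monoid_axioms by blast
qed

text \<open>A left divisor \<open>d\<close> of \<open>x\<close> is determined by its cofactor \<open>d \ x\<close>.\<close>

lemma finite_left_divisors:
  assumes "x \<in> carrier G"
  shows "finite {d. d \<preceq> x}"
proof -
  obtain k where k: "x \<in> products S k" using in_products_if_generates[OF generates_S assms] by blast
  have "inj_on (\<lambda>d. d \<setminus> x) {d. d \<preceq> x}"
  proof (rule inj_onI)
    fix d e assume de: "d \<in> {d. d \<preceq> x}" "e \<in> {d. d \<preceq> x}" "d \<setminus> x = e \<setminus> x"
    then have c: "d \<in> carrier G" "e \<in> carrier G" using dvd_closed by auto
    have "d \<otimes> (d \<setminus> x) = x" "e \<otimes> (e \<setminus> x) = x" by (rule mult_rc_if_dvd, use de in simp)+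
    then show "d = e" using de(3) c right_cancel assms rc_closed by metis
  qed
  moreover have "(\<lambda>d. d \<setminus> x) ` {d. d \<preceq> x} \<subseteq> products S k"
    using rc_products[OF generates_S rc_S _ k] dvd_closed by blast
  ultimately show ?thesis using finite_products[OF finite_S] by (meson inj_on_finite)
qed

lemma finite_right_divisors:
  assumes "x \<in> carrier G"
  shows "finite {d. right_divides G d x}"
proof -
  obtain k where k: "x \<in> products S k" using in_products_if_generates[OF generates_S assms] by blast
  have "{d. right_divides G d x} \<subseteq> products S k"
    using right_divisor_products k unfolding right_divides_def by blast
  then show ?thesis using finite_products[OF finite_S] finite_subset by blast
qed

text \<open>The left gcd is the right lcm of all common left divisors.\<close>

lemma left_gcd_exists:
  assumes "x \<in> carrier G" "y \<in> carrier G"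
  shows "\<exists>d. is_left_gcd G x y d"
proof -
  let ?A = "{d. d \<preceq> x \<and> d \<preceq> y}"
  have "finite ?A" using finite_left_divisors[OF assms(1)] by (rule finite_subset[rotated]) blast
  moreover have "\<one> \<in> ?A" using assms dvd_one by blast
  moreover have "?A \<subseteq> carrier G" using dvd_closed by blast
  moreover have "\<exists>m\<in>carrier G. x \<preceq> m \<and> y \<preceq> m \<and> (\<forall>n. x \<preceq> n \<and> y \<preceq> n \<longrightarrow> m \<preceq> n)"
    if "x \<in> carrier G" "y \<in> carrier G" for x y
    using right_lcm_exists[OF that] unfolding is_right_lcm_def by (blast dest: dvd_closed)
  ultimately obtain m where "\<forall>a\<in>?A. a \<preceq> m" "\<forall>n. (\<forall>a\<in>?A. a \<preceq> n) \<longrightarrow> m \<preceq> n"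
    using finite_upper_bound[of ?A "carrier G" "(\<preceq>)"] dvd_trans dvd_refl by blast
  then have "is_left_gcd G x y m" unfolding is_left_gcd_def by blast
  then show ?thesis ..
qed

text \<open>For a generator \<open>s\<close> with \<open>v s = \<Delta>\<close> and \<open>x = \<theta>(x')\<close>, the element \<open>\<Delta> x = x' v s\<close> is a common left
  multiple; products of generators are treated one factor at a time.\<close>

lemma common_left_multiple:
  assumes "x \<in> carrier G" "y \<in> carrier G"
  shows "\<exists>p\<in>carrier G. \<exists>q\<in>carrier G. p \<otimes> x = q \<otimes> y"
proof -
  have "\<exists>p\<in>carrier G. \<exists>q\<in>carrier G. p \<otimes> x = q \<otimes> mprod G xs" if "xs \<in> lists S" for xs
    using that assms(1)
  proof (induction xs arbitrary: x rule: rev_induct)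
    case Nil
    then show ?case by (intro bexI[of _ \<one>] bexI[of _ x]) auto
  next
    case (snoc s xs)
    then have s: "s \<in> S" "xs \<in> lists S" by auto
    then have c: "s \<in> carrier G" "mprod G xs \<in> carrier G" "xs \<in> lists (carrier G)" "[s] \<in> lists (carrier G)"
      using subsetD[OF S_closed] subsetD[OF lists_mono[OF S_closed]] by simp_all
    obtain k where k: "x \<in> products S k"
      using in_products_if_generates[OF generates_S snoc.prems(2)] by blast
    then have "x \<in> \<theta> ` products S k" by (simp add: \<theta>_image_products)
    then obtain x' where x': "x' \<in> products S k" "\<theta> x' = x" by blast
    then have x'c: "x' \<in> carrier G" using products_closed[OF S_closed] by blast
    obtain v where v: "v \<in> S" "v \<otimes> s = \<Delta>" using left_factor s by blast
    then have vc: "v \<in> carrier G" using S_closed by blast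
    obtain p q where pq: "p \<in> carrier G" "q \<in> carrier G" "p \<otimes> (x' \<otimes> v) = q \<otimes> mprod G xs"
      using snoc.IH[OF s(2), of "x' \<otimes> v"] x'c vc by blast
    have "p \<otimes> \<Delta> \<otimes> x = p \<otimes> (x' \<otimes> (v \<otimes> s))"
      using \<theta>_mult[OF x'c] x'(2) v pq snoc.prems by (simp add: m_assoc)
    also have "\<dots> = p \<otimes> (x' \<otimes> v) \<otimes> s" using pq(1) x'c vc c by (simp add: m_assoc)
    also have "\<dots> = q \<otimes> mprod G xs \<otimes> s" by (simp only: pq(3))
    also have "\<dots> = q \<otimes> mprod G (xs @ [s])"
      using pq(2) c by (simp add: mprod_append m_assoc)
    finally show ?case using pq by (intro bexI[of _ "p \<otimes> \<Delta>"] bexI[of _ q]) simp_all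
  qed
  then show ?thesis using generated[OF assms(2)] by metis
qed

lemma right_dvd_trans: "right_divides G x y \<Longrightarrow> right_divides G y z \<Longrightarrow> right_divides G x z"
  unfolding right_divides_def by (metis m_assoc m_closed)

text \<open>Dividing a common left multiple \<open>p x = q y\<close> by the left gcd of \<open>p\<close> and \<open>q\<close> yields the left
  lcm of \<open>x\<close> and \<open>y\<close>.\<close>

lemma left_lcm_exists:
  assumes x: "x \<in> carrier G" and y: "y \<in> carrier G"
  shows "\<exists>m. is_left_lcm G x y m"
proof -
  obtain p q where pq: "p \<in> carrier G" "q \<in> carrier G" "p \<otimes> x = q \<otimes> y"
    using common_left_multiple assms by blast
  obtain g where g: "is_left_gcd G p q g" using left_gcd_exists pq by blast
  obtain p' q' where p'q': "p' \<in> carrier G" "q' \<in> carrier G" "p = g \<otimes> p'" "q = g \<otimes> q'"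
    and gc: "g \<in> carrier G"
    using g unfolding is_left_gcd_def left_divides_def by blast
  have coprime: "d = \<one>" if "d \<preceq> p'" "d \<preceq> q'" for d
  proof -
    have dc: "d \<in> carrier G" using that dvd_closed by blast
    then have "g \<otimes> d \<preceq> p" "g \<otimes> d \<preceq> q" using that p'q' gc by (simp_all add: dvd_mult_cancel)
    then have "g \<otimes> d \<preceq> g \<otimes> \<one>" using g gc unfolding is_left_gcd_def by simp
    then show ?thesis using dc gc dvd_mult_cancel[of g d \<one>] by (simp add: dvd_one_iff)
  qed
  define m where "m = p' \<otimes> x"
  have "g \<otimes> (p' \<otimes> x) = g \<otimes> (q' \<otimes> y)" using pq p'q' gc x y by (simp add: m_assoc)
  then have m: "m = q' \<otimes> y" unfolding m_def using left_cancel gc p'q' x y m_closed by blast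
  have mc: "m \<in> carrier G" using m_def p'q' x by simp
  have "right_divides G m n" if n: "right_divides G x n" "right_divides G y n" for n
  proof -
    obtain a b where ab: "a \<in> carrier G" "b \<in> carrier G" "a \<otimes> x = n" "b \<otimes> y = n"
      and nc: "n \<in> carrier G"
      using n unfolding right_divides_def by blast
    obtain e e' where e: "e \<in> carrier G" "e' \<in> carrier G" "e \<otimes> m = e' \<otimes> n"
      using common_left_multiple mc nc by blast
    have "e \<otimes> p' \<otimes> x = e' \<otimes> a \<otimes> x" "e \<otimes> q' \<otimes> y = e' \<otimes> b \<otimes> y"
      using e(3) ab p'q' e x y m_def by (simp_all add: m_assoc) (simp add: m m_assoc[symmetric])
    then have "e \<otimes> p' = e' \<otimes> a" "e \<otimes> q' = e' \<otimes> b"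
      using right_cancel e ab p'q' x y m_closed by blast+
    then have e'_dvd: "e' \<preceq> e \<otimes> p'" "e' \<preceq> e \<otimes> q'" using e ab by (simp_all add: dvdI)
    have "e \<setminus> e' \<preceq> p'" "e \<setminus> e' \<preceq> q'"
      using e'_dvd e p'q' by (simp_all add: rc_dvd_iff)
    then have "e \<setminus> e' = \<one>" by (rule coprime)
    then have "e' \<preceq> e" using e(1,2) by (simp add: rc_eq_one_iff)
    then obtain r where r: "r \<in> carrier G" "e = e' \<otimes> r" unfolding left_divides_def by blast
    have "e' \<otimes> (r \<otimes> m) = e' \<otimes> n" using e r mc by (simp add: m_assoc)
    then have "r \<otimes> m = n" using left_cancel e r mc nc m_closed by blast
    then show ?thesis using r mc nc unfolding right_divides_def by blast
  qed
  moreover have "right_divides G x m" "right_divides G y m"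
    using m m_def p'q'(1,2) x y mc unfolding right_divides_def by auto
  ultimately have "is_left_lcm G x y m" unfolding is_left_lcm_def by blast
  then show ?thesis ..
qed

text \<open>The right gcd is the left lcm of all common right divisors.\<close>

lemma right_gcd_exists:
  assumes "x \<in> carrier G" "y \<in> carrier G"
  shows "\<exists>d. is_right_gcd G x y d"
proof -
  let ?A = "{d. right_divides G d x \<and> right_divides G d y}"
  have "finite ?A" using finite_right_divisors[OF assms(1)] by (rule finite_subset[rotated]) blast
  moreover have "\<one> \<in> ?A" using assms unfolding right_divides_def by auto
  moreover have "?A \<subseteq> carrier G" by (auto simp: right_divides_def)
  moreover have "\<exists>m\<in>carrier G. right_divides G x m \<and> right_divides G y m \<and>
      (\<forall>n. right_divides G x n \<and> right_divides G y n \<longrightarrow> right_divides G m n)"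
    if "x \<in> carrier G" "y \<in> carrier G" for x y
    using left_lcm_exists[OF that] unfolding is_left_lcm_def right_divides_def by blast
  moreover have "right_divides G x x" if "x \<in> carrier G" for x
    using that unfolding right_divides_def by (auto intro: bexI[of _ \<one>])
  ultimately obtain m where "\<forall>a\<in>?A. right_divides G a m"
      "\<forall>n. (\<forall>a\<in>?A. right_divides G a n) \<longrightarrow> right_divides G m n"
    using finite_upper_bound[of ?A "carrier G" "right_divides G"] right_dvd_trans by blast
  then have "is_right_gcd G x y m" unfolding is_right_gcd_def by blast
  then show ?thesis ..
qed

lemma gaussian: "gaussian_monoid G"
proof -
  have "monoid_cancel G"
    by unfold_locales (use left_cancel right_cancel in blast)+
  then show ?thesis
    unfolding gaussian_monoid_def
    using atomic right_lcm_exists left_lcm_exists left_gcd_exists right_gcd_exists by simp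
qed

lemma right_divisors_\<Delta>: "{x. right_divides G x \<Delta>} = S"
proof (intro equalityI subsetI)
  fix y assume "y \<in> {x. right_divides G x \<Delta>}"
  then obtain x where "x \<in> carrier G" "y \<in> carrier G" "x \<otimes> y = \<Delta>"
    unfolding right_divides_def by blast
  then show "y \<in> S" using rc_generated[OF generates_S rc_S _ \<Delta>_in_S] rc_mult_self by metis
next
  fix u assume "u \<in> S"
  then show "u \<in> {x. right_divides G x \<Delta>}"
    using left_factor S_closed \<Delta>_closed unfolding right_divides_def by blast
qed

lemma left_divisors_\<Delta>: "{x. x \<preceq> \<Delta>} = S"
proof (intro equalityI subsetI)
  fix x assume "x \<in> {x. x \<preceq> \<Delta>}"
  then obtain y where y: "x \<in> carrier G" "y \<in> carrier G" "x \<otimes> y = \<Delta>"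
    unfolding left_divides_def by blast
  then have "y \<in> S" using right_divisors_\<Delta> \<Delta>_closed unfolding right_divides_def by blast
  then obtain v where "v \<in> S" "v \<otimes> y = \<Delta>" using left_factor by blast
  moreover from this have "v = x" using right_cancel y S_closed by blast
  ultimately show "x \<in> S" by simp
qed (use dvd_\<Delta> in blast)

theorem garside: "garside_monoid G"
  unfolding garside_monoid_def garside_element_def
  using gaussian left_divisors_\<Delta> right_divisors_\<Delta> finite_S generates_S \<Delta>_closed by (auto intro!: exI[of _ \<Delta>])

end


section \<open>Presented monoids\<close>

context
  fixes \<Sigma> :: "'a set" and R :: "('a list \<times> 'a list) set"
begin

abbreviation (input) cls where "cls \<equiv> word_class \<Sigma> R"

lemma equiv_word_congruence: "equiv (lists \<Sigma>) (word_congruence \<Sigma> R)"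
proof (rule equivI)
  show "word_congruence \<Sigma> R \<subseteq> lists \<Sigma> \<times> lists \<Sigma>"
    by (intro subrelI SigmaI) (rule word_congruence_lists, assumption)+
  show "refl_on (lists \<Sigma>) (word_congruence \<Sigma> R)"
    by (intro refl_onI word_congruence.refl)
  show "sym (word_congruence \<Sigma> R)"
    using word_congruence.sym by (auto intro!: symI)
  show "trans (word_congruence \<Sigma> R)"
    using word_congruence.trans by (blast intro: transI)
qed

lemma word_class_eq_iff:
  assumes "u \<in> lists \<Sigma>" "v \<in> lists \<Sigma>"
  shows "cls u = cls v \<longleftrightarrow> (u, v) \<in> word_congruence \<Sigma> R"
  unfolding word_class_def using eq_equiv_class_iff[OF equiv_word_congruence] assms by blast

lemma carrier_presented_monoid: "carrier (presented_monoid \<Sigma> R) = cls ` lists \<Sigma>"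
  by (auto simp: presented_monoid_def quotient_def word_class_def)

lemma word_class_in_carrier: "u \<in> lists \<Sigma> \<Longrightarrow> cls u \<in> carrier (presented_monoid \<Sigma> R)"
  by (simp add: carrier_presented_monoid)

lemma one_presented_monoid: "\<one>\<^bsub>presented_monoid \<Sigma> R\<^esub> = cls []"
  by (simp add: presented_monoid_def)

lemma mult_word_class:
  assumes "u \<in> lists \<Sigma>" "v \<in> lists \<Sigma>"
  shows "cls u \<otimes>\<^bsub>presented_monoid \<Sigma> R\<^esub> cls v = cls (u @ v)"
proof -
  have "cls (u' @ v') = cls (u @ v)" if "u' \<in> cls u" "v' \<in> cls v" for u' v'
  proof -
    have *: "(u @ v, u' @ v') \<in> word_congruence \<Sigma> R"
      using that by (auto simp: word_class_def intro: word_congruence.append)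
    then show ?thesis
      using word_class_eq_iff[OF word_congruence_lists[OF *]] by simp
  qed
  moreover have "u \<in> cls u" "v \<in> cls v"
    using assms by (auto simp: word_class_def intro: word_congruence.refl)
  ultimately have "(\<Union>u'\<in>cls u. \<Union>v'\<in>cls v. cls (u' @ v')) = cls (u @ v)" by blast
  then show ?thesis by (simp add: presented_monoid_def)
qed

lemma monoid_presented_monoid: "monoid (presented_monoid \<Sigma> R)"
  by (rule monoidI)
    (auto simp: carrier_presented_monoid one_presented_monoid mult_word_class lists_eq_set)

lemma mprod_presented_monoid:
  "u \<in> lists \<Sigma> \<Longrightarrow> mprod (presented_monoid \<Sigma> R) (map (\<lambda>a. cls [a]) u) = cls u"
  by (induction u rule: list.induct) (auto simp: one_presented_monoid mult_word_class)

lemma generates_presented_monoid: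
  "generates (presented_monoid \<Sigma> R) ((\<lambda>a. cls [a]) ` \<Sigma>)"
  unfolding generates_def
proof safe
  fix x assume "x \<in> carrier (presented_monoid \<Sigma> R)"
  then obtain u where u: "u \<in> lists \<Sigma>" "x = cls u" by (auto simp: carrier_presented_monoid)
  then show "\<exists>xs\<in>lists ((\<lambda>a. cls [a]) ` \<Sigma>). mprod (presented_monoid \<Sigma> R) xs = x"
    using mprod_presented_monoid by (intro bexI[of _ "map (\<lambda>a. cls [a]) u"]) auto
qed (auto intro: word_class_in_carrier)

end


section \<open>Words representing elements of a monoid with right lcm's\<close>

text \<open>A closure inside a set on which the operation is total is the intersection of all closed sets.\<close>

lemma is_closure_exists:
  assumes "A \<subseteq> lists \<Sigma>" "closed_under c (lists \<Sigma>)"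
  shows "\<exists>C. is_closure \<Sigma> c A C"
proof -
  let ?F = "{D. D \<subseteq> lists \<Sigma> \<and> A \<subseteq> D \<and> closed_under c D}"
  have F: "lists \<Sigma> \<in> ?F" using assms by blast
  moreover have "closed_under c (\<Inter>?F)"
  proof (rule closed_under_def[THEN iffD2], intro ballI)
    fix u v assume uv: "u \<in> \<Inter>?F" "v \<in> \<Inter>?F"
    then have "u \<in> lists \<Sigma>" "v \<in> lists \<Sigma>" using InterD[OF _ F] by blast+
    then obtain w where w: "c u v = Some w"
      using assms(2) unfolding closed_under_def by blast
    have "w \<in> D" if "D \<in> ?F" for D
    proof -
      have "u \<in> D" "v \<in> D" using InterD[OF uv(1) that] InterD[OF uv(2) that] .
      moreover have "closed_under c D" using that by simp
      ultimately obtain w' where "w' \<in> D" "c u v = Some w'"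
        unfolding closed_under_def by blast
      then show ?thesis using w by simp
    qed
    then have "w \<in> \<Inter>?F" by (rule InterI)
    with w show "\<exists>w\<in>\<Inter>?F. c u v = Some w" by (rule bexI)
  qed
  moreover have "A \<subseteq> \<Inter>?F" by blast
  moreover have "\<Inter>?F \<subseteq> D" if "D \<subseteq> lists \<Sigma> \<and> A \<subseteq> D \<and> closed_under c D" for D
    using that by (intro Inter_lower) simp
  moreover have "\<Inter>?F \<subseteq> lists \<Sigma>" using F by (rule Inter_lower)
  ultimately have "is_closure \<Sigma> c A (\<Inter>?F)"
    unfolding is_closure_def using assms by (intro conjI allI impI) (assumption | simp)+
  then show ?thesis ..
qed

text \<open>The letters are mapped to a generating family of \<open>G\<close>, and reversing is total and computes
  complements in \<open>G\<close>.\<close>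

locale reversing_model = lcm_monoid +
  fixes \<iota> :: "'c \<Rightarrow> 'a" and \<Sigma> :: "'c set" and f :: "'c \<Rightarrow> 'c \<Rightarrow> 'c list option"
  assumes generates_letters: "generates G (\<iota> ` \<Sigma>)"
    and complement: "\<And>u v. u \<in> lists \<Sigma> \<Longrightarrow> v \<in> lists \<Sigma> \<Longrightarrow>
      \<exists>w\<in>lists \<Sigma>. word_complement f u v = Some w \<and>
        mprod G (map \<iota> w) = mprod G (map \<iota> u) \<setminus> mprod G (map \<iota> v)"
begin

text \<open>The element represented by a word.\<close>

abbreviation ev where "ev u \<equiv> mprod G (map \<iota> u)"

lemma letters_closed: "a \<in> \<Sigma> \<Longrightarrow> \<iota> a \<in> carrier G"
  using generates_letters unfolding generates_def by blast

lemma map_letters_closed: "u \<in> lists \<Sigma> \<Longrightarrow> map \<iota> u \<in> lists (carrier G)"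
  using letters_closed by (auto simp: lists_eq_set)

lemma ev_closed: "u \<in> lists \<Sigma> \<Longrightarrow> ev u \<in> carrier G"
  using map_letters_closed by simp

lemma ev_append: "u \<in> lists \<Sigma> \<Longrightarrow> v \<in> lists \<Sigma> \<Longrightarrow> ev (u @ v) = ev u \<otimes> ev v"
  using map_letters_closed by (simp add: mprod_append)

lemma ev_complement:
  assumes "u \<in> lists \<Sigma>" "v \<in> lists \<Sigma>" "word_complement f u v = Some w"
  shows "w \<in> lists \<Sigma>" "ev w = ev u \<setminus> ev v"
  using complement[OF assms(1,2)] assms(3) by auto

lemma closed_under_word_complement: "closed_under (word_complement f) (lists \<Sigma>)"
  using complement unfolding closed_under_def by blast

lemma word_lcm:
  assumes "u \<in> lists \<Sigma>" "v \<in> lists \<Sigma>"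
  shows "\<exists>w\<in>lists \<Sigma>. word_lcm f u v = Some w \<and> ev w = ev u \<otimes> (ev u \<setminus> ev v)"
proof -
  obtain w where w: "w \<in> lists \<Sigma>" "word_complement f u v = Some w" "ev w = ev u \<setminus> ev v"
    using complement assms by blast
  have "ev (u @ w) = ev u \<otimes> (ev u \<setminus> ev v)" using ev_append[OF assms(1) w(1)] w(3) by simp
  moreover have "word_lcm f u v = Some (u @ w)" using w(2) by (simp add: word_lcm_def)
  moreover have "u @ w \<in> lists \<Sigma>" using assms(1) w(1) by simp
  ultimately show ?thesis by blast
qed

lemma closed_under_word_lcm: "closed_under (word_lcm f) (lists \<Sigma>)"
  using word_lcm unfolding closed_under_def by blast

lemma rc_complement_closure:
  assumes "is_closure \<Sigma> (word_complement f) A T" "s \<in> ev ` T" "t \<in> ev ` T"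
  shows "s \<setminus> t \<in> ev ` T"
proof -
  obtain u v where uv: "u \<in> T" "v \<in> T" "s = ev u" "t = ev v" using assms by blast
  have T: "T \<subseteq> lists \<Sigma>" "closed_under (word_complement f) T"
    using assms(1) unfolding is_closure_def by blast+
  obtain w where "w \<in> T" "word_complement f u v = Some w"
    using T uv unfolding closed_under_def by blast
  moreover from this have "ev w = s \<setminus> t" using ev_complement(2)[of u v w] uv subsetD[OF T(1)] by simp
  ultimately show ?thesis by (metis image_eqI)
qed

lemma ev_lcm_closure:
  assumes "is_closure \<Sigma> (word_lcm f) T V"
  shows "ev ` V = lcm_closure (ev ` T)"
proof (intro equalityI subsetI)
  have V: "V \<subseteq> lists \<Sigma>" "T \<subseteq> V" "closed_under (word_lcm f) V"
    "\<And>D. D \<subseteq> lists \<Sigma> \<Longrightarrow> T \<subseteq> D \<Longrightarrow> closed_under (word_lcm f) D \<Longrightarrow> V \<subseteq> D"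
    using assms unfolding is_closure_def by blast+
  have T: "ev ` T \<subseteq> carrier G" using V ev_closed by blast
  let ?D = "{u \<in> lists \<Sigma>. ev u \<in> lcm_closure (ev ` T)}"
  have "closed_under (word_lcm f) ?D"
    unfolding closed_under_def
  proof (intro ballI)
    fix u v assume uv: "u \<in> ?D" "v \<in> ?D"
    then obtain w where w: "w \<in> lists \<Sigma>" "word_lcm f u v = Some w"
        "ev w = ev u \<otimes> (ev u \<setminus> ev v)"
      using word_lcm by blast
    then have "w \<in> ?D" using uv lcm_closure_join[OF T] by simp
    then show "\<exists>w\<in>?D. word_lcm f u v = Some w" using w by blast
  qed
  moreover have "T \<subseteq> ?D" using V(1,2) by (auto intro!: lcm_closure.base)
  ultimately have "V \<subseteq> ?D" using V(4)[of ?D] by blast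
  then show "x \<in> lcm_closure (ev ` T)" if "x \<in> ev ` V" for x using that by blast
  show "x \<in> ev ` V" if "x \<in> lcm_closure (ev ` T)" for x
    using that
  proof (induction rule: lcm_closure.induct)
    case (base t)
    then show ?case using V by blast
  next
    case (join s t)
    then obtain u v where uv: "u \<in> V" "v \<in> V" "s = ev u" "t = ev v" using V by blast
    obtain w where w: "w \<in> V" "word_lcm f u v = Some w"
      using V uv unfolding closed_under_def by blast
    have "u \<in> lists \<Sigma>" "v \<in> lists \<Sigma>" using uv V(1) by blast+
    then have "ev w = s \<otimes> (s \<setminus> t)" using word_lcm[of u v] w(2) uv(3,4) by force
    then show ?case using w(1) by (metis image_eqI)
  qed
qed

lemma ev_word_congruence:
  assumes "(u, v) \<in> word_congruence \<Sigma> (complement_relations f)"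
  shows "ev u = ev v"
  using assms
proof induction
  case (rel u v)
  then obtain a b p q where *: "u = a # p" "v = b # q" "f a b = Some p" "f b a = Some q"
    unfolding complement_relations_def by blast
  then have l: "a \<in> \<Sigma>" "b \<in> \<Sigma>" "p \<in> lists \<Sigma>" "q \<in> lists \<Sigma>" using rel by auto
  have "word_complement f [a] [b] = Some p" "word_complement f [b] [a] = Some q"
    using reversing_square_letters[of f, OF *(3,4)] reversing_square_letters[of f, OF *(4,3)]
    unfolding word_complement_eq_Some_iff by blast+
  then have "ev p = \<iota> a \<setminus> \<iota> b" "ev q = \<iota> b \<setminus> \<iota> a"
    using ev_complement(2)[of "[a]" "[b]" p] ev_complement(2)[of "[b]" "[a]" q] l letters_closed
    by simp_all
  then show ?case using * join_commute letters_closed l by simp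
next
  case (append u v u' v')
  then show ?case using word_congruence_lists ev_append by metis
qed simp_all

text \<open>The words of the closure under lcm's represent a generating set closed under complements, with
  the class of \<open>\<Omega>\<close> as its greatest element.\<close>

lemma garside_monoid_if_garside_conditions:
  assumes "\<Sigma> \<noteq> {}" "garside_conditions \<Sigma> f"
  shows "garside_monoid G"
proof -
  obtain T V \<Omega> where T: "is_closure \<Sigma> (word_complement f) ((\<lambda>a. [a]) ` \<Sigma>) T" "finite T"
    and V: "is_closure \<Sigma> (word_lcm f) T V" and \<Omega>: "\<Omega> \<in> V"
    and top: "\<And>u. u \<in> V \<Longrightarrow> word_complement f \<Omega> u = Some []"
    and factor: "\<And>u. u \<in> V \<Longrightarrow> \<exists>v\<in>V. \<exists>w. word_complement f v \<Omega> = Some w \<and>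
      (w, u) \<in> word_congruence \<Sigma> (complement_relations f)"
    using assms(2) unfolding garside_conditions_def by blast
  have sub: "V \<subseteq> lists \<Sigma>" "T \<subseteq> V" using V unfolding is_closure_def by blast+
  have closed: "ev ` T \<subseteq> carrier G" "ev ` V \<subseteq> carrier G" using sub ev_closed by blast+
  have V_eq: "ev ` V = lcm_closure (ev ` T)" using ev_lcm_closure V by blast
  have top': "ev u \<preceq> ev \<Omega>" if "u \<in> V" for u
  proof -
    have l: "\<Omega> \<in> lists \<Sigma>" "u \<in> lists \<Sigma>" using that \<Omega> sub by blast+
    then show ?thesis
      using ev_complement(2)[OF l top[OF that]] rc_eq_one_iff[of "ev \<Omega>" "ev u"] ev_closed by simp
  qed
  have letters: "\<iota> ` \<Sigma> \<subseteq> ev ` V"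
  proof
    fix x assume "x \<in> \<iota> ` \<Sigma>"
    then obtain a where a: "a \<in> \<Sigma>" "x = \<iota> a" by blast
    have "(\<lambda>a. [a]) ` \<Sigma> \<subseteq> T" using T(1) unfolding is_closure_def by (elim conjE)
    then have "[a] \<in> V" using a(1) sub(2) by blast
    moreover have "ev [a] = x" using a letters_closed by simp
    ultimately show "x \<in> ev ` V" by blast
  qed
  have "garside_family G (ev ` V) (ev \<Omega>)"
  proof unfold_locales
    show "finite (ev ` V)" using V_eq finite_lcm_closure[OF closed(1)] T(2) by simp
    show "generates G (ev ` V)"
      unfolding generates_def
    proof (intro conjI ballI)
      fix x assume "x \<in> carrier G"
      then obtain xs where "xs \<in> lists (\<iota> ` \<Sigma>)" "mprod G xs = x"
        using generates_letters unfolding generates_def by blast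
      then show "\<exists>xs\<in>lists (ev ` V). mprod G xs = x" using lists_mono[OF letters] by (metis subsetD)
    qed (rule closed(2))
    show "s \<setminus> t \<in> ev ` V" if "s \<in> ev ` V" "t \<in> ev ` V" for s t
      using rc_lcm_closure[OF closed(1) rc_complement_closure[OF T(1)]] that V_eq by simp
    show "ev \<Omega> \<in> ev ` V" using \<Omega> by blast
    show "s \<preceq> ev \<Omega>" if "s \<in> ev ` V" for s using that top' by blast
    show "\<exists>v\<in>ev ` V. v \<otimes> u = ev \<Omega>" if u: "u \<in> ev ` V" for u
    proof -
      obtain u' where u': "u' \<in> V" "u = ev u'" using u by blast
      then obtain v w where vw: "v \<in> V" "word_complement f v \<Omega> = Some w"
          "(w, u') \<in> word_congruence \<Sigma> (complement_relations f)"
        using factor by blast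
      have "u = ev v \<setminus> ev \<Omega>"
        using ev_word_congruence[OF vw(3)] ev_complement(2)[of v \<Omega> w] u' vw \<Omega> sub by auto
      then have "ev v \<otimes> u = ev \<Omega>" using mult_rc_if_dvd top' vw by simp
      then show ?thesis using vw by blast
    qed
  qed
  then show ?thesis by (rule garside_family.garside)
qed

end

text \<open>With non-trivial letters, reversing to the empty word detects equality in \<open>G\<close>. Right cancellation
  serves to solve \<open>v \ \<Omega> = u\<close> for \<open>v\<close>.\<close>

locale faithful_reversing_model = reversing_model +
  assumes letters_map: "partial_word_map \<Sigma> f"
    and letters_nontrivial: "\<And>a. a \<in> \<Sigma> \<Longrightarrow> \<iota> a \<noteq> \<one>"
    and right_cancel: "\<lbrakk>x \<otimes> z = y \<otimes> z; x \<in> carrier G; y \<in> carrier G; z \<in> carrier G\<rbrakk> \<Longrightarrow> x = y"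
begin

lemma Nil_if_ev_eq_one:
  assumes "u \<in> lists \<Sigma>" "ev u = \<one>"
  shows "u = []"
proof (cases u)
  case (Cons a v)
  then have "\<iota> a = \<one>" using mprod_eq_one[OF assms(2) map_letters_closed[OF assms(1)]] by simp
  then show ?thesis using letters_nontrivial assms(1) Cons by auto
qed simp

lemma reversing_square_if_ev_eq:
  assumes "u \<in> lists \<Sigma>" "v \<in> lists \<Sigma>" "ev u = ev v"
  shows "reversing_square f u v [] []"
proof -
  obtain w w' where w: "w \<in> lists \<Sigma>" "word_complement f u v = Some w" "ev w = ev u \<setminus> ev v"
    and w': "w' \<in> lists \<Sigma>" "word_complement f v u = Some w'" "ev w' = ev v \<setminus> ev u"
    using complement assms(1,2) by meson
  then have "w = []" "w' = []" using Nil_if_ev_eq_one ev_closed assms by simp_all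
  then show ?thesis
    using w(2) w'(2) unfolding word_complement_eq_Some_iff
    by (metis reversing_square_sym reversing_square_unique)
qed

lemma word_congruence_iff_ev_eq:
  assumes "u \<in> lists \<Sigma>" "v \<in> lists \<Sigma>"
  shows "(u, v) \<in> word_congruence \<Sigma> (complement_relations f) \<longleftrightarrow> ev u = ev v"
proof
  assume "ev u = ev v"
  then have "reversing_square f u v [] []" by (rule reversing_square_if_ev_eq[OF assms])
  from reversing_square_sound[OF letters_map this assms]
  show "(u, v) \<in> word_congruence \<Sigma> (complement_relations f)" by simp
qed (rule ev_word_congruence)

lemma cube: "cube_property f (Some ` lists \<Sigma>)"
  unfolding cube_property_def
proof (intro ballI)
  fix p q r assume "p \<in> Some ` lists \<Sigma>" "q \<in> Some ` lists \<Sigma>" "r \<in> Some ` lists \<Sigma>"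
  then obtain u v w where l: "u \<in> lists \<Sigma>" "v \<in> lists \<Sigma>" "w \<in> lists \<Sigma>"
    and pqr: "p = Some u" "q = Some v" "r = Some w" by blast
  obtain uv uw where 1: "word_complement f u v = Some uv" "word_complement f u w = Some uw"
      "uv \<in> lists \<Sigma>" "uw \<in> lists \<Sigma>" "ev uv = ev u \<setminus> ev v" "ev uw = ev u \<setminus> ev w"
    using complement l by meson
  obtain vu vw where 2: "word_complement f v u = Some vu" "word_complement f v w = Some vw"
      "vu \<in> lists \<Sigma>" "vw \<in> lists \<Sigma>" "ev vu = ev v \<setminus> ev u" "ev vw = ev v \<setminus> ev w"
    using complement l by meson
  obtain x y where 3: "word_complement f uv uw = Some x" "word_complement f vu vw = Some y"
      "x \<in> lists \<Sigma>" "y \<in> lists \<Sigma>" "ev x = ev uv \<setminus> ev uw" "ev y = ev vu \<setminus> ev vw"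
    using complement 1 2 by meson
  have "ev x = ev y" using 1 2 3 rc_cube ev_closed l by simp
  then have "reversing_square f x y [] []" using reversing_square_if_ev_eq 3 by blast
  then show "reversing_equiv f
      (word_complement_opt f (word_complement_opt f p q) (word_complement_opt f p r))
      (word_complement_opt f (word_complement_opt f q p) (word_complement_opt f q r))"
    by (simp add: pqr word_complement_opt_def 1 2 3 reversing_square_def)
qed

lemma admits_complemented_presentation:
  "admits_presentation G \<iota> \<Sigma> (complement_relations f)"
proof -
  let ?R = "complement_relations f"
  let ?P = "presented_monoid \<Sigma> ?R"
  define h where "h A = the_elem (ev ` A)" for A
  have h: "h (word_class \<Sigma> ?R u) = ev u" if "u \<in> lists \<Sigma>" for u
  proof -
    have "ev ` word_class \<Sigma> ?R u = {ev u}"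
      using ev_word_congruence that word_congruence.refl unfolding word_class_def by force
    then show ?thesis by (simp add: h_def)
  qed
  have h_closed: "h x \<in> carrier G" if x: "x \<in> carrier ?P" for x
  proof -
    obtain u where "u \<in> lists \<Sigma>" "x = word_class \<Sigma> ?R u"
      using x unfolding carrier_presented_monoid by blast
    then show ?thesis using h ev_closed by simp
  qed
  have "h \<in> hom ?P G"
  proof (rule homI)
    fix x y assume "x \<in> carrier ?P" "y \<in> carrier ?P"
    then obtain u v where uv: "u \<in> lists \<Sigma>" "v \<in> lists \<Sigma>"
      "x = word_class \<Sigma> ?R u" "y = word_class \<Sigma> ?R v"
      by (auto simp: carrier_presented_monoid)
    have "u @ v \<in> lists \<Sigma>" using uv by simp
    then show "h (x \<otimes>\<^bsub>?P\<^esub> y) = h x \<otimes> h y"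
      using uv h ev_append mult_word_class by metis
  qed (rule h_closed)
  moreover have "inj_on h (carrier ?P)"
  proof (rule inj_onI)
    fix x y assume "x \<in> carrier ?P" "y \<in> carrier ?P" and eq: "h x = h y"
    then obtain u v where uv: "u \<in> lists \<Sigma>" "v \<in> lists \<Sigma>"
      "x = word_class \<Sigma> ?R u" "y = word_class \<Sigma> ?R v"
      unfolding carrier_presented_monoid by blast
    then have "ev u = ev v" using h[OF uv(1)] h[OF uv(2)] eq by simp
    then have "(u, v) \<in> word_congruence \<Sigma> ?R"
      using word_congruence_iff_ev_eq[OF uv(1,2)] by simp
    then show "x = y" using word_class_eq_iff[OF uv(1,2)] uv(3,4) by simp
  qed
  moreover have "h ` carrier ?P = carrier G"
  proof (intro equalityI subsetI)
    fix x assume "x \<in> carrier G"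
    then obtain xs where xs: "xs \<in> lists (\<iota> ` \<Sigma>)" "mprod G xs = x"
      using generates_letters unfolding generates_def by blast
    then obtain u where u: "u \<in> lists \<Sigma>" "xs = map \<iota> u" by (auto simp: lists_image)
    then have "x = h (word_class \<Sigma> ?R u)" using h[OF u(1)] xs by simp
    then show "x \<in> h ` carrier ?P" using word_class_in_carrier[OF u(1)] by (rule image_eqI)
  qed (use h_closed in blast)
  ultimately have "h \<in> iso ?P G" by (simp add: iso_def bij_betw_def)
  moreover have "h (word_class \<Sigma> ?R [a]) = \<iota> a" if "a \<in> \<Sigma>" for a
    using h[of "[a]"] that letters_closed by simp
  ultimately show ?thesis unfolding admits_presentation_def by blast
qed

lemma garside_conditions_if_finite:
  assumes "\<Sigma> \<noteq> {}" and T: "is_closure \<Sigma> (word_complement f) ((\<lambda>a. [a]) ` \<Sigma>) T" "finite T"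
  shows "garside_conditions \<Sigma> f"
proof -
  have subT: "T \<subseteq> lists \<Sigma>" and neT: "T \<noteq> {}" using T assms(1) unfolding is_closure_def by blast+
  obtain V where V: "is_closure \<Sigma> (word_lcm f) T V"
    using is_closure_exists[OF subT closed_under_word_lcm] by blast
  have sub: "V \<subseteq> lists \<Sigma>" "T \<subseteq> V" using V unfolding is_closure_def by blast+
  have closed: "ev ` T \<subseteq> carrier G" using subT ev_closed by blast
  let ?L = "lcm_closure (ev ` T)"
  have V_eq: "ev ` V = ?L" using ev_lcm_closure V by blast
  obtain d where d: "d \<in> ?L" "\<And>s. s \<in> ?L \<Longrightarrow> s \<preceq> d"
    using finite_lcm_closure_top[OF closed] T(2) neT by blast
  have Lc: "?L \<subseteq> carrier G" using lcm_closure_closed[OF closed] by blast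
  obtain \<Omega> where \<Omega>: "\<Omega> \<in> V" "ev \<Omega> = d" using d(1) unfolding V_eq[symmetric] by blast
  \<comment> \<open>Right cancellation makes \<open>v \<mapsto> v \ \<Omega>\<close> injective on the finite closure, hence onto.\<close>
  have inj: "inj_on (\<lambda>v. v \<setminus> d) ?L"
  proof (rule inj_onI)
    fix v v' assume v: "v \<in> ?L" "v' \<in> ?L" and eq: "v \<setminus> d = v' \<setminus> d"
    have c: "v \<in> carrier G" "v' \<in> carrier G" "d \<in> carrier G" using v d(1) Lc by blast+
    have *: "v \<otimes> (v \<setminus> d) = v' \<otimes> (v \<setminus> d)"
      using mult_rc_if_dvd[OF d(2)[OF v(1)]] mult_rc_if_dvd[OF d(2)[OF v(2)]] eq by simp
    show "v = v'" using c by (intro right_cancel[OF *]) simp_all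
  qed
  have "(\<lambda>v. v \<setminus> d) ` ?L \<subseteq> ?L"
    using rc_lcm_closure[OF closed rc_complement_closure[OF T(1)]] d(1) by blast
  then have surj: "(\<lambda>v. v \<setminus> d) ` ?L = ?L"
    using endo_inj_surj inj finite_lcm_closure[OF closed] T(2) by blast
  have "cube_property f (Some ` T)"
    using cube subT unfolding cube_property_def by blast
  moreover have "\<forall>u\<in>V. word_complement f \<Omega> u = Some [] \<and>
      (\<exists>v\<in>V. \<exists>w. word_complement f v \<Omega> = Some w \<and> (w, u) \<in> word_congruence \<Sigma> (complement_relations f))"
  proof (intro ballI conjI)
    fix u assume u: "u \<in> V"
    then have ul: "u \<in> lists \<Sigma>" "\<Omega> \<in> lists \<Sigma>" using sub \<Omega> by auto
    obtain w where w: "w \<in> lists \<Sigma>" "word_complement f \<Omega> u = Some w" "ev w = ev \<Omega> \<setminus> ev u"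
      using complement[of \<Omega> u] ul by blast
    have "ev u \<preceq> ev \<Omega>" using u V_eq d \<Omega> by blast
    then have "ev w = \<one>" using w ul ev_closed by (simp add: rc_eq_one_iff)
    then show "word_complement f \<Omega> u = Some []" using Nil_if_ev_eq_one w by simp
    have "ev u \<in> (\<lambda>v. v \<setminus> d) ` ?L" using surj u V_eq by blast
    then obtain s where s: "s \<in> ?L" "ev u = s \<setminus> d" by blast
    then obtain v where v: "v \<in> V" "s = ev v" using V_eq by blast
    then have vl: "v \<in> lists \<Sigma>" using sub by blast
    then obtain x where x: "x \<in> lists \<Sigma>" "word_complement f v \<Omega> = Some x" "ev x = ev v \<setminus> ev \<Omega>"
      using complement[of v \<Omega>] ul by blast
    then have "(x, u) \<in> word_congruence \<Sigma> (complement_relations f)"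
      using word_congruence_iff_ev_eq s v \<Omega> ul by simp
    then show "\<exists>v\<in>V. \<exists>w. word_complement f v \<Omega> = Some w \<and>
        (w, u) \<in> word_congruence \<Sigma> (complement_relations f)"
      using v x by blast
  qed
  ultimately show ?thesis
    unfolding garside_conditions_def using T V \<Omega>(1) by blast
qed

end


section \<open>From Garside monoids to reversing\<close>

lemma (in monoid) atoms_closed: "atoms G \<subseteq> carrier G"
  by (auto simp: atoms_def)

text \<open>A bound for the lengths of the atomic factorizations of an element.\<close>

definition length_bound :: "('m, 'x) monoid_scheme \<Rightarrow> 'm \<Rightarrow> nat \<Rightarrow> bool" where
  "length_bound M x n \<longleftrightarrow> (\<forall>xs\<in>lists (atoms M). mprod M xs = x \<longrightarrow> length xs \<le> n)"

locale gaussian = monoid G for G (structure) +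
  assumes gaussian_monoid: "gaussian_monoid G"
begin

lemma atomic_factorization:
  assumes "x \<in> carrier G"
  obtains xs where "xs \<in> lists (atoms G)" "mprod G xs = x"
  using gaussian_monoid assms
  unfolding gaussian_monoid_def atomic_monoid_def generates_def by blast

lemma length_bound_exists: "x \<in> carrier G \<Longrightarrow> \<exists>n. length_bound G x n"
  using gaussian_monoid
  unfolding gaussian_monoid_def atomic_monoid_def length_bound_def by blast

lemma atoms_lists: "xs \<in> lists (atoms G) \<Longrightarrow> xs \<in> lists (carrier G)"
  using lists_mono[OF atoms_closed] by blast

lemma length_bound_mult:
  assumes "length_bound G (x \<otimes> y) n" "x \<in> carrier G" "y \<in> carrier G" "x \<noteq> \<one>"
  shows "\<exists>k. n = Suc k \<and> length_bound G y k"
proof -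
  obtain xs where xs: "xs \<in> lists (atoms G)" "mprod G xs = x" using atomic_factorization assms by blast
  obtain ys where ys: "ys \<in> lists (atoms G)" "mprod G ys = y" using atomic_factorization assms by blast
  have bound: "length xs + length zs \<le> n" if "zs \<in> lists (atoms G)" "mprod G zs = y" for zs
  proof -
    have "mprod G (xs @ zs) = x \<otimes> y" using mprod_append atoms_lists xs that by simp
    moreover have "xs @ zs \<in> lists (atoms G)" using xs(1) that(1) by simp
    ultimately show ?thesis using assms(1) unfolding length_bound_def by fastforce
  qed
  have "xs \<noteq> []" using xs assms(4) by auto
  then have "length xs \<ge> 1" by (cases xs) auto
  then have "n \<ge> 1" "length_bound G y (n - 1)"
    using bound[OF ys] bound unfolding length_bound_def by fastforce+
  then show ?thesis by (intro exI[of _ "n - 1"]) auto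
qed

lemma length_bound_mult_weak:
  assumes "length_bound G (x \<otimes> y) n" "x \<in> carrier G" "y \<in> carrier G"
  shows "length_bound G y n"
proof (cases "x = \<one>")
  case False
  then obtain k where "n = Suc k" "length_bound G y k" using length_bound_mult assms by blast
  then show ?thesis unfolding length_bound_def by fastforce
qed (use assms in simp)

text \<open>A non-trivial factor of \<open>\<one>\<close> would give factorizations of \<open>\<one>\<close> of arbitrary length.\<close>

lemma one_has_no_proper_factor:
  assumes "x \<otimes> y = \<one>" "x \<in> carrier G" "y \<in> carrier G"
  shows "x = \<one>"
proof (rule ccontr)
  assume x: "x \<noteq> \<one>"
  obtain xs where xs: "xs \<in> lists (atoms G)" "mprod G xs = x" using atomic_factorization assms by blast
  obtain ys where ys: "ys \<in> lists (atoms G)" "mprod G ys = y" using atomic_factorization assms by blast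
  have "xs \<noteq> []" using xs x by auto
  have "\<exists>zs\<in>lists (atoms G). mprod G zs = \<one> \<and> length zs \<ge> k" for k
  proof (induction k)
    case 0
    then show ?case by (intro bexI[of _ "[]"]) auto
  next
    case (Suc k)
    then obtain zs where zs: "zs \<in> lists (atoms G)" "mprod G zs = \<one>" "length zs \<ge> k" by blast
    have "mprod G (xs @ ys @ zs) = \<one>"
      using mprod_append atoms_lists xs ys zs assms by simp
    moreover have "xs @ ys @ zs \<in> lists (atoms G)" using xs(1) ys(1) zs(1) by simp
    moreover have "length (xs @ ys @ zs) \<ge> Suc k"
      using zs(3) \<open>xs \<noteq> []\<close> by (cases xs) auto
    ultimately show ?case by blast
  qed
  moreover obtain n where "length_bound G \<one> n" using length_bound_exists by blast
  ultimately show False unfolding length_bound_def by (meson not_less_eq_eq)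
qed

sublocale lcm_monoid G
proof unfold_locales
  show "y = z" if "x \<otimes> y = x \<otimes> z" "x \<in> carrier G" "y \<in> carrier G" "z \<in> carrier G" for x y z
    using gaussian_monoid monoid_cancel.l_cancel[of G x y z] that unfolding gaussian_monoid_def by blast
  show "x = \<one>" if "x \<otimes> y = \<one>" "x \<in> carrier G" "y \<in> carrier G" for x y
    using one_has_no_proper_factor that .
  show "\<exists>m. is_right_lcm G x y m" if "x \<in> carrier G" "y \<in> carrier G" for x y
    using gaussian_monoid that unfolding gaussian_monoid_def by blast
qed

end

text \<open>The letters are elements of the monoid and represent themselves.\<close>

locale gaussian_selector = gaussian +
  fixes \<Sigma> :: "'a set" and f :: "'a \<Rightarrow> 'a \<Rightarrow> 'a list option"
  assumes selector: "lcm_selector G (\<lambda>a. a) \<Sigma> f" and nontrivial: "\<one> \<notin> \<Sigma>"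
begin

lemma letters_in_carrier: "\<Sigma> \<subseteq> carrier G"
  using selector unfolding lcm_selector_def generates_def by simp

lemma lists_in_carrier: "u \<in> lists \<Sigma> \<Longrightarrow> u \<in> lists (carrier G)"
  using lists_mono[OF letters_in_carrier] by blast

lemma selector_defined:
  assumes "a \<in> \<Sigma>" "b \<in> \<Sigma>"
  shows "\<exists>w\<in>lists \<Sigma>. f a b = Some w \<and> mprod G w = a \<setminus> b"
proof -
  have "is_lcm_complement G a b (a \<setminus> b)"
    using is_lcm_complement_rc assms letters_in_carrier by blast
  then obtain w where w: "f a b = Some w" "mprod G w = a \<setminus> b"
    using selector assms unfolding lcm_selector_def by (metis list.map_ident)
  have "partial_word_map \<Sigma> f" using selector unfolding lcm_selector_def by blast
  then have "w \<in> lists \<Sigma>" using w(1) unfolding partial_word_map_def by blast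
  then show ?thesis using w by blast
qed

text \<open>A reversing square that represents an lcm square of \<open>G\<close>.\<close>

definition lcm_square where
  "lcm_square u v v' u' \<longleftrightarrow> u \<in> lists \<Sigma> \<and> v \<in> lists \<Sigma> \<and> v' \<in> lists \<Sigma> \<and> u' \<in> lists \<Sigma> \<and>
     reversing_square f u v v' u' \<and>
     mprod G v' = mprod G u \<setminus> mprod G v \<and> mprod G u' = mprod G v \<setminus> mprod G u"

lemma lcm_square_sym: "lcm_square u v v' u' \<Longrightarrow> lcm_square v u u' v'"
  unfolding lcm_square_def using reversing_square_sym by blast

lemma lcm_square_append_left:
  assumes "lcm_square u1 v v1 u1'" "lcm_square u2 v1 v2 u2'"
  shows "lcm_square (u1 @ u2) v v2 (u1' @ u2')"
  using assms reversing_square_append_left[of f u1 v v1 u1' u2 v2 u2'] mprod_closed[OF lists_in_carrier]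
    lists_in_carrier
  unfolding lcm_square_def by (simp add: mprod_append rc_mult_left rc_mult_right)

lemma lcm_square_append_right:
  assumes "lcm_square u v1 v1' u'" "lcm_square u' v2 v2' u''"
  shows "lcm_square u (v1 @ v2) (v1' @ v2') u''"
  using assms by (meson lcm_square_append_left lcm_square_sym)

lemma lcm_square_Nil_left: "v \<in> lists \<Sigma> \<Longrightarrow> lcm_square [] v v []"
  unfolding lcm_square_def using reversing_square_Nil_left mprod_closed[OF lists_in_carrier] by simp

lemma lcm_square_letters:
  assumes "a \<in> \<Sigma>" "b \<in> \<Sigma>"
  shows "\<exists>v u. lcm_square [a] [b] v u"
proof -
  obtain v where "v \<in> lists \<Sigma>" "f a b = Some v" "mprod G v = a \<setminus> b"
    using selector_defined assms by blast
  moreover obtain u where "u \<in> lists \<Sigma>" "f b a = Some u" "mprod G u = b \<setminus> a"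
    using selector_defined assms by blast
  ultimately have "lcm_square [a] [b] v u"
    using assms subsetD[OF letters_in_carrier] reversing_square_letters unfolding lcm_square_def
    by auto
  then show ?thesis by blast
qed

text \<open>Reversing terminates: all paths in the diagram represent divisors of a common right multiple
  of the two words, and the length bound for the remaining factor decreases.\<close>

lemma lcm_square_exists_bounded:
  assumes "length_bound G m n" "u \<in> lists \<Sigma>" "v \<in> lists \<Sigma>" "mprod G u \<preceq> m" "mprod G v \<preceq> m"
  shows "\<exists>v' u'. lcm_square u v v' u'"
  using assms
proof (induction n arbitrary: m u v)
  case 0
  have "u = []"
  proof (cases u)
    case (Cons a u')
    then have *: "a \<in> \<Sigma>" "a \<in> carrier G" "u' \<in> lists \<Sigma>" "mprod G u' \<in> carrier G"
      using 0(2) letters_in_carrier mprod_closed[OF lists_in_carrier] by auto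
    obtain z where "z \<in> carrier G" "m = a \<otimes> (mprod G u' \<otimes> z)"
      using 0(4) Cons * unfolding left_divides_def by (auto simp: m_assoc)
    then show ?thesis using length_bound_mult[of a "mprod G u' \<otimes> z" 0] 0(1) * nontrivial by auto
  qed simp
  then show ?case using lcm_square_Nil_left 0 by blast
next
  case (Suc n)
  show ?case
  proof (cases "u = [] \<or> v = []")
    case True
    then show ?thesis using lcm_square_Nil_left lcm_square_sym Suc.prems by blast
  next
    case False
    then obtain a b u1 v1 where uv: "u = a # u1" "v = b # v1" by (meson list.exhaust)
    have l: "a \<in> \<Sigma>" "b \<in> \<Sigma>" "u1 \<in> lists \<Sigma>" "v1 \<in> lists \<Sigma>" using Suc.prems uv by auto
    have c: "a \<in> carrier G" "b \<in> carrier G" "mprod G u1 \<in> carrier G" "mprod G v1 \<in> carrier G"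
      using l letters_in_carrier mprod_closed[OF lists_in_carrier] by auto
    have nt: "a \<noteq> \<one>" "b \<noteq> \<one>" using l nontrivial by auto
    obtain w w' where w: "lcm_square [a] [b] w w'" using lcm_square_letters l by blast
    have wl: "w \<in> lists \<Sigma>" "w' \<in> lists \<Sigma>" and we: "mprod G w = a \<setminus> b" "mprod G w' = b \<setminus> a"
      using w c unfolding lcm_square_def by auto
    have wc: "mprod G w \<in> carrier G" "mprod G w' \<in> carrier G"
      using wl mprod_closed[OF lists_in_carrier] by auto
    have u_dvd: "a \<otimes> mprod G u1 \<preceq> m" and v_dvd: "b \<otimes> mprod G v1 \<preceq> m" using Suc.prems uv by auto
    then have ab: "a \<preceq> m" "b \<preceq> m" using dvd_trans dvdI c by blast+
    then have "a \<otimes> (a \<setminus> b) \<preceq> m" using join_dvd_iff c by blast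
    then obtain m3 where m3: "m3 \<in> carrier G" "m = a \<otimes> (a \<setminus> b) \<otimes> m3"
      unfolding left_divides_def by blast
    define m1 m2 where "m1 = mprod G w \<otimes> m3" and "m2 = mprod G w' \<otimes> m3"
    have m: "m = a \<otimes> m1" "m = b \<otimes> m2"
      using m3 c wc we join_commute[of a b] unfolding m1_def m2_def by (simp_all flip: m_assoc)
    have mc: "m1 \<in> carrier G" "m2 \<in> carrier G" using m1_def m2_def m3 wc by auto
    have bound: "length_bound G m1 n" "length_bound G m2 n"
      using length_bound_mult[of a m1 "Suc n"] length_bound_mult[of b m2 "Suc n"]
        Suc.prems(1) m mc c nt by simp_all
    have bound3: "length_bound G m3 n"
      using length_bound_mult_weak bound(1) wc m3 unfolding m1_def by blast
    have dvd1: "mprod G u1 \<preceq> m1" "mprod G w \<preceq> m1"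
      and dvd2: "mprod G v1 \<preceq> m2" "mprod G w' \<preceq> m2"
      using u_dvd[unfolded m(1)] v_dvd[unfolded m(2)] mc c wc m3(1)
      by (simp_all add: dvd_mult_cancel) (simp_all add: m1_def m2_def dvdI)
    obtain p q where pq: "lcm_square u1 w p q" using Suc.IH[OF bound(1) l(3) wl(1) dvd1] by blast
    obtain x y where xy: "lcm_square v1 w' x y" using Suc.IH[OF bound(2) l(4) wl(2) dvd2] by blast
    have yq: "y \<in> lists \<Sigma>" "q \<in> lists \<Sigma>" "mprod G y = mprod G w' \<setminus> mprod G v1"
        "mprod G q = mprod G w \<setminus> mprod G u1"
      using pq xy unfolding lcm_square_def by auto
    have "mprod G y \<preceq> m3" "mprod G q \<preceq> m3"
      using yq dvd1 dvd2 c wc m3 rc_dvd_iff m1_def m2_def by simp_all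
    then obtain s t where st: "lcm_square y q s t" using Suc.IH[OF bound3 yq(1,2)] by blast
    have "lcm_square ([a] @ u1) [b] p (w' @ q)" by (rule lcm_square_append_left[OF w pq])
    then have "lcm_square [b] ([a] @ u1) (w' @ q) p" by (rule lcm_square_sym)
    moreover have "lcm_square v1 (w' @ q) (x @ s) t" by (rule lcm_square_append_right[OF xy st])
    ultimately have "lcm_square ([b] @ v1) ([a] @ u1) (x @ s) (p @ t)" by (rule lcm_square_append_left)
    then show ?thesis using lcm_square_sym uv by fastforce
  qed
qed

lemma lcm_square_exists:
  assumes "u \<in> lists \<Sigma>" "v \<in> lists \<Sigma>"
  shows "\<exists>v' u'. lcm_square u v v' u'"
proof -
  let ?m = "mprod G u \<otimes> (mprod G u \<setminus> mprod G v)"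
  have c: "mprod G u \<in> carrier G" "mprod G v \<in> carrier G"
    using mprod_closed[OF lists_in_carrier] assms by auto
  then have "mprod G u \<preceq> ?m" "mprod G v \<preceq> ?m"
    using join_dvd_iff[OF c, of ?m] dvd_refl by auto
  moreover obtain n where "length_bound G ?m n"
    using length_bound_exists[of ?m] c by (meson m_closed rc_closed)
  ultimately show ?thesis using lcm_square_exists_bounded assms by blast
qed

sublocale faithful_reversing_model G "\<lambda>a. a" \<Sigma> f
proof unfold_locales
  show "generates G ((\<lambda>a. a) ` \<Sigma>)" "partial_word_map \<Sigma> f"
    using selector unfolding lcm_selector_def by auto
  show "\<exists>w\<in>lists \<Sigma>. word_complement f u v = Some w \<and>
      mprod G (map (\<lambda>a. a) w) = mprod G (map (\<lambda>a. a) u) \<setminus> mprod G (map (\<lambda>a. a) v)"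
    if uv: "u \<in> lists \<Sigma>" "v \<in> lists \<Sigma>" for u v
  proof -
    obtain v' u' where "lcm_square u v v' u'" using lcm_square_exists[OF uv] by blast
    then show ?thesis
      unfolding lcm_square_def by (intro bexI[of _ v']) (auto simp: word_complement_eq_Some_iff)
  qed
  show "a \<noteq> \<one>" if "a \<in> \<Sigma>" for a using that nontrivial by blast
  show "x = y" if "x \<otimes> z = y \<otimes> z" "x \<in> carrier G" "y \<in> carrier G" "z \<in> carrier G" for x y z
    using gaussian_monoid monoid_cancel.r_cancel[of G x z y] that unfolding gaussian_monoid_def by blast
qed

lemma reversing_function:
  assumes "\<Sigma> \<noteq> {}"
  shows "reversing_function \<Sigma> f"
  unfolding reversing_function_def
proof (intro conjI ballI allI impI)
  show "\<Sigma> \<noteq> {}" by fact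
  show "partial_word_map \<Sigma> f" by (rule letters_map)
  show "f a a = Some []" if a: "a \<in> \<Sigma>" for a
  proof -
    obtain w where w: "w \<in> lists \<Sigma>" "f a a = Some w" "mprod G w = a \<setminus> a" using selector_defined a by blast
    have "a \<in> carrier G" using a letters_in_carrier by blast
    then have "w = []" using Nil_if_ev_eq_one w by simp
    then show ?thesis using w by simp
  qed
  show "f b a \<noteq> None" if "f a b \<noteq> None" for a b
  proof -
    have "a \<in> \<Sigma>" "b \<in> \<Sigma>" using that letters_map unfolding partial_word_map_def by blast+
    then show ?thesis using selector_defined by fastforce
  qed
qed

lemma length_word_bound:
  assumes "u \<in> lists \<Sigma>" "length_bound G (mprod G u) n"
  shows "length u \<le> n"
  using assms
proof (induction u arbitrary: n rule: list.induct)
  case (Cons a u)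
  then have *: "a \<in> \<Sigma>" "u \<in> lists \<Sigma>" by auto
  then have "a \<in> carrier G" "mprod G u \<in> carrier G" "a \<noteq> \<one>"
    using letters_in_carrier mprod_closed[OF lists_in_carrier] nontrivial by auto
  then obtain k where "n = Suc k" "length_bound G (mprod G u) k"
    using length_bound_mult[of a "mprod G u" n] Cons.prems by auto
  then show ?case using Cons.IH *(2) by simp
qed simp

lemma finite_words:
  assumes "finite \<Sigma>" "x \<in> carrier G"
  shows "finite {u \<in> lists \<Sigma>. mprod G u = x}"
proof -
  obtain n where "length_bound G x n" using length_bound_exists assms by blast
  then have "{u \<in> lists \<Sigma>. mprod G u = x} \<subseteq> {u. set u \<subseteq> \<Sigma> \<and> length u \<le> n}"
    using length_word_bound by (auto simp: lists_eq_set)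
  then show ?thesis using finite_lists_length_le[OF assms(1)] finite_subset by blast
qed

text \<open>All words in the closure of the letters under complement represent products of a fixed
  number of divisors of \<open>\<Delta>\<close>.\<close>

lemma finite_complement_closure:
  assumes "finite \<Sigma>" "garside_element G \<Delta>"
    "is_closure \<Sigma> (word_complement f) ((\<lambda>a. [a]) ` \<Sigma>) T"
  shows "finite T"
proof -
  let ?S = "{x. x \<preceq> \<Delta>}"
  have \<Delta>: "\<Delta> \<in> carrier G" "?S = {x. right_divides G x \<Delta>}" "finite ?S" "generates G ?S"
    using assms(2) unfolding garside_element_def by auto
  have S: "?S \<subseteq> carrier G" "\<one> \<in> ?S" using dvd_closed dvd_one \<Delta>(1) by blast+
  have rc_S: "s \<setminus> t \<in> ?S" if st: "s \<in> ?S" "t \<in> ?S" for s t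
  proof -
    have c: "s \<in> carrier G" "t \<in> carrier G" using st S by blast+
    then have "s \<otimes> (s \<setminus> t) \<preceq> \<Delta>" using st join_dvd_iff by simp
    then have "right_divides G (s \<otimes> (s \<setminus> t)) \<Delta>" using \<Delta>(2) by blast
    then obtain z where "z \<in> carrier G" "z \<otimes> (s \<otimes> (s \<setminus> t)) = \<Delta>"
      unfolding right_divides_def by blast
    then have "z \<otimes> s \<otimes> (s \<setminus> t) = \<Delta>" using c by (simp add: m_assoc)
    then have "right_divides G (s \<setminus> t) \<Delta>"
      using \<open>z \<in> carrier G\<close> c \<Delta>(1) unfolding right_divides_def by auto
    then show ?thesis using \<Delta>(2) by blast
  qed
  have "\<exists>k. \<Sigma>' \<subseteq> products ?S k" if "finite \<Sigma>'" "\<Sigma>' \<subseteq> \<Sigma>" for \<Sigma>'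
    using that
  proof (induction \<Sigma>' rule: finite_induct)
    case (insert a A)
    then obtain j where "A \<subseteq> products ?S j" by blast
    moreover obtain i where "a \<in> products ?S i"
      using in_products_if_generates[OF \<Delta>(4)] insert.prems letters_in_carrier by blast
    moreover have "products ?S i \<subseteq> products ?S (i + j)" "products ?S j \<subseteq> products ?S (i + j)"
      using products_mono[OF S] by simp_all
    ultimately show ?case by (intro exI[of _ "i + j"]) blast
  qed simp
  then obtain k where k: "\<Sigma> \<subseteq> products ?S k" using assms(1) by blast
  let ?D = "{u \<in> lists \<Sigma>. mprod G u \<in> products ?S k}"
  have "closed_under (word_complement f) ?D"
    unfolding closed_under_def
  proof (intro ballI)
    fix u v assume uv: "u \<in> ?D" "v \<in> ?D"
    then obtain w where w: "w \<in> lists \<Sigma>" "word_complement f u v = Some w"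
        "mprod G w = mprod G u \<setminus> mprod G v"
      using complement[of u v] by auto
    have "mprod G u \<in> carrier G" using uv mprod_closed[OF lists_in_carrier] by blast
    then have "w \<in> ?D" using rc_products[OF \<Delta>(4) rc_S] w uv by simp
    then show "\<exists>w\<in>?D. word_complement f u v = Some w" using w by blast
  qed
  moreover have "(\<lambda>a. [a]) ` \<Sigma> \<subseteq> ?D" using k subsetD[OF letters_in_carrier] by auto
  moreover have "?D \<subseteq> lists \<Sigma>" by blast
  ultimately have "T \<subseteq> ?D" using assms(3) unfolding is_closure_def by meson
  moreover have "finite ?D"
  proof -
    have "finite (\<Union>x\<in>products ?S k. {u \<in> lists \<Sigma>. mprod G u = x})"
    proof (rule finite_UN_I)
      show "finite (products ?S k)" using finite_products \<Delta>(3) .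
      show "finite {u \<in> lists \<Sigma>. mprod G u = x}" if "x \<in> products ?S k" for x
        using finite_words[OF assms(1)] products_closed[OF S(1)] that by blast
    qed
    then show ?thesis by (rule rev_finite_subset) blast
  qed
  ultimately show ?thesis by (rule finite_subset)
qed

lemma garside_conditions:
  assumes "finite \<Sigma>" "\<Sigma> \<noteq> {}" "garside_element G \<Delta>"
  shows "garside_conditions \<Sigma> f"
proof -
  have "(\<lambda>a. [a]) ` \<Sigma> \<subseteq> lists \<Sigma>" by auto
  then obtain T where T: "is_closure \<Sigma> (word_complement f) ((\<lambda>a. [a]) ` \<Sigma>) T"
    using is_closure_exists closed_under_word_complement by blast
  then show ?thesis
    using garside_conditions_if_finite finite_complement_closure assms by blast
qed

end


section \<open>The cube property\<close>

text \<open>The word \<open>u \ v\<close> computed by reversing; unspecified if reversing does not succeed.\<close>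

definition word_cpl :: "('a \<Rightarrow> 'a \<Rightarrow> 'a list option) \<Rightarrow> 'a list \<Rightarrow> 'a list \<Rightarrow> 'a list" where
  "word_cpl f u v = the (word_complement f u v)"

lemma word_cpl_eqI: "reversing_square f u v v' u' \<Longrightarrow> word_cpl f u v = v'"
  using word_complement_eq_Some_iff[of f u v v'] unfolding word_cpl_def by fastforce

lemma word_cpl_Nil_left [simp]: "word_cpl f [] v = v"
  by (rule word_cpl_eqI[OF reversing_square_Nil_left])

lemma word_cpl_Nil_right [simp]: "word_cpl f u [] = []"
  by (rule word_cpl_eqI[OF reversing_square_Nil_right])

text \<open>The relation \<open>\<equiv>\<^sup>+\<^sup>+\<close> on words: \<open>u\<inverse> v\<close> reverses to the empty word.\<close>

abbreviation word_equiv ::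
  "('a \<Rightarrow> 'a \<Rightarrow> 'a list option) \<Rightarrow> 'a list \<Rightarrow> 'a list \<Rightarrow> bool" where
  "word_equiv f u v \<equiv> reversing_square f u v [] []"

lemma word_equiv_sym: "word_equiv f u v \<Longrightarrow> word_equiv f v u"
  by (rule reversing_square_sym)

lemma word_equiv_append:
  assumes "word_equiv f u u'" "word_equiv f v v'"
  shows "word_equiv f (u @ v) (u' @ v')"
proof -
  have "reversing_square f u (u' @ v') ([] @ v') []"
    using assms(1) reversing_square_Nil_left by (rule reversing_square_append_right)
  then have "reversing_square f u (u' @ v') v' []" by simp
  from reversing_square_append_left[OF this assms(2)] show ?thesis by simp
qed

lemma word_equiv_refl:
  assumes "\<And>a. a \<in> \<Sigma> \<Longrightarrow> f a a = Some []" "u \<in> lists \<Sigma>"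
  shows "word_equiv f u u"
  using assms(2)
proof (induction u rule: list.induct)
  case (Cons a u)
  then have "f a a = Some []" using assms(1) by simp
  from reversing_square_letters[of f, OF this this] have "word_equiv f [a] [a]" .
  moreover have "word_equiv f u u" using Cons by simp
  ultimately show ?case using word_equiv_append[of f "[a]" "[a]" u u] by simp
qed (rule reversing_square_Nil_left)

lemma concat_word_equiv:
  assumes "list_all2 (word_equiv f) U V"
  shows "word_equiv f (concat U) (concat V)"
  using assms
  by (induction rule: list_all2_induct) (auto intro: word_equiv_append reversing_square_Nil_left)

text \<open>A set of words closed under complements on which the cube property holds. There
  \<open>word_equiv\<close> is compatible with the complement, and transitive. This is used both for the closure of
  the letters and for the set of all words.\<close>

locale cube_set =
  fixes f :: "'a \<Rightarrow> 'a \<Rightarrow> 'a list option" and X :: "'a list set"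
  assumes square: "u \<in> X \<Longrightarrow> v \<in> X \<Longrightarrow>
      reversing_square f u v (word_cpl f u v) (word_cpl f v u)"
    and closed: "u \<in> X \<Longrightarrow> v \<in> X \<Longrightarrow> word_cpl f u v \<in> X"
    and cube: "u \<in> X \<Longrightarrow> v \<in> X \<Longrightarrow> w \<in> X \<Longrightarrow>
      word_equiv f (word_cpl f (word_cpl f u v) (word_cpl f u w))
        (word_cpl f (word_cpl f v u) (word_cpl f v w))"
begin

lemma word_equiv_iff:
  assumes "u \<in> X" "v \<in> X"
  shows "word_equiv f u v \<longleftrightarrow> word_cpl f u v = [] \<and> word_cpl f v u = []"
  using square[OF assms] reversing_square_unique[of f u v] by metis

lemma word_equiv_cpl_left:
  assumes "word_equiv f u v" "u \<in> X" "v \<in> X" "w \<in> X"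
  shows "word_equiv f (word_cpl f u w) (word_cpl f v w)"
  using cube[OF assms(2-4)] word_equiv_iff[OF assms(2,3)] assms(1) by simp

lemma word_equiv_cpl_right:
  assumes "word_equiv f u v" "u \<in> X" "v \<in> X" "w \<in> X"
  shows "word_equiv f (word_cpl f w u) (word_cpl f w v)"
proof -
  have *: "word_cpl f (word_cpl f w x) (word_cpl f w y) = []"
    if "word_cpl f x y = []" "x \<in> X" "y \<in> X" for x y
  proof -
    have "word_equiv f (word_cpl f (word_cpl f w x) (word_cpl f w y)) []"
      using cube[OF assms(4) that(2,3)] that(1) by simp
    then show ?thesis using reversing_square_unique[OF reversing_square_Nil_right] by blast
  qed
  have "word_cpl f u v = []" "word_cpl f v u = []" using assms word_equiv_iff by blast+
  then show ?thesis
    using * assms closed word_equiv_iff by simp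
qed

lemma word_equiv_trans:
  assumes "word_equiv f u v" "word_equiv f v w" "u \<in> X" "v \<in> X" "w \<in> X"
  shows "word_equiv f u w"
proof -
  have *: "word_cpl f x z = []"
    if "word_equiv f x y" "word_equiv f y z" "x \<in> X" "y \<in> X" "z \<in> X" for x y z
  proof -
    have "word_cpl f y z = []" using that word_equiv_iff by blast
    then have "word_equiv f (word_cpl f x z) []"
      using word_equiv_cpl_left[OF that(1,3,4,5)] by simp
    then show ?thesis using reversing_square_unique[OF reversing_square_Nil_right] by blast
  qed
  show ?thesis
    using *[OF assms] *[of w v u] assms word_equiv_sym word_equiv_iff by blast
qed

end


text \<open>Complements of lists in terms of a complement \<open>c\<close> of their entries, read off a rectangular
  grid: \<open>grid_row c u V\<close> and \<open>grid_rest c u V\<close> are the complements of the one-entry list \<open>u\<close> and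
  \<open>V\<close> in each other, and \<open>grid c U V\<close> is the complement of \<open>U\<close> in \<open>V\<close>. It has the length of \<open>V\<close>.\<close>

fun grid_row :: "('x \<Rightarrow> 'x \<Rightarrow> 'x) \<Rightarrow> 'x \<Rightarrow> 'x list \<Rightarrow> 'x list" where
  "grid_row c u [] = []"
| "grid_row c u (v # V) = c u v # grid_row c (c v u) V"

fun grid_rest :: "('x \<Rightarrow> 'x \<Rightarrow> 'x) \<Rightarrow> 'x \<Rightarrow> 'x list \<Rightarrow> 'x" where
  "grid_rest c u [] = u"
| "grid_rest c u (v # V) = grid_rest c (c v u) V"

fun grid :: "('x \<Rightarrow> 'x \<Rightarrow> 'x) \<Rightarrow> 'x list \<Rightarrow> 'x list \<Rightarrow> 'x list" where
  "grid c [] V = V"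
| "grid c (u # U) V = grid c U (grid_row c u V)"

lemma length_grid_row [simp]: "length (grid_row c u V) = length V"
  by (induction V arbitrary: u) auto

lemma length_grid [simp]: "length (grid c U V) = length V"
  by (induction U arbitrary: V) auto

lemma grid_Nil_right [simp]: "grid c U [] = []"
  by (induction U) auto

lemma grid_append_left: "grid c (U @ U') V = grid c U' (grid c U V)"
  by (induction U arbitrary: V) auto

text \<open>The definition of \<open>grid\<close> decomposes its first argument; the rule for the second one is the
  same by the symmetry of the grid.\<close>

lemma grid_Cons_right: "grid c V (u # U) = grid_rest c u V # grid c (grid_row c u V) U"
  by (induction V arbitrary: u U) auto

lemma grid_append_right: "grid c V (U @ U') = grid c V U @ grid c (grid c U V) U'"
  by (induction U arbitrary: V) (auto simp: grid_Cons_right)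

context
  fixes c :: "'x \<Rightarrow> 'x \<Rightarrow> 'x" and X :: "'x set"
  assumes closed: "\<And>u v. u \<in> X \<Longrightarrow> v \<in> X \<Longrightarrow> c u v \<in> X"
begin

lemma grid_row_lists: "u \<in> X \<Longrightarrow> V \<in> lists X \<Longrightarrow> grid_row c u V \<in> lists X"
  using closed by (induction V arbitrary: u rule: list.induct) auto

lemma grid_lists: "U \<in> lists X \<Longrightarrow> V \<in> lists X \<Longrightarrow> grid c U V \<in> lists X"
proof (induction U arbitrary: V rule: list.induct)
  case (Cons u U)
  have "grid_row c u V \<in> lists X" using Cons.prems by (intro grid_row_lists) auto
  then show ?case using Cons by simp
qed simp

text \<open>The cube identity extends from entries to lists, by splitting \<open>W\<close> or \<open>V\<close>; the case of \<open>U\<close> is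
  symmetric to that of \<open>V\<close>. Since the length of \<open>grid c U V\<close> is that of \<open>V\<close>, the total length decreases. The
  cube identity must be an equality here: for words it only holds up to equivalence, whose
  transitivity is not available before the cube property is.\<close>

lemma grid_cube:
  assumes cube: "\<And>u v w. u \<in> X \<Longrightarrow> v \<in> X \<Longrightarrow> w \<in> X \<Longrightarrow> c (c u v) (c u w) = c (c v u) (c v w)"
    and "U \<in> lists X" "V \<in> lists X" "W \<in> lists X"
  shows "grid c (grid c U V) (grid c U W) = grid c (grid c V U) (grid c V W)"
  using assms(2-4)
proof (induction "length U + length V + length W" arbitrary: U V W rule: less_induct)
  case less
  note IH = less.hyps
  have split_V: "grid c (grid c U V) (grid c U W) = grid c (grid c V U) (grid c V W)"
    if len: "length V \<ge> 2" and "U \<in> lists X" "V \<in> lists X" "W \<in> lists X"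
      and less': "\<And>U' V' W'. length U' + length V' + length W' < length U + length V + length W \<Longrightarrow>
        U' \<in> lists X \<Longrightarrow> V' \<in> lists X \<Longrightarrow> W' \<in> lists X \<Longrightarrow>
        grid c (grid c U' V') (grid c U' W') = grid c (grid c V' U') (grid c V' W')"
    for U V W
  proof -
    obtain v V' where V: "V = [v] @ V'" "V' \<noteq> []"
      using len by (cases V rule: list.exhaust; cases "tl V") auto
    have l: "[v] \<in> lists X" "V' \<in> lists X" using \<open>V \<in> lists X\<close> V by auto
    have "grid c (grid c U V) (grid c U W) =
        grid c (grid c (grid c [v] U) V') (grid c (grid c U [v]) (grid c U W))"
      unfolding V(1) grid_append_right grid_append_left ..
    also have "grid c (grid c U [v]) (grid c U W) = grid c (grid c [v] U) (grid c [v] W)"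
      using V by (intro less' l that) simp
    also have "grid c (grid c (grid c [v] U) V') (grid c (grid c [v] U) (grid c [v] W)) =
        grid c (grid c V' (grid c [v] U)) (grid c V' (grid c [v] W))"
      using V by (intro less' l that grid_lists) simp
    also have "\<dots> = grid c (grid c V U) (grid c V W)"
      unfolding V(1) grid_append_left ..
    finally show ?thesis .
  qed
  consider "length W \<ge> 2" | "length V \<ge> 2" | "length U \<ge> 2"
    | "length U \<le> 1" "length V \<le> 1" "length W \<le> 1" by linarith
  then show ?case
  proof cases
    case 1
    obtain w W' where W: "W = [w] @ W'" "W' \<noteq> []"
      using 1 by (cases W rule: list.exhaust; cases "tl W") auto
    have l: "[w] \<in> lists X" "W' \<in> lists X" using less.prems W by auto
    have expand: "grid c (grid c A B) (grid c A W) = grid c (grid c A B) (grid c A [w]) @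
        grid c (grid c (grid c [w] A) (grid c [w] B)) (grid c (grid c [w] A) W')"
      if AB: "A \<in> lists X" "B \<in> lists X" "length A + length B = length U + length V" for A B
    proof -
      have "grid c (grid c A [w]) (grid c A B) = grid c (grid c [w] A) (grid c [w] B)"
        using W AB by (intro IH l) simp_all
      then show ?thesis unfolding W(1) grid_append_right by (simp only:)
    qed
    have "grid c (grid c U V) (grid c U [w]) = grid c (grid c V U) (grid c V [w])"
      using W less.prems by (intro IH l) simp_all
    moreover have "grid c (grid c (grid c [w] U) (grid c [w] V)) (grid c (grid c [w] U) W') =
        grid c (grid c (grid c [w] V) (grid c [w] U)) (grid c (grid c [w] V) W')"
      using W less.prems by (intro IH l grid_lists) simp_all
    ultimately show ?thesis
      using expand[of U V] expand[of V U] less.prems by (simp only: add.commute)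
  next
    case 2
    show ?thesis
      using less.prems by (intro split_V[OF 2] IH) auto
  next
    case 3
    have "grid c (grid c V U) (grid c V W) = grid c (grid c U V) (grid c U W)"
      using less.prems by (intro split_V[OF 3] IH) auto
    then show ?thesis ..
  next
    case 4
    show ?thesis
    proof (cases "U = [] \<or> V = [] \<or> W = []")
      case True
      then show ?thesis by auto
    next
      case False
      then obtain u v w where "U = [u]" "V = [v]" "W = [w]"
        using 4 by (metis One_nat_def le_Suc_eq le_zero_eq length_0_conv length_Suc_conv)
      then show ?thesis using cube less.prems by simp
    qed
  qed
qed

lemma map_grid_row:
  assumes "\<And>u v. u \<in> X \<Longrightarrow> v \<in> X \<Longrightarrow> r (c u v) = c' (r u) (r v)" "u \<in> X" "V \<in> lists X"
  shows "map r (grid_row c u V) = grid_row c' (r u) (map r V)"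
  using assms(3,2) by (induction V arbitrary: u rule: list.induct) (auto simp: assms(1) closed)

lemma map_grid:
  assumes "\<And>u v. u \<in> X \<Longrightarrow> v \<in> X \<Longrightarrow> r (c u v) = c' (r u) (r v)" "U \<in> lists X" "V \<in> lists X"
  shows "map r (grid c U V) = grid c' (map r U) (map r V)"
  using assms(2,3)
proof (induction U arbitrary: V rule: list.induct)
  case (Cons u U)
  have "grid_row c u V \<in> lists X" using Cons.prems by (intro grid_row_lists) auto
  moreover have "map r (grid_row c u V) = grid_row c' (r u) (map r V)"
    using map_grid_row[of r c' u V] assms(1) Cons.prems by simp
  ultimately show ?case using Cons by simp
qed simp

end


section \<open>From reversing to Garside monoids\<close>

text \<open>The closure \<open>T\<close> of the letters enters only through the closedness of \<open>T\<close> and its cube property.\<close>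

locale reversing_cube =
  fixes \<Sigma> :: "'a set" and f :: "'a \<Rightarrow> 'a \<Rightarrow> 'a list option" and T :: "'a list set"
  assumes reversing: "reversing_function \<Sigma> f"
    and letters_in_T: "(\<lambda>a. [a]) ` \<Sigma> \<subseteq> T" and T_lists: "T \<subseteq> lists \<Sigma>"
    and closed_T: "closed_under (word_complement f) T"
    and cube_T: "cube_property f (Some ` T)"
begin

lemma map_f: "partial_word_map \<Sigma> f"
  using reversing unfolding reversing_function_def by blast

lemma word_complement_T:
  assumes "u \<in> T" "v \<in> T"
  shows "word_complement f u v = Some (word_cpl f u v)" "word_cpl f u v \<in> T"
proof -
  obtain w where "w \<in> T" "word_complement f u v = Some w"
    using closed_T assms unfolding closed_under_def by blast
  then show "word_complement f u v = Some (word_cpl f u v)" "word_cpl f u v \<in> T"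
    by (simp_all add: word_cpl_def)
qed

sublocale T: cube_set f T
proof
  fix u v assume uv: "u \<in> T" "v \<in> T"
  show "word_cpl f u v \<in> T" using word_complement_T uv by blast
  obtain u' where "reversing_square f u v (word_cpl f u v) u'"
    using iffD1[OF word_complement_eq_Some_iff word_complement_T(1)[OF uv]] by (elim exE)
  moreover have "word_cpl f v u = u'"
    using reversing_square_sym[OF calculation] by (rule word_cpl_eqI)
  ultimately show "reversing_square f u v (word_cpl f u v) (word_cpl f v u)" by simp
next
  fix u v w assume uvw: "u \<in> T" "v \<in> T" "w \<in> T"
  have "reversing_equiv f
      (word_complement_opt f (word_complement_opt f (Some u) (Some v))
        (word_complement_opt f (Some u) (Some w)))
      (word_complement_opt f (word_complement_opt f (Some v) (Some u))
        (word_complement_opt f (Some v) (Some w)))"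
    using cube_T uvw unfolding cube_property_def by blast
  then show "word_equiv f (word_cpl f (word_cpl f u v) (word_cpl f u w))
      (word_cpl f (word_cpl f v u) (word_cpl f v w))"
    using uvw by (simp add: word_complement_opt_def word_complement_T reversing_square_def)
qed

abbreviation gr where "gr \<equiv> grid (word_cpl f)"

lemma gr_lists: "U \<in> lists T \<Longrightarrow> V \<in> lists T \<Longrightarrow> gr U V \<in> lists T"
  by (rule grid_lists[OF T.closed])

lemma grid_row_square:
  assumes "u \<in> T" "V \<in> lists T"
  shows "reversing_square f u (concat V) (concat (grid_row (word_cpl f) u V))
    (grid_rest (word_cpl f) u V)"
  using assms(2,1)
proof (induction V arbitrary: u rule: list.induct)
  case (Cons v V)
  then have "v \<in> T" "V \<in> lists T" by auto
  then show ?case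
    using Cons.IH[of "word_cpl f v u"] Cons.prems(2) T.closed
      reversing_square_append_right[OF T.square[of u v]] by simp
qed (simp add: reversing_square_Nil_right)

lemma grid_square:
  assumes "U \<in> lists T" "V \<in> lists T"
  shows "reversing_square f (concat U) (concat V) (concat (gr U V)) (concat (gr V U))"
  using assms
proof (induction U arbitrary: V rule: list.induct)
  case (Cons u U)
  then have u: "u \<in> T" "U \<in> lists T" by auto
  let ?V = "grid_row (word_cpl f) u V"
  have "?V \<in> lists T" using T.closed u(1) Cons.prems(2) by (rule grid_row_lists)
  then have "reversing_square f (concat U) (concat ?V) (concat (gr U ?V)) (concat (gr ?V U))"
    using Cons.IH u by blast
  from reversing_square_append_left[OF grid_row_square[OF u(1) Cons.prems(2)] this]
  show ?case by (simp add: grid_Cons_right)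
qed (simp add: reversing_square_Nil_left)

text \<open>The entries of the two sides of the cube identity for lists are equivalent one by one.
  Choosing representatives for \<open>word_equiv\<close> in \<open>T\<close> turns the identity into an equality.\<close>

lemma cube_gr:
  assumes "U \<in> lists T" "V \<in> lists T" "W \<in> lists T"
  shows "list_all2 (word_equiv f) (gr (gr U V) (gr U W)) (gr (gr V U) (gr V W))"
proof -
  define r where "r u = (SOME v. v \<in> T \<and> word_equiv f u v)" for u
  define c where "c u v = r (word_cpl f u v)" for u v
  have refl: "word_equiv f u u" if "u \<in> T" for u
    using word_equiv_refl[of \<Sigma> f u] reversing that T_lists unfolding reversing_function_def by blast
  have r: "r u \<in> T \<and> word_equiv f u (r u)" if "u \<in> T" for u
    unfolding r_def by (rule someI[of _ u]) (use refl that in blast)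
  have r_eq_iff: "r u = r v \<longleftrightarrow> word_equiv f u v" if uv: "u \<in> T" "v \<in> T" for u v
  proof
    assume "r u = r v"
    then show "word_equiv f u v"
      using T.word_equiv_trans[of u "r u" v] r[OF uv(1)] r[OF uv(2)] word_equiv_sym[of f v "r v"]
      uv by simp
  next
    assume uv_equiv: "word_equiv f u v"
    have "word_equiv f u w \<longleftrightarrow> word_equiv f v w" if "w \<in> T" for w
      using T.word_equiv_trans[of u v w] T.word_equiv_trans[of v u w] word_equiv_sym[OF uv_equiv]
        uv_equiv uv that by blast
    then show "r u = r v" unfolding r_def by metis
  qed
  have r_cpl: "r (word_cpl f u v) = c (r u) (r v)" if uv: "u \<in> T" "v \<in> T" for u v
  proof -
    have "word_equiv f (word_cpl f u v) (word_cpl f (r u) v)"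
      using r uv by (intro T.word_equiv_cpl_left) auto
    moreover have "word_equiv f (word_cpl f (r u) v) (word_cpl f (r u) (r v))"
      using r uv by (intro T.word_equiv_cpl_right) auto
    ultimately have "word_equiv f (word_cpl f u v) (word_cpl f (r u) (r v))"
      by (rule T.word_equiv_trans) (use r uv T.closed in auto)
    then show ?thesis using r_eq_iff r uv T.closed unfolding c_def by simp
  qed
  have c_closed: "c x y \<in> r ` T" if xy: "x \<in> r ` T" "y \<in> r ` T" for x y
  proof -
    obtain u v where "u \<in> T" "v \<in> T" "x = r u" "y = r v" using xy by blast
    then show ?thesis using r_cpl[of u v] T.closed[of u v] by (metis image_eqI)
  qed
  have c_cube: "c (c x y) (c x z) = c (c y x) (c y z)"
    if xyz: "x \<in> r ` T" "y \<in> r ` T" "z \<in> r ` T" for x y z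
  proof -
    obtain u v w where *: "u \<in> T" "v \<in> T" "w \<in> T" "x = r u" "y = r v" "z = r w" using xyz by blast
    have "c (c x y) (c x z) = r (word_cpl f (word_cpl f u v) (word_cpl f u w))"
      "c (c y x) (c y z) = r (word_cpl f (word_cpl f v u) (word_cpl f v w))"
      using * T.closed r_cpl by simp_all
    then show ?thesis using r_eq_iff T.cube * T.closed by simp
  qed
  have map_gr: "map r (gr A B) = grid c (map r A) (map r B)" if "A \<in> lists T" "B \<in> lists T" for A B
    using that by (intro map_grid[OF T.closed] r_cpl)
  have "map r (gr (gr U V) (gr U W)) = grid c (grid c (map r U) (map r V)) (grid c (map r U) (map r W))"
    using assms gr_lists map_gr by simp
  also have "\<dots> = grid c (grid c (map r V) (map r U)) (grid c (map r V) (map r W))"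
    using assms by (intro grid_cube[where X="r ` T" and c=c] c_closed c_cube) auto
  also have "\<dots> = map r (gr (gr V U) (gr V W))"
    using assms gr_lists map_gr by simp
  finally have eq: "map r (gr (gr U V) (gr U W)) = map r (gr (gr V U) (gr V W))" .
  show ?thesis
  proof (rule list_all2_all_nthI)
    show len: "length (gr (gr U V) (gr U W)) = length (gr (gr V U) (gr V W))" by simp
    fix i assume i: "i < length (gr (gr U V) (gr U W))"
    have "gr (gr U V) (gr U W) \<in> lists T" "gr (gr V U) (gr V W) \<in> lists T"
      by (intro gr_lists assms)+
    then have "gr (gr U V) (gr U W) ! i \<in> T" "gr (gr V U) (gr V W) ! i \<in> T"
      using i len nth_mem[of i] by (simp_all only: in_lists_conv_set) auto
    moreover have "r (gr (gr U V) (gr U W) ! i) = r (gr (gr V U) (gr V W) ! i)"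
      using arg_cong[OF eq, of "\<lambda>xs. xs ! i"] i len by simp
    ultimately show "word_equiv f (gr (gr U V) (gr U W) ! i) (gr (gr V U) (gr V W) ! i)"
      using r_eq_iff by blast
  qed
qed

lemma word_as_concat:
  assumes "u \<in> lists \<Sigma>"
  obtains U where "U \<in> lists T" "u = concat U"
proof
  show "u = concat (map (\<lambda>a. [a]) u)" by simp
  show "map (\<lambda>a. [a]) u \<in> lists T" using assms letters_in_T by (auto simp: lists_eq_set)
qed

lemma word_cpl_concat:
  assumes "U \<in> lists T" "V \<in> lists T"
  shows "word_cpl f (concat U) (concat V) = concat (gr U V)"
  using grid_square[OF assms] by (rule word_cpl_eqI)

sublocale cube_set f "lists \<Sigma>"
proof
  fix u v assume uv: "u \<in> lists \<Sigma>" "v \<in> lists \<Sigma>"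
  obtain U where U: "U \<in> lists T" "u = concat U" using word_as_concat[OF uv(1)] .
  obtain V where V: "V \<in> lists T" "v = concat V" using word_as_concat[OF uv(2)] .
  show *: "reversing_square f u v (word_cpl f u v) (word_cpl f v u)"
    using grid_square[OF U(1) V(1)] word_cpl_concat U V by simp
  show "word_cpl f u v \<in> lists \<Sigma>" using reversing_square_lists(1)[OF map_f * uv] .
next
  fix u v w assume uvw: "u \<in> lists \<Sigma>" "v \<in> lists \<Sigma>" "w \<in> lists \<Sigma>"
  obtain U where U: "U \<in> lists T" "u = concat U" using word_as_concat[OF uvw(1)] .
  obtain V where V: "V \<in> lists T" "v = concat V" using word_as_concat[OF uvw(2)] .
  obtain W where W: "W \<in> lists T" "w = concat W" using word_as_concat[OF uvw(3)] .
  show "word_equiv f (word_cpl f (word_cpl f u v) (word_cpl f u w))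
      (word_cpl f (word_cpl f v u) (word_cpl f v w))"
    using concat_word_equiv[OF cube_gr[OF U(1) V(1) W(1)]] U V W gr_lists
    by (simp add: word_cpl_concat)
qed

lemma word_equiv_refl': "u \<in> lists \<Sigma> \<Longrightarrow> word_equiv f u u"
  using word_equiv_refl[of \<Sigma> f u] reversing unfolding reversing_function_def by blast

lemma word_cpl_self: "u \<in> lists \<Sigma> \<Longrightarrow> word_cpl f u u = []"
  using word_equiv_refl' by (rule word_cpl_eqI)

lemma word_equiv_Nil: "word_equiv f u [] \<Longrightarrow> u = []"
  using reversing_square_unique[OF reversing_square_Nil_right] by blast

lemma word_cpl_append_left:
  assumes "u \<in> lists \<Sigma>" "v \<in> lists \<Sigma>" "w \<in> lists \<Sigma>"
  shows "word_cpl f (u @ v) w = word_cpl f v (word_cpl f u w)"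
  using square[OF assms(1,3)] square[OF assms(2) closed[OF assms(1,3)]]
  by (rule word_cpl_eqI[OF reversing_square_append_left])

lemma word_cpl_append_right:
  assumes "u \<in> lists \<Sigma>" "v \<in> lists \<Sigma>" "w \<in> lists \<Sigma>"
  shows "word_cpl f w (u @ v) = word_cpl f w u @ word_cpl f (word_cpl f u w) v"
  using square[OF assms(3,1)] square[OF closed[OF assms(1,3)] assms(2)]
  by (rule word_cpl_eqI[OF reversing_square_append_right])

abbreviation "R \<equiv> complement_relations f"

text \<open>The congruence of the presentation consists of the pairs \<open>(u, v)\<close> for which \<open>u\<inverse> v\<close> reverses to the
  empty word.\<close>

lemma word_congruence_iff_word_equiv:
  assumes "u \<in> lists \<Sigma>" "v \<in> lists \<Sigma>"
  shows "(u, v) \<in> word_congruence \<Sigma> R \<longleftrightarrow> word_equiv f u v"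
proof
  assume "word_equiv f u v"
  from reversing_square_sound[OF map_f this assms] show "(u, v) \<in> word_congruence \<Sigma> R" by simp
next
  assume "(u, v) \<in> word_congruence \<Sigma> R"
  then show "word_equiv f u v"
  proof induction
    case (rel u v)
    then obtain a b p q where *: "u = [a] @ p" "v = [b] @ q" "f a b = Some p" "f b a = Some q"
      unfolding complement_relations_def by auto
    then have pq: "p \<in> lists \<Sigma>" "q \<in> lists \<Sigma>" using rel by auto
    have "reversing_square f [a] ([b] @ q) (p @ []) []"
      using reversing_square_letters[of f, OF *(3,4)] word_equiv_refl'[OF pq(2)]
      by (rule reversing_square_append_right)
    then have "reversing_square f [a] ([b] @ q) p []" by simp
    from reversing_square_append_left[OF this word_equiv_refl'[OF pq(1)]]
    show ?case using * by simp
  next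
    case (refl u)
    then show ?case by (rule word_equiv_refl')
  next
    case (sym u v)
    then show ?case using word_equiv_sym by blast
  next
    case (trans u v w)
    then show ?case
      using word_equiv_trans[of u v w] word_congruence_lists[OF trans.hyps(1)]
        word_congruence_lists[OF trans.hyps(2)] by blast
  next
    case (append u v u' v')
    then show ?case using word_equiv_append by blast
  qed
qed

abbreviation "P \<equiv> presented_monoid \<Sigma> R"
abbreviation "cl \<equiv> word_class \<Sigma> R"

lemma cl_eq_iff: "u \<in> lists \<Sigma> \<Longrightarrow> v \<in> lists \<Sigma> \<Longrightarrow> cl u = cl v \<longleftrightarrow> word_equiv f u v"
  using word_class_eq_iff[of u \<Sigma> v R] word_congruence_iff_word_equiv[of u v] by simp

lemma cl_lcm:
  assumes "u \<in> lists \<Sigma>" "v \<in> lists \<Sigma>"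
  shows "cl (u @ word_cpl f u v) = cl (v @ word_cpl f v u)"
proof -
  have "(u @ word_cpl f u v, v @ word_cpl f v u) \<in> word_congruence \<Sigma> R"
    using reversing_square_sound[OF map_f square[OF assms] assms] .
  then show ?thesis using word_class_eq_iff[OF word_congruence_lists] by blast
qed

lemma carrierE:
  assumes "x \<in> carrier P"
  obtains u where "u \<in> lists \<Sigma>" "x = cl u"
  using assms unfolding carrier_presented_monoid by blast

lemma left_divides_cl_iff:
  assumes "u \<in> lists \<Sigma>" "w \<in> lists \<Sigma>"
  shows "left_divides P (cl u) (cl w) \<longleftrightarrow> word_cpl f w u = []"
proof
  assume "left_divides P (cl u) (cl w)"
  then obtain z where z: "z \<in> carrier P" "cl u \<otimes>\<^bsub>P\<^esub> z = cl w" unfolding left_divides_def by blast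
  obtain x where x: "x \<in> lists \<Sigma>" "z = cl x" using carrierE[OF z(1)] .
  have ux: "u @ x \<in> lists \<Sigma>" using assms x by simp
  have "cl w = cl (u @ x)" using z x assms by (simp add: mult_word_class)
  then have "word_equiv f w (u @ x)" using cl_eq_iff[OF assms(2) ux] by simp
  from word_equiv_cpl_left[OF this assms(2) ux assms(1)]
  have "word_equiv f (word_cpl f w u) []"
    using assms x by (simp add: word_cpl_append_left word_cpl_self)
  then show "word_cpl f w u = []" by (rule word_equiv_Nil)
next
  assume "word_cpl f w u = []"
  then have "cl u \<otimes>\<^bsub>P\<^esub> cl (word_cpl f u w) = cl w"
    using cl_lcm[OF assms] mult_word_class[OF assms(1) closed[OF assms]] by simp
  then show "left_divides P (cl u) (cl w)"
    using word_class_in_carrier[OF assms(1), of R] word_class_in_carrier[OF assms(2), of R]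
      word_class_in_carrier[OF closed[OF assms], of R] unfolding left_divides_def by blast
qed

text \<open>A common multiple \<open>w\<close> of \<open>u\<close> and \<open>v\<close> satisfies \<open>w \ u = w \ v = \<epsilon>\<close>; the cube property then yields
  \<open>(u \ w) \ (u \ v) = \<epsilon>\<close>, hence \<open>w \ (u (u \ v)) = \<epsilon>\<close>.\<close>

lemma is_right_lcm_cl:
  assumes u: "u \<in> lists \<Sigma>" and v: "v \<in> lists \<Sigma>"
  shows "is_right_lcm P (cl u) (cl v) (cl (u @ word_cpl f u v))"
  unfolding is_right_lcm_def
proof (intro conjI allI impI)
  have dvd: "left_divides P (cl u) (cl (u @ word_cpl f u v))"
    if "u \<in> lists \<Sigma>" "v \<in> lists \<Sigma>" for u v
    using that closed by (subst left_divides_cl_iff) (auto simp: word_cpl_append_left word_cpl_self)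
  show "left_divides P (cl u) (cl (u @ word_cpl f u v))" using dvd[OF u v] .
  show "left_divides P (cl v) (cl (u @ word_cpl f u v))"
    using dvd[OF v u] cl_lcm[OF u v] by simp
  fix n assume n: "left_divides P (cl u) n \<and> left_divides P (cl v) n"
  then have "n \<in> carrier P" unfolding left_divides_def by blast
  then obtain w where w: "w \<in> lists \<Sigma>" "n = cl w" by (rule carrierE)
  have *: "word_cpl f w u = []" "word_cpl f w v = []"
    using n w u v left_divides_cl_iff by auto
  have "word_equiv f (word_cpl f (word_cpl f u w) (word_cpl f u v)) []"
    using cube[OF u w(1) v] * by simp
  then have "word_cpl f w (u @ word_cpl f u v) = []"
    using word_cpl_append_right[OF u closed[OF u v] w(1)] * word_equiv_Nil by simp
  moreover have "u @ word_cpl f u v \<in> lists \<Sigma>" using u closed[OF u v] by simp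
  ultimately show "left_divides P (cl (u @ word_cpl f u v)) n"
    using left_divides_cl_iff w by blast
qed

sublocale lcm_monoid P
proof (intro lcm_monoid.intro lcm_monoid_axioms.intro monoid_presented_monoid)
  fix x y z assume eq: "x \<otimes>\<^bsub>P\<^esub> y = x \<otimes>\<^bsub>P\<^esub> z"
    and xyz: "x \<in> carrier P" "y \<in> carrier P" "z \<in> carrier P"
  obtain u where u: "u \<in> lists \<Sigma>" "x = cl u" using carrierE[OF xyz(1)] .
  obtain v where v: "v \<in> lists \<Sigma>" "y = cl v" using carrierE[OF xyz(2)] .
  obtain w where w: "w \<in> lists \<Sigma>" "z = cl w" using carrierE[OF xyz(3)] .
  have l: "u @ v \<in> lists \<Sigma>" "u @ w \<in> lists \<Sigma>" using u v w by auto
  have "cl (u @ v) = cl (u @ w)"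
    using eq u v w by (simp add: mult_word_class)
  then have "word_equiv f (u @ v) (u @ w)" using cl_eq_iff[OF l] by simp
  then have "word_cpl f (u @ v) (u @ w) = []" "word_cpl f (u @ w) (u @ v) = []"
    using word_equiv_iff[OF l] by auto
  moreover have "word_cpl f (u @ p) (u @ q) = word_cpl f p q" if "p \<in> lists \<Sigma>" "q \<in> lists \<Sigma>" for p q
    using that u by (simp add: word_cpl_append_left word_cpl_append_right word_cpl_self)
  ultimately have "word_equiv f v w" using word_equiv_iff[OF v(1) w(1)] v w by simp
  then show "y = z" using cl_eq_iff v w by simp
next
  fix x y assume eq: "x \<otimes>\<^bsub>P\<^esub> y = \<one>\<^bsub>P\<^esub>" and xy: "x \<in> carrier P" "y \<in> carrier P"
  obtain u where u: "u \<in> lists \<Sigma>" "x = cl u" using carrierE[OF xy(1)] .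
  obtain v where v: "v \<in> lists \<Sigma>" "y = cl v" using carrierE[OF xy(2)] .
  have "cl (u @ v) = cl []"
    using eq u v by (simp add: mult_word_class one_presented_monoid)
  then have "word_equiv f (u @ v) []" using cl_eq_iff[of "u @ v" "[]"] u v by simp
  then have "u @ v = []" by (rule word_equiv_Nil)
  then show "x = \<one>\<^bsub>P\<^esub>" using u by (simp add: one_presented_monoid)
next
  fix x y assume xy: "x \<in> carrier P" "y \<in> carrier P"
  obtain u where u: "u \<in> lists \<Sigma>" "x = cl u" using carrierE[OF xy(1)] .
  obtain v where v: "v \<in> lists \<Sigma>" "y = cl v" using carrierE[OF xy(2)] .
  show "\<exists>m. is_right_lcm P x y m" using is_right_lcm_cl u v by blast
qed

lemma rc_cl:
  assumes "u \<in> lists \<Sigma>" "v \<in> lists \<Sigma>"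
  shows "rc (cl u) (cl v) = cl (word_cpl f u v)"
proof (rule rc_eqI)
  have "is_right_lcm P (cl u) (cl v) (cl u \<otimes>\<^bsub>P\<^esub> cl (word_cpl f u v))"
    using is_right_lcm_cl[OF assms] mult_word_class[OF assms(1) closed[OF assms]] by simp
  then show "is_lcm_complement P (cl u) (cl v) (cl (word_cpl f u v))"
    using word_class_in_carrier[OF closed[OF assms]] unfolding is_lcm_complement_def by blast
qed

sublocale reversing_model P "\<lambda>a. cl [a]" \<Sigma> f
proof
  show "generates P ((\<lambda>a. cl [a]) ` \<Sigma>)" by (rule generates_presented_monoid)
  fix u v assume uv: "u \<in> lists \<Sigma>" "v \<in> lists \<Sigma>"
  have "word_complement f u v = Some (word_cpl f u v)"
    using word_complement_eq_Some_iff square[OF uv] by blast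
  then show "\<exists>w\<in>lists \<Sigma>. word_complement f u v = Some w \<and>
      mprod P (map (\<lambda>a. cl [a]) w) = rc (mprod P (map (\<lambda>a. cl [a]) u)) (mprod P (map (\<lambda>a. cl [a]) v))"
    using closed[OF uv] mprod_presented_monoid[OF uv(1)] mprod_presented_monoid[OF uv(2)]
      mprod_presented_monoid[OF closed[OF uv]] rc_cl[OF uv]
    by (intro bexI[of _ "word_cpl f u v"]) simp_all
qed

lemma lcm_selector: "lcm_selector P (\<lambda>a. cl [a]) \<Sigma> f"
  unfolding lcm_selector_def
proof (intro conjI ballI allI impI)
  show "generates P ((\<lambda>a. cl [a]) ` \<Sigma>)" by (rule generates_presented_monoid)
  show "partial_word_map \<Sigma> f" by (rule map_f)
  fix a b z assume ab: "a \<in> \<Sigma>" "b \<in> \<Sigma>" and z: "is_lcm_complement P (cl [a]) (cl [b]) z"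
  have l: "[a] \<in> lists \<Sigma>" "[b] \<in> lists \<Sigma>" using ab by auto
  have "z = cl (word_cpl f [a] [b])" using rc_eqI[OF z] rc_cl[OF l] by simp
  moreover have "f a b = Some (word_cpl f [a] [b])"
    using reversing_square_letters_defined[OF square[OF l]] by simp
  ultimately show "\<exists>w. f a b = Some w \<and> mprod P (map (\<lambda>a. cl [a]) w) = z"
    using mprod_presented_monoid[OF closed[OF l]] by simp
qed

end

theorem mainTheorem3:
  shows
    "(\<forall>(M :: ('m, 'x) monoid_scheme) \<Sigma> f.
        garside_monoid M \<and> generates M \<Sigma> \<and> finite \<Sigma> \<and> \<Sigma> \<noteq> {} \<and> \<one>\<^bsub>M\<^esub> \<notin> \<Sigma> \<and>
        lcm_selector M (\<lambda>a. a) \<Sigma> f \<longrightarrow>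
          reversing_function \<Sigma> f \<and> garside_conditions \<Sigma> f \<and>
          admits_presentation M (\<lambda>a. a) \<Sigma> (complement_relations f)) \<and>
     (\<forall>(\<Sigma> :: 'a set) f.
        reversing_function \<Sigma> f \<and> garside_conditions \<Sigma> f \<longrightarrow>
          garside_monoid (presented_monoid \<Sigma> (complement_relations f)) \<and>
          lcm_selector (presented_monoid \<Sigma> (complement_relations f))
            (\<lambda>a. word_class \<Sigma> (complement_relations f) [a]) \<Sigma> f)"
proof (intro conjI allI impI)
  fix M :: "('m, 'x) monoid_scheme" and \<Sigma> f
  assume asm: "garside_monoid M \<and> generates M \<Sigma> \<and> finite \<Sigma> \<and> \<Sigma> \<noteq> {} \<and> \<one>\<^bsub>M\<^esub> \<notin> \<Sigma> \<and>
    lcm_selector M (\<lambda>a. a) \<Sigma> f"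
  then have g: "gaussian_monoid M" by (simp add: garside_monoid_def)
  then have "monoid M" by (simp add: gaussian_monoid_def atomic_monoid_def)
  with g asm interpret gaussian_selector M \<Sigma> f
    by (intro gaussian_selector.intro gaussian.intro gaussian_axioms.intro
        gaussian_selector_axioms.intro) simp_all
  show "reversing_function \<Sigma> f" using reversing_function asm by blast
  show "garside_conditions \<Sigma> f"
    using garside_conditions asm unfolding garside_monoid_def by blast
  show "admits_presentation M (\<lambda>a. a) \<Sigma> (complement_relations f)"
    by (rule admits_complemented_presentation)
next
  fix \<Sigma> :: "'a set" and f
  assume asm: "reversing_function \<Sigma> f \<and> garside_conditions \<Sigma> f"
  then obtain T where T: "is_closure \<Sigma> (word_complement f) ((\<lambda>a. [a]) ` \<Sigma>) T"
    "cube_property f (Some ` T)"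
    unfolding garside_conditions_def by blast
  then interpret reversing_cube \<Sigma> f T
    using asm unfolding is_closure_def by unfold_locales simp_all
  have "\<Sigma> \<noteq> {}" using asm by (simp add: reversing_function_def)
  then show "garside_monoid (presented_monoid \<Sigma> (complement_relations f))"
    using garside_monoid_if_garside_conditions asm by blast
  show "lcm_selector (presented_monoid \<Sigma> (complement_relations f))
      (\<lambda>a. word_class \<Sigma> (complement_relations f) [a]) \<Sigma> f"
    by (rule lcm_selector)
qed

end
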